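(* For every $r\in\left(0,\frac{\pi}{2}\right)$, when $t\to0$, $$p_t(r,0)\sim\frac{r}{\sin r}\sqrt{\frac{1}{1-r\cot r}}\;\frac{\sqrt{\pi}\,e^{-\frac{r^2}{4t}}}{4t^{3/2}}.$$
   Context: Here $a(t)\sim b(t)$ means $a(t)/b(t)\to1$. $\mathbf{SU}(2)$ is the group of $2\times2$ complex unitary matrices of determinant $1$. Let $X,Y,Z$ be the left-invariant vector fields on $\mathbf{SU}(2)$ corresponding to the elements $\begin{pmatrix}0&1\\-1&0\end{pmatrix}$, $\begin{pmatrix}0&i\\i&0\end{pmatrix}$, $\begin{pmatrix}i&0\\0&-i\end{pmatrix}$ of its Lie algebra; they satisfy $[Z,X]=2Y$, $[X,Y]=2Z$, $[Y,Z]=2X$. Put $\mathcal L=X^2+Y^2$ (a subelliptic operator). Cylindric coordinates $(r,\theta,z)$, $0\le r<\pi/2$, $\theta\in[0,2\pi]$, $z\in[-\pi,\pi]$, are given by $$(r,\theta,z)\mapsto \exp(r\cos\theta\,X+r\sin\theta\,Y)\exp(zZ).$$ The normalized bi-invariant Haar measure is $d\mu=\frac{1}{4\pi^2}\sin 2r\,dr\,d\theta\,dz$. The semigroup $P_t=e^{t\mathcal L}$ has a smooth kernel with respect to $\mu$; the heat kernel issued from the identity, i.e. the function $p_t$ with $(P_tf)(\text{identity})=\int p_t f\,d\mu$, depends only on $(r,z)$ and is written $p_t(r,z)$. *)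

theory Defs
  imports "HOL-Analysis.Analysis" "HOL-Library.Landau_Symbols"
begin

section \<open>The group SU(2)\<close>

type_synonym mat2 = "complex^2^2"

definition cadjoint :: "mat2 \<Rightarrow> mat2" where
  "cadjoint A = (\<chi> i j. cnj (A $ j $ i))"

lemma cadjoint_mult: "cadjoint (A ** B) = cadjoint B ** cadjoint A"
  by (simp add: cadjoint_def matrix_matrix_mult_def vec_eq_iff sum_2 mult.commute)

lemma cadjoint_one: "cadjoint (mat 1) = mat 1"
  by (auto simp: cadjoint_def mat_def vec_eq_iff)

typedef SU2 = "{A :: mat2. A ** cadjoint A = mat 1 \<and> cadjoint A ** A = mat 1 \<and> det A = 1}"
  morphisms mat_of Abs_SU2
  by (rule exI[of _ "mat 1"]) (simp add: cadjoint_one)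

setup_lifting type_definition_SU2

instantiation SU2 :: monoid_mult
begin

lift_definition one_SU2 :: SU2 is "mat 1"
  by (simp add: cadjoint_one)

lift_definition times_SU2 :: "SU2 \<Rightarrow> SU2 \<Rightarrow> SU2" is "(**)"
proof -
  fix A B :: mat2
  assume A: "A ** cadjoint A = mat 1 \<and> cadjoint A ** A = mat 1 \<and> det A = 1"
    and B: "B ** cadjoint B = mat 1 \<and> cadjoint B ** B = mat 1 \<and> det B = 1"
  have "(A ** B) ** cadjoint (A ** B) = A ** (B ** cadjoint B) ** cadjoint A"
    "cadjoint (A ** B) ** (A ** B) = cadjoint B ** (cadjoint A ** A) ** B"
    by (simp_all only: cadjoint_mult matrix_mul_assoc)
  then show "(A ** B) ** cadjoint (A ** B) = mat 1 \<and>
      cadjoint (A ** B) ** (A ** B) = mat 1 \<and> det (A ** B) = 1"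
    using A B by (simp add: det_mul)
qed

instance
  by standard (transfer, simp add: matrix_mul_assoc)+

end

text \<open>The topology is the one induced from the space of matrices.\<close>

instantiation SU2 :: metric_space
begin

definition dist_SU2 :: "SU2 \<Rightarrow> SU2 \<Rightarrow> real" where
  "dist_SU2 g h = dist (mat_of g) (mat_of h)"

definition uniformity_SU2 :: "(SU2 \<times> SU2) filter" where
  "uniformity_SU2 = (INF e\<in>{0<..}. principal {(g, h). dist g h < e})"

definition open_SU2 :: "SU2 set \<Rightarrow> bool" where
  "open_SU2 U = (\<forall>x\<in>U. \<forall>\<^sub>F (x', y) in uniformity. x' = x \<longrightarrow> y \<in> U)"

instance
proof
  fix x y z :: SU2
  show "dist x y = 0 \<longleftrightarrow> x = y"
    by (simp add: dist_SU2_def mat_of_inject)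
  show "dist x y \<le> dist x z + dist y z"
    by (simp add: dist_SU2_def dist_triangle2)
qed (simp_all add: uniformity_SU2_def open_SU2_def)

end

section \<open>Exponential map and cylindric coordinates\<close>

text \<open>The library's \<open>exp\<close> is not available for \<open>mat2\<close>, whose class-level product is entrywise.\<close>

definition mat_exp :: "mat2 \<Rightarrow> mat2" where
  "mat_exp A = (\<Sum>n. (1 / fact n) *\<^sub>R (((**) A ^^ n) (mat 1)))"

definition X_su2 :: mat2 where
  "X_su2 = vector [vector [0, 1], vector [-1, 0]]"

definition Y_su2 :: mat2 where
  "Y_su2 = vector [vector [0, \<i>], vector [\<i>, 0]]"

definition Z_su2 :: mat2 where
  "Z_su2 = vector [vector [\<i>, 0], vector [0, - \<i>]]"

definition exp_SU2 :: "mat2 \<Rightarrow> SU2" where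
  "exp_SU2 A = Abs_SU2 (mat_exp A)"

text \<open>\<open>exp_SU2\<close> is only meaningful on the Lie algebra; there \<open>mat_exp\<close> does land in the group:\<close>

lemma mat_exp_closed_form:
  fixes a b c :: real
  defines "A \<equiv> a *\<^sub>R X_su2 + b *\<^sub>R Y_su2 + c *\<^sub>R Z_su2"
    and "\<rho> \<equiv> sqrt (a\<^sup>2 + b\<^sup>2 + c\<^sup>2)"
  shows "mat_exp A = cos \<rho> *\<^sub>R mat 1 + (sin \<rho> / \<rho>) *\<^sub>R A"
proof -
  define M where "M n = ((**) A ^^ n) (mat 1)" for n
  have rho2: "\<rho>\<^sup>2 = a\<^sup>2 + b\<^sup>2 + c\<^sup>2"
    by (simp add: \<rho>_def)
  have M_Suc: "M (Suc n) = A ** M n" for n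
    by (simp add: M_def)
  have A2: "A ** A = (- (\<rho>\<^sup>2)) *\<^sub>R mat 1"
    unfolding rho2
    by (simp add: A_def X_su2_def Y_su2_def Z_su2_def matrix_matrix_mult_def mat_def
        vec_eq_iff sum_2 forall_2 complex_eq_iff power2_eq_square algebra_simps)
  have scale: "A ** (k *\<^sub>R B) = k *\<^sub>R (A ** B)" for k :: real and B :: mat2
    by (simp add: matrix_matrix_mult_def vec_eq_iff scaleR_sum_right)
  have M_even: "M (2 * k) = ((-1) ^ k * \<rho> ^ (2 * k)) *\<^sub>R mat 1" for k
  proof (induction k)
    case 0
    show ?case by (simp add: M_def)
  next
    case (Suc k)
    have "M (2 * Suc k) = A ** (A ** M (2 * k))"
      by (simp add: M_Suc)
    also have "\<dots> = ((-1) ^ k * \<rho> ^ (2 * k)) *\<^sub>R (A ** A)"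
      by (simp add: Suc scale)
    finally show ?case
      by (simp add: A2 power2_eq_square)
  qed
  have M_odd: "M (Suc (2 * k)) = ((-1) ^ k * \<rho> ^ (2 * k)) *\<^sub>R A" for k
    by (simp add: M_Suc M_even scale)
  have "(\<lambda>n. (1 / fact n) *\<^sub>R M n) sums (cos \<rho> *\<^sub>R mat 1 + (sin \<rho> / \<rho>) *\<^sub>R A)"
  proof (cases "\<rho> = 0")
    case True
    then have "A = 0"
      using rho2 by (simp add: A_def sum_power2_eq_zero_iff add_nonneg_eq_0_iff)
    have "M n = 0" if "n \<noteq> 0" for n
      using that \<open>A = 0\<close> by (cases n) (simp_all add: M_Suc)
    then have "(\<lambda>n. (1 / fact n) *\<^sub>R M n) sums (\<Sum>n\<in>{0}. (1 / fact n) *\<^sub>R M n)"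
      by (intro sums_finite) auto
    then show ?thesis
      using True by (simp add: M_def)
  next
    case False
    have term_eq: "(1 / fact n) *\<^sub>R M n =
        (cos_coeff n *\<^sub>R \<rho> ^ n) *\<^sub>R mat 1 + ((sin_coeff n *\<^sub>R \<rho> ^ n) / \<rho>) *\<^sub>R A" for n
    proof (cases "even n")
      case True
      then obtain k where "n = 2 * k" by (elim evenE)
      then show ?thesis by (simp add: M_even cos_coeff_def sin_coeff_def)
    next
      case odd: False
      then obtain k where "n = Suc (2 * k)" by (elim oddE) simp
      then show ?thesis
        using False by (simp add: M_odd cos_coeff_def sin_coeff_def)
    qed
    show ?thesis
      unfolding term_eq
      by (intro sums_add bounded_linear.sums[OF bounded_linear_scaleR_left]
          sums_divide cos_converges sin_converges)
  qed
  then show ?thesis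
    unfolding mat_exp_def M_def by (rule sums_unique[symmetric])
qed

lemma mat_of_exp_SU2:
  "mat_of (exp_SU2 (a *\<^sub>R X_su2 + b *\<^sub>R Y_su2 + c *\<^sub>R Z_su2)) =
    mat_exp (a *\<^sub>R X_su2 + b *\<^sub>R Y_su2 + c *\<^sub>R Z_su2)"
proof -
  define \<rho> where "\<rho> = sqrt (a\<^sup>2 + b\<^sup>2 + c\<^sup>2)"
  define s where "s = sin \<rho> / \<rho>"
  define u where "u = cos \<rho>"
  have "s\<^sup>2 * (a\<^sup>2 + b\<^sup>2 + c\<^sup>2) = (sin \<rho>)\<^sup>2"
  proof (cases "\<rho> = 0")
    case False
    have "a\<^sup>2 + b\<^sup>2 + c\<^sup>2 = \<rho>\<^sup>2" by (simp add: \<rho>_def)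
    then show ?thesis using False by (simp add: s_def power_divide)
  qed (simp add: s_def)
  then have norm1: "u * u + s * s * (a * a + b * b + c * c) = 1"
    by (simp add: u_def power2_eq_square[symmetric])
  have E: "mat_exp (a *\<^sub>R X_su2 + b *\<^sub>R Y_su2 + c *\<^sub>R Z_su2) =
      u *\<^sub>R mat 1 + s *\<^sub>R (a *\<^sub>R X_su2 + b *\<^sub>R Y_su2 + c *\<^sub>R Z_su2)" (is "_ = ?B")
    unfolding u_def s_def \<rho>_def by (rule mat_exp_closed_form)
  have "?B ** cadjoint ?B = mat 1 \<and> cadjoint ?B ** ?B = mat 1 \<and> det ?B = 1"
    using norm1
    by (simp add: X_su2_def Y_su2_def Z_su2_def matrix_matrix_mult_def mat_def cadjoint_def
        det_2 vec_eq_iff sum_2 forall_2 complex_eq_iff algebra_simps)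
  then show ?thesis
    by (simp add: exp_SU2_def E Abs_SU2_inverse)
qed

definition cylindric :: "real \<Rightarrow> real \<Rightarrow> real \<Rightarrow> SU2" where
  "cylindric r \<theta> z =
     exp_SU2 ((r * cos \<theta>) *\<^sub>R X_su2 + (r * sin \<theta>) *\<^sub>R Y_su2) * exp_SU2 (z *\<^sub>R Z_su2)"

text \<open>Normalized Haar measure, as the image of its density in cylindric coordinates.\<close>

definition haar_SU2 :: "SU2 measure" where
  "haar_SU2 =
     distr
       (density lborel (\<lambda>(r, \<theta>, z).
          ennreal (sin (2 * r) / (4 * pi\<^sup>2)) *
          indicator ({0..<pi / 2} \<times> {0..2 * pi} \<times> {- pi..pi}) (r, \<theta>, z)))
       borel (\<lambda>(r, \<theta>, z). cylindric r \<theta> z)"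

section \<open>Smooth functions and the subelliptic operator\<close>

primrec C_k :: "nat \<Rightarrow> ('a::real_normed_vector \<Rightarrow> real) \<Rightarrow> bool" where
  "C_k 0 f \<longleftrightarrow> continuous_on UNIV f"
| "C_k (Suc k) f \<longleftrightarrow>
     (\<forall>x. f differentiable (at x)) \<and> (\<forall>v. C_k k (\<lambda>x. frechet_derivative f (at x) v))"

text \<open>
  SU(2) is a closed submanifold of the real vector space \<open>mat2\<close>, so its smooth functions
  are exactly the restrictions of smooth functions on \<open>mat2\<close>.
\<close>

definition smooth_SU2 :: "(SU2 \<Rightarrow> real) \<Rightarrow> bool" where
  "smooth_SU2 f \<longleftrightarrow> (\<exists>F :: mat2 \<Rightarrow> real. (\<forall>k. C_k k F) \<and> (\<forall>g. f g = F (mat_of g)))"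

definition left_inv_field :: "mat2 \<Rightarrow> (SU2 \<Rightarrow> real) \<Rightarrow> (SU2 \<Rightarrow> real)" where
  "left_inv_field V f = (\<lambda>g. deriv (\<lambda>s. f (g * exp_SU2 (s *\<^sub>R V))) 0)"

definition subLaplacian :: "(SU2 \<Rightarrow> real) \<Rightarrow> (SU2 \<Rightarrow> real)" where
  "subLaplacian f = (\<lambda>g.
     left_inv_field X_su2 (left_inv_field X_su2 f) g +
     left_inv_field Y_su2 (left_inv_field Y_su2 f) g)"

section \<open>Heat semigroup and heat kernel\<close>

instance bcontfun :: (metric_space, banach) banach ..

definition C0_semigroup :: "(real \<Rightarrow> ('a::banach \<Rightarrow>\<^sub>L 'a)) \<Rightarrow> bool" where
  "C0_semigroup P \<longleftrightarrow>
     P 0 = id_blinfun \<and>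
     (\<forall>s\<ge>0. \<forall>t\<ge>0. P (s + t) = P s o\<^sub>L P t) \<and>
     (\<forall>f. ((\<lambda>t. blinfun_apply (P t) f) \<longlongrightarrow> f) (at_right 0))"

text \<open>The graph of the infinitesimal generator.\<close>

definition generator :: "(real \<Rightarrow> ('a::banach \<Rightarrow>\<^sub>L 'a)) \<Rightarrow> ('a \<times> 'a) set" where
  "generator P = {(f, h). ((\<lambda>t. (blinfun_apply (P t) f - f) /\<^sub>R t) \<longlongrightarrow> h) (at_right 0)}"

text \<open>
  \<open>P t = exp (t L)\<close>, acting on the Banach space of continuous functions on SU(2) with the
  supremum norm: the strongly continuous semigroup generated by the closure of \<open>L\<close>
  on smooth functions. As usual, a semigroup is determined by its generator, so there is at
  most one such \<open>P\<close> (up to its irrelevant values at negative times).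
\<close>

definition heat_semigroup :: "(real \<Rightarrow> ((SU2 \<Rightarrow>\<^sub>C real) \<Rightarrow>\<^sub>L (SU2 \<Rightarrow>\<^sub>C real))) \<Rightarrow> bool" where
  "heat_semigroup P \<longleftrightarrow>
     C0_semigroup P \<and>
     generator P = closure {(f, h). smooth_SU2 (apply_bcontfun f) \<and>
                                    apply_bcontfun h = subLaplacian (apply_bcontfun f)}"

text \<open>\<open>p\<close> is the smooth kernel issued from the identity.\<close>

definition heat_kernel ::
  "(real \<Rightarrow> ((SU2 \<Rightarrow>\<^sub>C real) \<Rightarrow>\<^sub>L (SU2 \<Rightarrow>\<^sub>C real))) \<Rightarrow> (real \<Rightarrow> SU2 \<Rightarrow> real) \<Rightarrow> bool" where
  "heat_kernel P p \<longleftrightarrow>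
     (\<forall>t>0. smooth_SU2 (p t) \<and>
        (\<forall>f. apply_bcontfun (blinfun_apply (P t) f) 1 =
             (\<integral>g. p t g * apply_bcontfun f g \<partial>haar_SU2)))"

end

theory Submission
  imports Defs "HOL-Probability.Probability" "HOL-Real_Asymp.Real_Asymp"
begin

text \<open>Write \<open>a\<close> and \<open>b\<close> for the entries of the first row of a matrix in SU(2). In cylindric coordinates
\<open>a = cos r e\<^sup>i\<^sup>z\<close> and \<open>b = sin r e\<^sup>i\<^sup>(\<^sup>\<theta>\<^sup>-\<^sup>z\<^sup>)\<close>, and Haar measure projects to the normalized area of the disc of
the \<open>a\<close>. The proof has two halves: an explicit series for the heat kernel as a function of \<open>a\<close>, and
the Laplace method for that series at \<open>a = cos r\<close>.

For the first half, \<open>\<L>\<close> sends \<open>a\<^sup>i (cnj a)\<^sup>j b\<^sup>k\<close> to \<open>-\<lambda>\<close> times itself plus \<open>4ij\<close> times the monomial with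
\<open>i\<close> and \<open>j\<close> lowered by one (\<open>subLaplacian_cmono\<close>). So the numbers \<open>(P\<^sub>t M)(1)\<close>, for all monomials \<open>M\<close>, satisfy a
triangular system of linear differential equations. It has only one solution, and that solution is
explicit (\<open>heat_semigroup_cmono\<close>); differentiating \<open>P\<^sub>t M\<close> from the left needs that \<open>P\<close> is locally
bounded, hence the uniform boundedness principle. On the other hand the disc (Zernike) polynomials
\<open>disc_poly i j\<close> are orthogonal eigenfunctions of \<open>\<L>\<close>, and the series
\<open>\<Sum>(i+j+1) e\<^sup>-\<^sup>\<lambda>\<^sup>t disc_poly i j\<close> has exactly the same integrals against all monomials
(\<open>haar_disc_kernel_cmono\<close>). Monomials span a dense space by Stone and Weierstrass, so this series is the
heat kernel (\<open>heat_kernel_eq_disc_kernel\<close>).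

For the second half, note that \<open>\<L>\<close> is the Laplacian of the three-sphere minus \<open>Z\<^sup>2\<close>. Since
\<open>exp (n\<^sup>2 t)\<close> is the Gaussian average of \<open>cosh (n y)\<close>, the series at \<open>a = cos r\<close> is the Gaussian average,
with variance \<open>2t\<close> in \<open>y\<close>, of the Riemannian heat kernel of the sphere at \<open>cos r cosh y\<close>
(\<open>disc_kernel_eq_Gaussian_integral\<close>). Here the argument may exceed 1, which means that the distance from
the identity becomes imaginary. The Riemannian kernel is a theta series; Poisson summation rewrites it
so that at distance \<open>d\<close>, real and at most \<open>\<pi> / 2\<close> or imaginary, it is
\<open>\<surd>\<pi> e\<^sup>t / (4 t\<^sup>3\<^sup>/\<^sup>2) \<cdot> d / sin d \<cdot> exp (- d\<^sup>2 / (4 t))\<close> with a relative error that is exponentially small uniformly in \<open>d\<close> (\<open>theta_expansion\<close>, \<open>radial_kernel_small_time\<close>).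

What remains is a Laplace integral with phase \<open>y\<^sup>2 + d(y)\<^sup>2\<close>, where \<open>cos d(y) = cos r cosh y\<close>. Its only minimum is
\<open>r\<^sup>2\<close>, at \<open>y = 0\<close>, with second-order coefficient \<open>1 - r cot r\<close> (\<open>phase_quadratic_limit\<close>), and it stays
above \<open>r\<^sup>2\<close> by a multiple of \<open>ln (cosh y)\<close> (\<open>phase_lower_bound\<close>). After the substitution \<open>y = \<surd>t u\<close> the
dominated convergence theorem applies (\<open>Gaussian_integral_Laplace\<close>): the limiting Gaussian
\<open>exp (- (1 - r cot r) u\<^sup>2 / 4)\<close> gives the square root in the statement and \<open>d / sin d\<close> at \<open>d = r\<close> gives the factor \<open>r / sin r\<close>.\<close>

section \<open>Disc polynomials and Chebyshev polynomials\<close>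

text \<open>At \<open>w = cnj z\<close> these are the disc (Zernike) polynomials; the indices record the powers of \<open>z\<close> and \<open>w\<close> in the
leading term. The recursion is the part of bidegree \<open>(i, j)\<close> of the three-term recursion of the
Chebyshev polynomials at \<open>(z + w) / 2\<close>; all their properties follow from it by induction. Keeping \<open>z\<close> and \<open>w\<close> independent allows \<open>z = k e\<^sup>y\<close>, \<open>w = k e\<^sup>-\<^sup>y\<close> with real \<open>y\<close>.\<close>

fun disc_poly :: "nat \<Rightarrow> nat \<Rightarrow> 'a::comm_ring_1 \<Rightarrow> 'a \<Rightarrow> 'a" where
  "disc_poly 0 0 z w = 1"
| "disc_poly (Suc i) 0 z w = z * disc_poly i 0 z w"
| "disc_poly 0 (Suc j) z w = w * disc_poly 0 j z w"
| "disc_poly (Suc i) (Suc j) z w = z * disc_poly i (Suc j) z w + w * disc_poly (Suc i) j z w - disc_poly i j z w"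

text \<open>The Chebyshev polynomials of the second kind. At half the trace, \<open>cheb_U m\<close> is the character of the
irreducible representation of SU(2) of dimension \<open>m + 1\<close>.\<close>

fun cheb_U :: "nat \<Rightarrow> 'a::comm_ring_1 \<Rightarrow> 'a" where
  "cheb_U 0 x = 1"
| "cheb_U (Suc 0) x = 2 * x"
| "cheb_U (Suc (Suc m)) x = 2 * x * cheb_U (Suc m) x - cheb_U m x"

lemma disc_poly_of_real:
  "disc_poly i j (of_real x) (of_real y) = (of_real (disc_poly i j x y) :: 'a::{real_algebra_1,comm_ring_1})"
  by (induction i j x y rule: disc_poly.induct) simp_all

lemma cheb_U_of_real: "cheb_U m (of_real x) = (of_real (cheb_U m x) :: 'a::{real_algebra_1,comm_ring_1})"
  by (induction m x rule: cheb_U.induct) simp_all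

text \<open>\<open>disc_poly i j\<close> is homogeneous of weight \<open>i - j\<close> under \<open>(z, w) \<mapsto> (u z, w / u)\<close>: the only inhomogeneous step of the
recursion drops the factor \<open>z w\<close>, which is invariant.\<close>

lemma disc_poly_torus:
  assumes "u * v = 1"
  shows "disc_poly i j (u * z) (v * w) = u ^ i * v ^ j * disc_poly i j z w"
proof (induction i j z w rule: disc_poly.induct)
  case (4 i j z w)
  have "u ^ Suc i * v ^ Suc j = (u * v) * (u ^ i * v ^ j)" by simp
  then have "u ^ Suc i * v ^ Suc j = u ^ i * v ^ j" using assms by simp
  moreover have "disc_poly (Suc i) (Suc j) (u * z) (v * w) =
    u ^ Suc i * v ^ Suc j * (z * disc_poly i (Suc j) z w + w * disc_poly (Suc i) j z w) - u ^ i * v ^ j * disc_poly i j z w"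
    using 4 by (simp add: algebra_simps)
  ultimately show ?case by (simp add: algebra_simps)
qed (simp_all add: algebra_simps)

lemma disc_poly_hyperbola:
  assumes "z * w = 1"
  shows "disc_poly i j z w = z ^ i * w ^ j"
proof -
  have "disc_poly i j 1 1 = (1::'a)"
    by (induction i j "1::'a" "1::'a" rule: disc_poly.induct) simp_all
  then show ?thesis
    using disc_poly_torus[OF assms, of i j 1 1] by simp
qed

text \<open>The decomposition of the character into weights: both sides satisfy the Chebyshev recursion.\<close>

lemma sum_disc_poly_eq_cheb_U:
  fixes x z w :: "'a::comm_ring_1"
  assumes "z + w = 2 * x"
  shows "(\<Sum>i\<le>m. disc_poly i (m - i) z w) = cheb_U m x"
  using assms
proof (induction m x rule: cheb_U.induct)
  case (3 m x)
  have e: "Suc (Suc m) - Suc i = Suc (m - i)" "Suc m - i = Suc (m - i)" if "i \<le> m" for i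
    using that by auto
  have "(\<Sum>i\<le>Suc (Suc m). disc_poly i (Suc (Suc m) - i) z w) =
      disc_poly 0 (Suc (Suc m)) z w + (\<Sum>i\<le>m. disc_poly (Suc i) (Suc (m - i)) z w) + disc_poly (Suc (Suc m)) 0 z w"
    by (subst sum.atMost_Suc_shift) (simp add: e)
  also have "(\<Sum>i\<le>m. disc_poly (Suc i) (Suc (m - i)) z w) =
      z * (\<Sum>i\<le>m. disc_poly i (Suc m - i) z w) + w * (\<Sum>i\<le>m. disc_poly (Suc i) (Suc m - Suc i) z w)
        - (\<Sum>i\<le>m. disc_poly i (m - i) z w)"
    by (simp add: sum_distrib_left sum.distrib sum_subtractf e)
  also have "(\<Sum>i\<le>m. disc_poly i (Suc m - i) z w) = (\<Sum>i\<le>Suc m. disc_poly i (Suc m - i) z w) - disc_poly (Suc m) 0 z w"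
    by simp
  also have "(\<Sum>i\<le>m. disc_poly (Suc i) (Suc m - Suc i) z w) = (\<Sum>i\<le>Suc m. disc_poly i (Suc m - i) z w) - disc_poly 0 (Suc m) z w"
    by (subst sum.atMost_Suc_shift[of _ m]) simp
  finally have "(\<Sum>i\<le>Suc (Suc m). disc_poly i (Suc (Suc m) - i) z w) =
      (z + w) * (\<Sum>i\<le>Suc m. disc_poly i (Suc m - i) z w) - (\<Sum>i\<le>m. disc_poly i (m - i) z w)"
    by (simp add: algebra_simps del: sum.atMost_Suc)
  then show ?case
    using 3 by (simp del: sum.atMost_Suc)
qed (simp_all add: add.commute)

text \<open>At the cosine of an angle a character is a sum of \<open>m + 1\<close> numbers of modulus 1.\<close>

lemma norm_cheb_U_le:
  assumes "\<bar>x\<bar> \<le> (1::real)"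
  shows "\<bar>cheb_U m x\<bar> \<le> m + 1"
proof -
  define z where "z = cis (arccos x)"
  have x: "cos (arccos x) = x" using assms by (intro cos_arccos) auto
  have zc: "z + cnj z = 2 * of_real x"
    by (simp add: z_def complex_eq_iff x)
  have zz: "z * cnj z = 1"
    by (simp add: z_def complex_norm_square[symmetric])
  have "of_real (cheb_U m x) = (\<Sum>i\<le>m. z ^ i * cnj z ^ (m - i))"
    by (simp add: cheb_U_of_real[symmetric] sum_disc_poly_eq_cheb_U[OF zc, symmetric] disc_poly_hyperbola[OF zz])
  also have "norm \<dots> \<le> (\<Sum>i\<le>m. 1)"
    by (rule sum_norm_le) (simp add: norm_mult norm_power z_def)
  finally show ?thesis by simp
qed

lemma cheb_U_cosh:
  fixes w :: complex
  shows "cheb_U m (cosh w) * sinh w = sinh (of_nat (m + 1) * w)"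
proof (induction m "cosh w" rule: cheb_U.induct)
  case 2
  show ?case using sinh_double[of w] by (simp add: mult_ac)
next
  case (3 m)
  have "sinh (of_nat (Suc (Suc m) + 1) * w) + sinh (of_nat (m + 1) * w) = 2 * cosh w * sinh (of_nat (Suc m + 1) * w)"
    using sinh_add[of "of_nat (Suc m + 1) * w" w] sinh_diff[of "of_nat (Suc m + 1) * w" w]
    by (simp add: algebra_simps)
  then show ?case using 3 by (simp add: algebra_simps)
qed simp

lemma integral_cis_period:
  "((\<lambda>x. cis (2 * pi * of_int k * x)) has_integral (if k = 0 then 1 else 0)) {0..1}"
proof (cases "k = 0")
  case True
  then show ?thesis using has_integral_const_real[of "1::complex" 0 1] by simp
next
  case False
  define c where "c = 2 * pi * of_int k"
  have "c \<noteq> 0" using False by (simp add: c_def)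
  have "((\<lambda>x. cis (c * x)) has_integral (cis (c * 1) / (\<i> * c) - cis (c * 0) / (\<i> * c))) {0..1}"
  proof (rule fundamental_theorem_of_calculus)
    fix x assume "x \<in> {0..1::real}"
    have "((\<lambda>z. exp (\<i> * c * z) / (\<i> * c)) has_field_derivative exp (\<i> * c * of_real x)) (at (of_real x))"
      using \<open>c \<noteq> 0\<close> by (auto intro!: derivative_eq_intros)
    from has_vector_derivative_real_field[OF this]
    show "((\<lambda>x. cis (c * x) / (\<i> * c)) has_vector_derivative cis (c * x)) (at x within {0..1})"
      by (simp add: cis_conv_exp mult.assoc has_vector_derivative_at_within)
  qed simp
  moreover have "cis c = 1"
    using cis_multiple_2pi[of "of_int k"] by (simp add: c_def mult_ac)
  ultimately show ?thesis using False by (simp add: c_def)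
qed

text \<open>For \<open>|u| = 1\<close> the disc polynomials at \<open>u a\<close> carry the weights \<open>u\<^sup>2\<^sup>i\<^sup>-\<^sup>m\<close>, so each of them is a Fourier coefficient
of \<open>u \<mapsto> cheb_U m (Re (u a))\<close> and inherits its bound. The crude bound from the recursion grows
exponentially in \<open>i + j\<close>, which the factors \<open>exp (- disc_eig i j 0 * t)\<close> with \<open>j = 0\<close> would not control.\<close>

lemma norm_disc_poly_le: 
  fixes a :: complex
  assumes "norm a \<le> 1" "i \<le> m"
  shows "norm (disc_poly i (m - i) a (cnj a)) \<le> m + 1"
proof -
  define c where "c l = disc_poly l (m - l) a (cnj a)" for l
  have bound: "norm (\<Sum>l\<le>m. c l * cis (of_int (2 * int l) * x)) \<le> m + 1" for x
  proof -
    define u where "u = cis x"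
    have uu: "u * cnj u = 1" by (simp add: u_def complex_norm_square[symmetric])
    have s: "u * a + cnj u * cnj a = 2 * of_real (Re (u * a))"
      using complex_add_cnj[of "u * a"] by simp
    have "u ^ m * of_real (cheb_U m (Re (u * a))) = (\<Sum>l\<le>m. u ^ m * (u ^ l * cnj u ^ (m - l) * c l))"
      unfolding cheb_U_of_real[symmetric] sum_disc_poly_eq_cheb_U[OF s, symmetric] disc_poly_torus[OF uu] c_def sum_distrib_left ..
    also have "\<dots> = (\<Sum>l\<le>m. c l * cis (of_int (2 * int l) * x))"
    proof (rule sum.cong)
      fix l assume "l \<in> {..m}"
      then have "u ^ m = u ^ l * u ^ (m - l)" by (simp add: power_add[symmetric])
      then have "u ^ m * (u ^ l * cnj u ^ (m - l) * c l) = (u ^ l * u ^ l) * (u * cnj u) ^ (m - l) * c l"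
        by (simp add: power_mult_distrib mult_ac)
      also have "u ^ l * u ^ l = cis (of_int (2 * int l) * x)"
        unfolding u_def Complex.DeMoivre cis_mult by (rule arg_cong[where f = cis]) simp
      finally show "u ^ m * (u ^ l * cnj u ^ (m - l) * c l) = c l * cis (of_int (2 * int l) * x)"
        by (simp add: uu)
    qed simp
    finally have e: "(\<Sum>l\<le>m. c l * cis (of_int (2 * int l) * x)) = u ^ m * of_real (cheb_U m (Re (u * a)))" ..
    have "\<bar>Re (u * a)\<bar> \<le> 1"
      using abs_Re_le_cmod[of "u * a"] assms(1) by (simp add: norm_mult u_def)
    from norm_cheb_U_le[OF this, of m] show ?thesis
      unfolding e by (simp add: norm_mult norm_power u_def)
  qed
  define g where "g x = (\<Sum>l\<le>m. c l * cis (of_int (2 * int l) * (pi * x))) * cis (- (2 * int i * (pi * x)))" for x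
  have g: "g x = (\<Sum>l\<le>m. c l * cis (2 * pi * of_int (int l - int i) * x))" for x
    unfolding g_def sum_distrib_right mult.assoc cis_mult
    by (intro sum.cong refl arg_cong2[where f = "(*)"] arg_cong[where f = cis]) (simp add: algebra_simps)
  have "(g has_integral (\<Sum>l\<le>m. c l * (if int l - int i = 0 then 1 else 0))) {0..1}"
    unfolding g by (intro has_integral_sum has_integral_mult_right integral_cis_period) simp
  also have "(\<Sum>l\<le>m. c l * (if int l - int i = 0 then 1 else 0)) = (\<Sum>l\<le>m. if l = i then c l else 0)"
    by (intro sum.cong) auto
  also have "\<dots> = c i" using assms by (simp)
  finally have int: "(g has_integral c i) (cbox 0 1)" by simp
  have "norm (c i) \<le> (m + 1) * measure lborel (cbox 0 (1::real))"
    by (rule has_integral_bound[OF _ int]) (use bound in \<open>auto simp: g_def norm_mult\<close>)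
  then show ?thesis by (simp add: c_def)
qed

text \<open>The partial sums telescope. With \<open>N = i + j + 1\<close> and \<open>k = min i j\<close> this is, up to a constant factor, the value
of \<open>disc_moment i j\<close> below at time 0.\<close>

lemma sum_disc_weights:
  assumes "k < N"
  shows "(\<Sum>d\<le>k. (real N - 2 * real d) / (fact d * fact (N - d))) = 1 / (fact k * fact (N - 1 - k))"
  using assms
proof (induction k)
  case 0
  then obtain n where "N = Suc n" by (cases N) auto
  moreover have "fact n + fact n * real n \<noteq> 0"
    by (metis fact_nonzero fact_Suc mult.commute distrib_left mult.right_neutral of_nat_Suc of_nat_fact)
  ultimately show ?case by (simp add: field_simps)
next
  case (Suc k)
  then obtain n where n: "N = Suc (Suc (k + n))" using less_imp_Suc_add by (metis add_Suc add_Suc_right)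
  have e: "Suc (Suc (k + n)) - Suc k = Suc n" "Suc (Suc (k + n)) - 1 - Suc k = n" "Suc (Suc (k + n)) - 1 - k = Suc n" by auto
  have "(\<Sum>d\<le>Suc k. (real N - 2 * real d) / (fact d * fact (N - d))) = 1 / (fact k * fact (Suc n)) + (real n - real k) / (fact (Suc k) * fact (Suc n))"
    using Suc unfolding n by (simp add: e del: fact_Suc)
  also have "\<dots> = 1 / (fact (Suc k) * fact n)"
  proof -
    have "1 / (a * ((1 + y) * b)) + (y - x) / (((1 + x) * a) * ((1 + y) * b)) = 1 / (((1 + x) * a) * b)"
      if "a \<noteq> 0" "b \<noteq> 0" "1 + x \<noteq> 0" "1 + y \<noteq> 0" for a b x y :: real
      using that by (simp add: divide_simps)
    from this[of "fact k" "fact n" "real k" "real n"] show ?thesis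
      by (simp add: of_nat_Suc)
  qed
  finally show ?case unfolding n e .
qed

section \<open>Poisson summation\<close>

text \<open>Test against the powers of \<open>w x = (1 + cos (2 \<pi> (x - s0))) / 2\<close>, which are trigonometric polynomials and
concentrate at \<open>s0\<close>. If \<open>f s0\<close> were not zero, the contribution of a neighbourhood of \<open>s0\<close> to \<open>\<integral> f w\<^sup>N\<close> would be at least
\<open>C q'\<^sup>N\<close> and the rest at most \<open>B q\<^sup>N\<close> with \<open>q < q'\<close>, so the integral could not vanish for large \<open>N\<close>. For
\<open>s0\<close> inside the interval \<open>w\<close> has its maximum at \<open>s0\<close> only; the endpoints follow by continuity.\<close>

lemma Fourier_coefficients_zero_imp_zero:
  fixes f :: "real \<Rightarrow> complex"
  assumes cont: "continuous_on {0..1} f"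
    and coeff: "\<And>k::int. ((\<lambda>x. f x * cis (2 * pi * of_int k * x)) has_integral 0) {0..1}"
    and s: "s \<in> {0..1}"
  shows "f s = 0"
proof -
  have interior: "f s0 = 0" if s0: "0 < s0" "s0 < 1" for s0
  proof (rule ccontr)
    assume nz: "f s0 \<noteq> 0"
    define w where "w x = (1 + cos (2 * pi * (x - s0))) / 2" for x :: real
    define a where "a = cis (2 * pi * s0)"
    have w_cis: "of_real (w x) * cis (2 * pi * of_int k * x) = cis (2 * pi * of_int k * x) / 2 +
        (cnj a / 4) * cis (2 * pi * of_int (k + 1) * x) + (a / 4) * cis (2 * pi * of_int (k - 1) * x)" for k x
    proof -
      have "of_real (w x) = 1 / 2 + (cis (2 * pi * (x - s0)) + cis (- (2 * pi * (x - s0)))) / 4"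
        by (simp add: w_def complex_eq_iff)
      moreover have "cis (2 * pi * (x - s0)) * cis (2 * pi * of_int k * x) = cnj a * cis (2 * pi * of_int (k + 1) * x)"
        unfolding a_def cis_cnj cis_mult by (rule arg_cong[where f = cis]) (simp add: algebra_simps)
      moreover have "cis (- (2 * pi * (x - s0))) * cis (2 * pi * of_int k * x) = a * cis (2 * pi * of_int (k - 1) * x)"
        unfolding a_def cis_cnj cis_mult by (rule arg_cong[where f = cis]) (simp add: algebra_simps)
      ultimately show ?thesis by (simp add: algebra_simps add_divide_distrib)
    qed
    have powers: "((\<lambda>x. f x * of_real (w x ^ N) * cis (2 * pi * of_int k * x)) has_integral 0) {0..1}" for N and k :: int
    proof (induction N arbitrary: k)
      case 0
      then show ?case using coeff by simp
    next
      case (Suc N)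
      have "((\<lambda>x. (f x * of_real (w x ^ N) * cis (2 * pi * of_int k * x)) * (1 / 2) +
          (f x * of_real (w x ^ N) * cis (2 * pi * of_int (k + 1) * x)) * (cnj a / 4) +
          (f x * of_real (w x ^ N) * cis (2 * pi * of_int (k - 1) * x)) * (a / 4)) has_integral
          (0 * (1 / 2) + 0 * (cnj a / 4) + 0 * (a / 4))) {0..1}"
        by (intro has_integral_add has_integral_mult_left Suc)
      moreover have "(\<lambda>x. (f x * of_real (w x ^ N) * cis (2 * pi * of_int k * x)) * (1 / 2) +
          (f x * of_real (w x ^ N) * cis (2 * pi * of_int (k + 1) * x)) * (cnj a / 4) +
          (f x * of_real (w x ^ N) * cis (2 * pi * of_int (k - 1) * x)) * (a / 4)) =
          (\<lambda>x. f x * of_real (w x ^ N) * (of_real (w x) * cis (2 * pi * of_int k * x)))"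
        unfolding w_cis by (rule ext) (simp add: algebra_simps add_divide_distrib)
      ultimately show ?case by (simp add: mult_ac)
    qed
    define g where "g x = Re (f x * cnj (f s0))" for x
    have g_int: "((\<lambda>x. g x * w x ^ N) has_integral 0) {0..1}" for N
    proof -
      have "((\<lambda>x. Re ((f x * of_real (w x ^ N) * cis (2 * pi * of_int 0 * x)) * cnj (f s0))) has_integral Re (0 * cnj (f s0))) {0..1}"
        by (intro has_integral_Re has_integral_mult_left powers)
      moreover have "(\<lambda>x. Re ((f x * of_real (w x ^ N) * cis (2 * pi * of_int 0 * x)) * cnj (f s0))) = (\<lambda>x. g x * w x ^ N)"
        by (rule ext) (simp add: g_def algebra_simps del: of_real_power)
      ultimately show ?thesis by simp
    qed
    have g_cont: "continuous_on {0..1} g"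
      unfolding g_def by (intro continuous_intros cont)
    define c where "c = g s0 / 2"
    have gs0: "g s0 = (norm (f s0))\<^sup>2"
      unfolding g_def by (metis Re_complex_of_real complex_norm_square)
    have c: "0 < c" using nz unfolding c_def gs0 by simp
    obtain B where B: "\<And>x. x \<in> {0..1} \<Longrightarrow> \<bar>g x\<bar> \<le> B" "B > 0"
      using compact_imp_bounded[OF compact_continuous_image[OF g_cont compact_Icc]]
      unfolding bounded_pos by (metis imageI real_norm_def)
    have w_cont: "continuous_on A w" for A
      unfolding w_def by (intro continuous_intros) auto
    have w_nonneg: "0 \<le> w x" for x
    proof -
      have "0 \<le> 1 + cos (2 * pi * (x - s0))"
        using cos_ge_minus_one[of "2 * pi * (x - s0)"] by linarith
      then show ?thesis by (simp add: w_def)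
    qed
    obtain d where d: "d > 0" "\<And>x. x \<in> {0..1} \<Longrightarrow> \<bar>x - s0\<bar> < d \<Longrightarrow> c \<le> g x"
    proof -
      obtain d where "d > 0" "\<forall>x\<in>{0..1}. dist x s0 < d \<longrightarrow> dist (g x) (g s0) < c"
        using g_cont[unfolded continuous_on_iff] s0 c by (metis atLeastAtMost_iff less_imp_le)
      moreover have "c \<le> y" if "dist y (g s0) < c" for y
        using that by (simp add: dist_real_def c_def abs_if split: if_splits)
      ultimately show ?thesis using that by (auto simp: dist_real_def)
    qed
    define K where "K = {0..1} - {s0 - d<..<s0 + d}"
    have K_cpt: "compact K" unfolding K_def by (intro compact_diff compact_Icc open_greaterThanLessThan)
    obtain q where q: "0 \<le> q" "q < 1" "\<And>x. x \<in> K \<Longrightarrow> w x \<le> q"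
    proof (cases "K = {}")
      case True
      then show ?thesis using that[of 0] by simp
    next
      case False
      obtain x0 where x0: "x0 \<in> K" "\<And>x. x \<in> K \<Longrightarrow> w x \<le> w x0"
        using continuous_attains_sup[OF K_cpt False w_cont] by blast
      have "w x0 \<noteq> 1"
      proof
        assume "w x0 = 1"
        then have "cos (2 * pi * (x0 - s0)) = 1" by (simp add: w_def)
        then obtain n :: int where "2 * pi * (x0 - s0) = of_int n * (2 * pi)"
          by (auto simp: cos_one_2pi_int)
        then have "x0 - s0 = of_int n" by (simp add: mult.commute)
        moreover have "\<bar>x0 - s0\<bar> < 1" "x0 \<noteq> s0" using x0(1) s0 d(1) by (auto simp: K_def)
        ultimately show False by (simp flip: of_int_abs)
      qed
      moreover have "w x0 \<le> 1" unfolding w_def using cos_le_one[of "2 * pi * (x0 - s0)"] by simp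
      ultimately show ?thesis using that[of "w x0"] x0 w_nonneg by auto
    qed
    \<comment> \<open>Any number strictly between the bound \<open>q\<close> away from \<open>s0\<close> and the maximum 1 of \<open>w\<close> would do.\<close>
    define q' where "q' = (1 + q) / 2"
    have q': "q < q'" "0 < q'" "q' < 1" using q by (auto simp: q'_def)
    have ws0: "w s0 = 1" by (simp add: w_def)
    obtain e where e: "e > 0" "\<And>x. \<bar>x - s0\<bar> < e \<Longrightarrow> q' \<le> w x"
    proof -
      obtain e where "e > 0" "\<forall>x\<in>UNIV. dist x s0 < e \<longrightarrow> dist (w x) (w s0) < 1 - q'"
        using w_cont[of UNIV, unfolded continuous_on_iff] q' by (metis UNIV_I diff_gt_0_iff_gt)
      moreover have "q' \<le> y" if "dist y 1 < 1 - q'" for y :: real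
        using that by (simp add: dist_real_def abs_if split: if_splits)
      ultimately show ?thesis using that ws0 by (auto simp: dist_real_def)
    qed
    define h where "h = Min {d, e, s0, 1 - s0} / 2"
    have h: "0 < h" "h < d" "h < e" "h < s0" "h < 1 - s0"
      using d(1) e(1) s0 by (auto simp: h_def)
    define C where "C = 2 * h * c"
    have C: "0 < C" using h(1) c by (simp add: C_def)
    have ineq: "C * q' ^ N \<le> B * q ^ N" for N
    proof -
      have ind: "((\<lambda>x. if x \<in> {s0 - h..s0 + h} then c * q' ^ N else 0) has_integral (2 * h * (c * q' ^ N))) {0..1}"
      proof -
        have "((\<lambda>x. c * q' ^ N) has_integral (2 * h * (c * q' ^ N))) {s0 - h..s0 + h}"
          using has_integral_const_real[of "c * q' ^ N" "s0 - h" "s0 + h"] h(1) by simp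
        moreover have "{s0 - h..s0 + h} \<subseteq> {0..1}" using h by auto
        ultimately show ?thesis
          by (simp only: has_integral_restrict)
      qed
      have "((\<lambda>x. (if x \<in> {s0 - h..s0 + h} then c * q' ^ N else 0) - B * q ^ N) has_integral (2 * h * (c * q' ^ N) - B * q ^ N)) {0..1}"
        using has_integral_diff[OF ind has_integral_const_real[of "B * q ^ N" 0 1]] by simp
      then have "2 * h * (c * q' ^ N) - B * q ^ N \<le> 0"
      proof (rule has_integral_le[OF _ g_int[of N]])
        fix x :: real assume x: "x \<in> {0..1}"
        show "(if x \<in> {s0 - h..s0 + h} then c * q' ^ N else 0) - B * q ^ N \<le> g x * w x ^ N"
        proof (cases "x \<in> K")
          case True
          have "x \<notin> {s0 - h..s0 + h}" using True h by (auto simp: K_def)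
          moreover have "- (B * q ^ N) \<le> g x * w x ^ N"
          proof -
            have "\<bar>g x * w x ^ N\<bar> \<le> B * q ^ N"
              unfolding abs_mult power_abs using B x q(3)[OF True] w_nonneg[of x]
              by (intro mult_mono power_mono) auto
            then show ?thesis by linarith
          qed
          ultimately show ?thesis by auto
        next
          case False
          then have "\<bar>x - s0\<bar> < d" using x by (auto simp: K_def)
          then have gx: "c \<le> g x" using d(2) x by auto
          have "0 \<le> g x * w x ^ N" using gx c w_nonneg[of x] by simp
          moreover have "0 \<le> B * q ^ N" using B q by simp
          moreover have "c * q' ^ N \<le> g x * w x ^ N" if "x \<in> {s0 - h..s0 + h}"
          proof -
            have "\<bar>x - s0\<bar> < e" using that h by (auto simp: abs_if)
            then show ?thesis using e(2)[of x] gx c q' by (intro mult_mono power_mono) auto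
          qed
          ultimately show ?thesis by auto
        qed
      qed
      then show ?thesis by (simp add: C_def mult_ac)
    qed
    have "(\<lambda>N. B * (q / q') ^ N) \<longlonglongrightarrow> B * 0"
      using q q' by (intro tendsto_mult tendsto_const LIMSEQ_power_zero) auto
    then have "eventually (\<lambda>N. B * (q / q') ^ N < C) sequentially"
      using C by (intro order_tendstoD) auto
    then obtain N where "B * (q / q') ^ N < C" by (auto simp: eventually_sequentially)
    then have "B * q ^ N < C * q' ^ N"
      using q' by (simp add: power_divide field_simps)
    with ineq[of N] show False by simp
  qed
  have "f ` closure {0<..<1} \<subseteq> {0}"
    by (rule image_closure_subset) (use cont interior in \<open>auto simp: closure_greaterThanLessThan\<close>)
  then show ?thesis using s by (simp add: closure_greaterThanLessThan image_subset_iff)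
qed

lemma filterlim_int_intervals: 
  "filterlim (\<lambda>N. {- int N..<int N}) (finite_subsets_at_top UNIV) sequentially"
  unfolding filterlim_finite_subsets_at_top
proof safe
  fix X :: "int set" assume "finite X"
  then obtain b where b: "\<And>x. x \<in> X \<Longrightarrow> \<bar>x\<bar> \<le> b"
    using finite_imp_bounded[of "abs ` X"] by (metis Max_ge finite_imageI imageI)
  show "\<forall>\<^sub>F y in sequentially. finite {- int y..<int y} \<and> X \<subseteq> {- int y..<int y} \<and> {- int y..<int y} \<subseteq> UNIV"
    using eventually_ge_at_top[of "nat b + 1"]
  proof eventually_elim
    case (elim N)
    then show ?case using b by (fastforce simp: abs_le_iff)
  qed
qed

lemma integral_unit_intervals:
  fixes f :: "real \<Rightarrow> complex"
  assumes "continuous_on UNIV f"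
  shows "((\<lambda>x. f x) has_integral (\<Sum>n\<in>{- int N..<int N}. integral {0..1} (\<lambda>x. f (x + of_int n)))) {- real N..real N}"
proof (induction N)
  case 0
  then show ?case using has_integral_refl(2)[of f 0] by simp
next
  case (Suc N)
  have unit: "(f has_integral integral {0..1} (\<lambda>x. f (x + of_int n))) {of_int n..of_int n + 1}" for n :: int
  proof -
    have "((\<lambda>x. f (x + of_int n)) has_integral integral {0..1} (\<lambda>x. f (x + of_int n))) {0..1}"
      by (intro integrable_integral integrable_continuous_interval continuous_intros continuous_on_compose2[OF assms]) auto
    then have "((\<lambda>x. f (1 *\<^sub>R x + of_int n)) has_integral integral {0..1} (\<lambda>x. f (x + of_int n))) ({0..1})" by simp
    with has_integral_affinity_iff[of 1 f "of_int n" _ "of_int n" "of_int n + 1"]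
    show ?thesis by simp
  qed
  have a: "(f has_integral (integral {0..1} (\<lambda>x. f (x + of_int (- int N - 1))) + (\<Sum>n\<in>{- int N..<int N}. integral {0..1} (\<lambda>x. f (x + of_int n))))) {- real N - 1..real N}"
    using has_integral_combine[OF _ _ _ Suc, of "- real N - 1"] unit[of "- int N - 1"] by (auto simp: algebra_simps)
  have b: "(f has_integral (integral {0..1} (\<lambda>x. f (x + of_int (- int N - 1))) + (\<Sum>n\<in>{- int N..<int N}. integral {0..1} (\<lambda>x. f (x + of_int n))) + integral {0..1} (\<lambda>x. f (x + of_int (int N))))) {- real N - 1..real N + 1}"
    using has_integral_combine[OF _ _ a, of "real N + 1"] unit[of "int N"] by (auto simp: algebra_simps)
  have "{- int (Suc N)..<int (Suc N)} = insert (- int N - 1) (insert (int N) {- int N..<int N})" by auto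
  then have "(\<Sum>n\<in>{- int (Suc N)..<int (Suc N)}. integral {0..1} (\<lambda>x. f (x + of_int n))) =
     integral {0..1} (\<lambda>x. f (x + of_int (- int N - 1))) + (\<Sum>n\<in>{- int N..<int N}. integral {0..1} (\<lambda>x. f (x + of_int n))) + integral {0..1} (\<lambda>x. f (x + of_int (int N)))"
    by (simp add: add_ac)
  moreover have "- real N - 1 = - real (Suc N)" "real N + 1 = real (Suc N)" by simp_all
  ultimately show ?case using b by (simp only:)
qed

text \<open>The periodization of \<open>\<phi>\<close> and the trigonometric series with coefficients \<open>F\<close> are continuous and have the same
Fourier coefficients, so they agree on the unit interval; the statement is their equality at 0.
The summable majorants make both series converge uniformly.\<close>

theorem Poisson_summation:
  fixes \<phi> :: "real \<Rightarrow> complex"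
  assumes cont: "continuous_on UNIV \<phi>"
    and bound: "\<And>n::int. \<And>x. x \<in> {0..1} \<Longrightarrow> norm (\<phi> (x + of_int n)) \<le> M n" "M summable_on UNIV"
    and ft: "\<And>k::int. has_bochner_integral lborel (\<lambda>x. \<phi> x * cis (- 2 * pi * of_int k * x)) (F k)"
    and F: "(\<lambda>k. norm (F k)) summable_on UNIV"
  shows "(\<Sum>\<^sub>\<infinity>n::int. \<phi> (of_int n)) = (\<Sum>\<^sub>\<infinity>k. F k)"
proof -
  define A where "A x = (\<Sum>\<^sub>\<infinity>n::int. \<phi> (x + of_int n))" for x
  define B where "B x = (\<Sum>\<^sub>\<infinity>k. F k * cis (2 * pi * of_int k * x))" for x
  have cont': "continuous_on S (\<lambda>x. \<phi> (x + c))" for S c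
    by (intro continuous_intros continuous_on_compose2[OF cont]) auto
  have A_lim: "uniform_limit {0..1} (\<lambda>X x. \<Sum>n\<in>X. \<phi> (x + of_int n)) A (finite_subsets_at_top UNIV)"
    unfolding A_def by (rule Weierstrass_m_test_general) (use bound in auto)
  have B_lim: "uniform_limit {0..1} (\<lambda>X x. \<Sum>k\<in>X. F k * cis (2 * pi * of_int k * x)) B (finite_subsets_at_top UNIV)"
    unfolding B_def by (rule Weierstrass_m_test_general[OF _ F]) (simp add: norm_mult)
  have A_cont: "continuous_on {0..1} A"
    by (rule uniform_limit_theorem[OF _ A_lim]) (auto intro!: always_eventually continuous_intros cont')
  have B_cont: "continuous_on {0..1} B"
    by (rule uniform_limit_theorem[OF _ B_lim]) (auto intro!: always_eventually continuous_intros)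
  have A_coeff: "((\<lambda>x. A x * cis (2 * pi * of_int k * x)) has_integral F (- k)) {0..1}" for k :: int
  proof -
    define \<psi> where "\<psi> x = \<phi> x * cis (2 * pi * of_int k * x)" for x
    have per: "cis (2 * pi * of_int k * (x + of_int n)) = cis (2 * pi * of_int k * x)" for x and n :: int
    proof -
      have "cis (2 * pi * of_int k * (x + of_int n)) = cis (2 * pi * of_int k * x) * cis (2 * pi * of_int (k * n))"
        unfolding cis_mult by (rule arg_cong[where f = cis]) (simp add: algebra_simps)
      also have "cis (2 * pi * of_int (k * n)) = 1" by (rule cis_multiple_2pi) simp
      finally show ?thesis by simp
    qed
    have sums: "(\<lambda>x. (\<Sum>n\<in>X. \<phi> (x + of_int n)) * cis (2 * pi * of_int k * x)) = (\<lambda>x. \<Sum>n\<in>X. \<psi> (x + of_int n))" for X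
      by (rule ext) (simp add: \<psi>_def per sum_distrib_right)
    have \<psi>_cont: "continuous_on UNIV \<psi>" unfolding \<psi>_def by (intro continuous_intros cont)
    have \<psi>_int: "integrable lborel \<psi>" "integral\<^sup>L lborel \<psi> = F (- k)"
      using ft[of "- k"] unfolding \<psi>_def[abs_def] by (auto simp: has_bochner_integral_iff)
    have bounded_char: "bounded ((\<lambda>x. cis (2 * pi * of_int k * x)) ` {0..1})"
      by (intro boundedI[of _ 1]) auto
    have bounded_A: "bounded (A ` {0..1})"
      by (intro compact_imp_bounded compact_continuous_image A_cont compact_Icc)
    have lim: "uniform_limit (cbox 0 1) (\<lambda>X x. (\<Sum>n\<in>X. \<phi> (x + of_int n)) * cis (2 * pi * of_int k * x))
        (\<lambda>x. A x * cis (2 * pi * of_int k * x)) (finite_subsets_at_top UNIV)"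
      using bounded_A bounded_char by (intro uniform_lim_mult uniform_limit_const) (use A_lim in auto)
    obtain I J where I: "\<And>X. ((\<lambda>x. \<Sum>n\<in>X. \<psi> (x + of_int n)) has_integral I X) (cbox 0 1)"
      and J: "((\<lambda>x. A x * cis (2 * pi * of_int k * x)) has_integral J) (cbox 0 1)"
      and IJ: "(I \<longlongrightarrow> J) (finite_subsets_at_top UNIV)"
    proof (rule uniform_limit_integral_cbox[OF lim, unfolded sums])
      show "continuous_on (cbox 0 1) (\<lambda>x. \<Sum>n\<in>X. \<psi> (x + of_int n))" for X
        by (intro continuous_intros continuous_on_compose2[OF \<psi>_cont]) auto
    qed auto
    have I_eq: "I {- int N..<int N} = (LBINT x:{- real N..real N}. \<psi> x)" for N
    proof -
      have "I X = (\<Sum>n\<in>X. integral {0..1} (\<lambda>x. \<psi> (x + of_int n)))" if "finite X" for X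
      proof (rule has_integral_unique[OF I])
        show "((\<lambda>x. \<Sum>n\<in>X. \<psi> (x + of_int n)) has_integral (\<Sum>n\<in>X. integral {0..1} (\<lambda>x. \<psi> (x + of_int n)))) (cbox 0 1)"
          unfolding cbox_interval
          by (intro has_integral_sum that integrable_integral integrable_continuous_interval
              continuous_intros continuous_on_compose2[OF \<psi>_cont]) auto
      qed
      then have "I {- int N..<int N} = (\<Sum>n\<in>{- int N..<int N}. integral {0..1} (\<lambda>x. \<psi> (x + of_int n)))" by simp
      also have "\<dots> = integral {- real N..real N} \<psi>"
        using integral_unit_intervals[OF \<psi>_cont] by (rule integral_unique[symmetric])
      also have "\<dots> = (LBINT x:{- real N..real N}. \<psi> x)"
        by (intro set_borel_integral_eq_integral(2)[symmetric] borel_integrable_atLeastAtMost'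
            continuous_on_subset[OF \<psi>_cont]) auto
      finally show ?thesis .
    qed
    have "(\<lambda>N. LBINT x:{- real N..real N}. \<psi> x) \<longlonglongrightarrow> integral\<^sup>L lborel \<psi>"
      unfolding set_lebesgue_integral_def
    proof (rule integral_dominated_convergence[where w = "\<lambda>x. norm (\<psi> x)"])
      show "AE x in lborel. (\<lambda>N. indicator {- real N..real N} x *\<^sub>R \<psi> x) \<longlonglongrightarrow> \<psi> x"
      proof (rule AE_I2, rule tendsto_eventually)
        fix x :: real
        show "\<forall>\<^sub>F N in sequentially. indicator {- real N..real N} x *\<^sub>R \<psi> x = \<psi> x"
          using eventually_ge_at_top[of "nat \<lceil>\<bar>x\<bar>\<rceil>"]
        proof eventually_elim
          case (elim N)
          then have "\<bar>x\<bar> \<le> real N" by linarith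
          then show ?case by (simp add: abs_le_iff)
        qed
      qed
    qed (use \<psi>_int in \<open>auto simp: indicator_def\<close>)
    then have "(\<lambda>N. I {- int N..<int N}) \<longlonglongrightarrow> F (- k)" by (simp add: I_eq \<psi>_int)
    moreover have "(\<lambda>N. I {- int N..<int N}) \<longlonglongrightarrow> J"
      by (rule filterlim_compose[OF IJ filterlim_int_intervals])
    ultimately have "J = F (- k)" by (rule LIMSEQ_unique[rotated])
    then show ?thesis using J by simp
  qed
  have B_coeff: "((\<lambda>x. B x * cis (2 * pi * of_int k * x)) has_integral F (- k)) {0..1}" for k :: int
  proof -
    have bounded_char: "bounded ((\<lambda>x. cis (2 * pi * of_int k * x)) ` {0..1})"
      by (intro boundedI[of _ 1]) auto
    have bounded_B: "bounded (B ` {0..1})"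
      by (intro compact_imp_bounded compact_continuous_image B_cont compact_Icc)
    have lim: "uniform_limit (cbox 0 1) (\<lambda>X x. (\<Sum>l\<in>X. F l * cis (2 * pi * of_int l * x)) * cis (2 * pi * of_int k * x))
        (\<lambda>x. B x * cis (2 * pi * of_int k * x)) (finite_subsets_at_top UNIV)"
      using bounded_B bounded_char by (intro uniform_lim_mult uniform_limit_const) (use B_lim in auto)
    obtain I J where I: "\<And>X. ((\<lambda>x. (\<Sum>l\<in>X. F l * cis (2 * pi * of_int l * x)) * cis (2 * pi * of_int k * x)) has_integral I X) (cbox 0 1)"
      and J: "((\<lambda>x. B x * cis (2 * pi * of_int k * x)) has_integral J) (cbox 0 1)"
      and IJ: "(I \<longlongrightarrow> J) (finite_subsets_at_top UNIV)"
      by (rule uniform_limit_integral_cbox[OF lim]) (auto intro!: continuous_intros)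
    have I_eq: "I X = F (- k)" if X: "finite X" "- k \<in> X" for X
    proof (rule has_integral_unique[OF I])
      have "((\<lambda>x. \<Sum>l\<in>X. F l * cis (2 * pi * of_int (l + k) * x)) has_integral (\<Sum>l\<in>X. F l * (if l + k = 0 then 1 else 0))) {0..1}"
        by (intro has_integral_sum has_integral_mult_right integral_cis_period X)
      also have "(\<Sum>l\<in>X. F l * (if l + k = 0 then 1 else 0)) = (\<Sum>l\<in>X. if l = - k then F l else 0)"
        by (intro sum.cong) auto
      also have "\<dots> = F (- k)" using X by simp
      also have "(\<lambda>x. \<Sum>l\<in>X. F l * cis (2 * pi * of_int (l + k) * x)) =
          (\<lambda>x. (\<Sum>l\<in>X. F l * cis (2 * pi * of_int l * x)) * cis (2 * pi * of_int k * x))"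
        unfolding sum_distrib_right mult.assoc cis_mult
        by (intro ext sum.cong refl arg_cong2[where f = "(*)"] arg_cong[where f = cis]) (simp add: algebra_simps)
      finally show "((\<lambda>x. (\<Sum>l\<in>X. F l * cis (2 * pi * of_int l * x)) * cis (2 * pi * of_int k * x)) has_integral F (- k)) (cbox 0 1)"
        by simp
    qed
    have "eventually (\<lambda>X. I X = F (- k)) (finite_subsets_at_top UNIV)"
      unfolding eventually_finite_subsets_at_top
      by (rule exI[of _ "{- k}"]) (auto intro: I_eq)
    then have "(I \<longlongrightarrow> F (- k)) (finite_subsets_at_top UNIV)" by (rule tendsto_eventually)
    then have "J = F (- k)" using IJ tendsto_unique finite_subsets_at_top_neq_bot by blast
    then show ?thesis using J by simp
  qed
  \<comment> \<open>Coefficient \<open>k\<close> is taken against \<open>cis (2 * pi * k * x)\<close>, hence the sign in \<open>F (- k)\<close> above.\<close>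
  have "A 0 - B 0 = 0"
  proof (rule Fourier_coefficients_zero_imp_zero)
    show "continuous_on {0..1} (\<lambda>x. A x - B x)" by (intro continuous_intros A_cont B_cont)
    show "((\<lambda>x. (A x - B x) * cis (2 * pi * of_int k * x)) has_integral 0) {0..1}" for k :: int
      using has_integral_diff[OF A_coeff[of k] B_coeff[of k]] by (simp add: left_diff_distrib)
  qed simp
  then show ?thesis by (simp add: A_def B_def)
qed

section \<open>The theta transformation\<close>

lemma norm_exp_quadratic: 
  "norm (exp (of_real (- t * x\<^sup>2) + v * of_real x)) = exp (- t * x\<^sup>2 + Re v * x)"
  by (simp add: norm_exp_eq_Re)

text \<open>For imaginary \<open>v\<close> this is the characteristic function of the normal distribution; the real part of \<open>v\<close>
is removed by completing the square, which is an affine substitution.\<close>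

lemma Gaussian_moment_0:
  fixes t :: real and v :: complex
  assumes t: "t > 0"
  shows "has_bochner_integral lborel (\<lambda>x. exp (of_real (- t * x\<^sup>2) + v * of_real x)) (of_real (sqrt (pi / t)) * exp (v\<^sup>2 / (4 * t)))"
proof -
  define u where "u = Re v"
  define \<tau> where "\<tau> = Im v"
  have v: "v = Complex u \<tau>" by (simp add: u_def \<tau>_def)
  define s where "s = sqrt (2 * t)"
  have s: "s > 0" "s\<^sup>2 = 2 * t" using t by (simp_all add: s_def)
  define a where "a = \<tau> / s"
  interpret real_distribution std_normal_distribution by (rule real_dist_normal_dist)
  have int: "has_bochner_integral std_normal_distribution (\<lambda>x. iexp (a * x)) (of_real (exp (- a\<^sup>2 / 2)))"
    using fun_cong[OF char_std_normal_distribution, of a] integrable_iexp[of "\<lambda>x. a * x"]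
    by (simp add: has_bochner_integral_iff char_def)
  have "has_bochner_integral lborel (\<lambda>x. std_normal_density x *\<^sub>R iexp (a * x)) (of_real (exp (- a\<^sup>2 / 2)))"
    using int by (simp add: has_bochner_integral_iff integrable_density integral_density normal_density_nonneg del: of_real_exp)
  then have "has_bochner_integral lborel (\<lambda>x. std_normal_density (- (u / s) + s * x) *\<^sub>R iexp (a * (- (u / s) + s * x))) (of_real (exp (- a\<^sup>2 / 2)) /\<^sub>R \<bar>s\<bar>)"
    using s(1) by (subst (asm) lborel_has_bochner_integral_real_affine_iff[where c = s and t = "- (u / s)"]) auto
  then have "has_bochner_integral lborel (\<lambda>x. (of_real (sqrt (2 * pi) * exp (u\<^sup>2 / (4 * t))) * iexp (a * u / s)) *
      (std_normal_density (- (u / s) + s * x) *\<^sub>R iexp (a * (- (u / s) + s * x))))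
     ((of_real (sqrt (2 * pi) * exp (u\<^sup>2 / (4 * t))) * iexp (a * u / s)) * (of_real (exp (- a\<^sup>2 / 2)) /\<^sub>R \<bar>s\<bar>))"
    by (rule has_bochner_integral_mult_right)
  moreover have "(of_real (sqrt (2 * pi) * exp (u\<^sup>2 / (4 * t))) * iexp (a * u / s)) *
      (std_normal_density (- (u / s) + s * x) *\<^sub>R iexp (a * (- (u / s) + s * x))) = exp (of_real (- t * x\<^sup>2) + v * of_real x)" for x
  proof -
    have "u\<^sup>2 / (4 * t) - (- (u / s) + s * x)\<^sup>2 / 2 = - t * x\<^sup>2 + u * x"
    proof -
      have "t = s * s / 2" using s(2) by (simp add: power2_eq_square)
      then show ?thesis using s(1) by (simp add: power2_eq_square field_simps)
    qed
    then have e1: "exp (u\<^sup>2 / (4 * t)) * exp (- ((- (u / s) + s * x)\<^sup>2 / 2)) = exp (- t * x\<^sup>2 + u * x)"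
      by (simp add: exp_add[symmetric])
    have e2: "a * u / s + a * (- (u / s) + s * x) = \<tau> * x"
      using s by (simp add: a_def field_simps)
    have "(of_real (sqrt (2 * pi) * exp (u\<^sup>2 / (4 * t))) * iexp (a * u / s)) *
      (std_normal_density (- (u / s) + s * x) *\<^sub>R iexp (a * (- (u / s) + s * x))) =
      of_real (exp (u\<^sup>2 / (4 * t)) * exp (- ((- (u / s) + s * x)\<^sup>2 / 2))) * (iexp (a * u / s) * iexp (a * (- (u / s) + s * x)))"
      by (simp add: std_normal_density_def scaleR_conv_of_real del: of_real_exp)
    also have "iexp (a * u / s) * iexp (a * (- (u / s) + s * x)) = iexp (\<tau> * x)"
      unfolding e2[symmetric] by (simp add: exp_add[symmetric] algebra_simps)
    also have "of_real (exp (u\<^sup>2 / (4 * t)) * exp (- ((- (u / s) + s * x)\<^sup>2 / 2))) * iexp (\<tau> * x) = exp (of_real (- t * x\<^sup>2) + v * of_real x)"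
    proof (subst e1)
      show "of_real (exp (- t * x\<^sup>2 + u * x)) * iexp (\<tau> * x) = exp (of_real (- t * x\<^sup>2) + v * of_real x)"
        unfolding exp_of_real[symmetric] exp_add[symmetric] v
        by (rule arg_cong[where f = exp]) (simp add: complex_eq_iff)
    qed
    finally show ?thesis .
  qed
  moreover have "(of_real (sqrt (2 * pi) * exp (u\<^sup>2 / (4 * t))) * iexp (a * u / s)) * (of_real (exp (- a\<^sup>2 / 2)) /\<^sub>R \<bar>s\<bar>) =
      of_real (sqrt (pi / t)) * exp (v\<^sup>2 / (4 * t))"
  proof -
    have "sqrt (2 * pi) / s = sqrt (pi / t)"
      unfolding s_def real_sqrt_divide[symmetric] by simp
    moreover have "exp (of_real (u\<^sup>2 / (4 * t))) * iexp (a * u / s) * exp (of_real (- a\<^sup>2 / 2)) = exp (v\<^sup>2 / (4 * t))"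
    proof -
      have "a * u / s = 2 * u * \<tau> / (4 * t)" "- a\<^sup>2 / 2 = - \<tau>\<^sup>2 / (4 * t)"
        using s by (simp_all add: a_def power_divide power2_eq_square[symmetric])
      then show ?thesis unfolding exp_add[symmetric] v
        by (intro arg_cong[where f = exp]) (simp add: complex_eq_iff power2_eq_square Re_divide_of_real Im_divide_of_real diff_divide_distrib)
    qed
    moreover have "(of_real (sqrt (2 * pi) * exp (u\<^sup>2 / (4 * t))) * iexp (a * u / s)) * (of_real (exp (- a\<^sup>2 / 2)) /\<^sub>R \<bar>s\<bar>) = 
      of_real (sqrt (2 * pi) / s) * (exp (of_real (u\<^sup>2 / (4 * t))) * iexp (a * u / s) * exp (of_real (- a\<^sup>2 / 2)))"
      using s(1) by (simp add: scaleR_conv_of_real field_simps exp_of_real[symmetric] del: of_real_divide of_real_power)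
        (simp flip: of_real_mult)
    ultimately show ?thesis by simp
  qed
  ultimately show ?thesis by simp
qed

text \<open>The integral of the derivative of \<open>exp (- t x\<^sup>2 + v x)\<close> over the line is 0, which expresses the first moment by
the zeroth one.\<close>

lemma Gaussian_moment_1:
  fixes t :: real and v :: complex
  assumes t: "t > 0"
  shows "has_bochner_integral lborel (\<lambda>x. of_real x * exp (of_real (- t * x\<^sup>2) + v * of_real x))
     (of_real (sqrt (pi / t)) * (v / (2 * t)) * exp (v\<^sup>2 / (4 * t)))"
proof -
  define E where "E x = exp (of_real (- t * x\<^sup>2) + v * of_real x)" for x
  have E0: "has_bochner_integral lborel E (of_real (sqrt (pi / t)) * exp (v\<^sup>2 / (4 * t)))"
    unfolding E_def[abs_def] by (rule Gaussian_moment_0[OF t])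
  have E_cont: "continuous_on UNIV E" unfolding E_def by (intro continuous_intros)
  have int: "integrable lborel (\<lambda>x. of_real x * E x)"
  proof (rule Bochner_Integration.integrable_bound)
    show "integrable lborel (\<lambda>x. norm (exp (of_real (- t * x\<^sup>2) + (v + 1) * of_real x)) + norm (exp (of_real (- t * x\<^sup>2) + (v - 1) * of_real x)))"
      by (intro Bochner_Integration.integrable_add integrable_norm has_bochner_integral_iff[THEN iffD1, THEN conjunct1, OF Gaussian_moment_0[OF t]])
    show "AE x in lborel. norm (of_real x * E x) \<le> norm (norm (exp (of_real (- t * x\<^sup>2) + (v + 1) * of_real x)) + norm (exp (of_real (- t * x\<^sup>2) + (v - 1) * of_real x)))"
    proof (rule AE_I2)
      fix x :: real
      have "\<bar>x\<bar> \<le> exp x + exp (- x)"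
        using exp_ge_add_one_self[of x] exp_ge_add_one_self[of "- x"] exp_gt_zero[of x] exp_gt_zero[of "- x"] by linarith
      then have "\<bar>x\<bar> * exp (- t * x\<^sup>2 + Re v * x) \<le> (exp x + exp (- x)) * exp (- t * x\<^sup>2 + Re v * x)"
        by (rule mult_right_mono) simp
      also have "\<dots> = exp (- t * x\<^sup>2 + Re (v + 1) * x) + exp (- t * x\<^sup>2 + Re (v - 1) * x)"
        by (simp add: exp_add[symmetric] distrib_right left_diff_distrib add_ac) (simp add: algebra_simps)
      finally show "norm (of_real x * E x) \<le> norm (norm (exp (of_real (- t * x\<^sup>2) + (v + 1) * of_real x)) + norm (exp (of_real (- t * x\<^sup>2) + (v - 1) * of_real x)))"
        unfolding E_def norm_mult norm_exp_quadratic norm_of_real by simp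
    qed
  qed (use E_cont in \<open>auto intro!: borel_measurable_continuous_onI continuous_intros\<close>)
  have "(LBINT x=-\<infinity>..\<infinity>. (v - 2 * t * x) * E x) = 0 - 0"
  proof (rule interval_integral_FTC_integrable)
    fix x :: real
    have "((\<lambda>z. exp (- of_real t * z\<^sup>2 + v * z)) has_field_derivative (exp (- of_real t * (of_real x)\<^sup>2 + v * of_real x) * (v - 2 * t * x))) (at (of_real x))"
      by (auto intro!: derivative_eq_intros simp: algebra_simps)
    from has_vector_derivative_real_field[OF this]
    show "(E has_vector_derivative (v - 2 * t * x) * E x) (at x)"
      by (simp add: E_def[abs_def] mult.commute)
    show "isCont (\<lambda>x. (v - 2 * t * x) * E x) x"
      unfolding E_def by (intro continuous_intros)
    have "integrable lborel (\<lambda>x. v * E x - 2 * t * (of_real x * E x))"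
      using E0 int by (intro Bochner_Integration.integrable_diff integrable_mult_right) (auto simp: has_bochner_integral_iff)
    then show "set_integrable lborel (einterval (-\<infinity>) \<infinity>) (\<lambda>x. (v - 2 * t * x) * E x)"
      by (simp add: set_integrable_def algebra_simps)
    have a: "((\<lambda>x. norm (E x)) \<longlongrightarrow> 0) at_top" "((\<lambda>x. norm (E x)) \<longlongrightarrow> 0) at_bot"
      unfolding E_def norm_exp_quadratic using t by real_asymp+
    then show "((E \<circ> real_of_ereal) \<longlongrightarrow> 0) (at_left \<infinity>)" "((E \<circ> real_of_ereal) \<longlongrightarrow> 0) (at_right (-\<infinity>))"
      by (simp_all add: ereal_tendsto_simps1 tendsto_norm_zero_iff)
  qed simp
  then have "(LBINT x. v * E x - 2 * t * (of_real x * E x)) = 0"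
    by (simp add: interval_lebesgue_integral_def set_lebesgue_integral_def algebra_simps)
  moreover have "(LBINT x. v * E x - 2 * t * (of_real x * E x)) = v * (LBINT x. E x) - 2 * t * (LBINT x. of_real x * E x)"
    using E0 int by (subst Bochner_Integration.integral_diff) (auto simp: has_bochner_integral_iff)
  ultimately have "(LBINT x. of_real x * E x) = v / (2 * t) * (LBINT x. E x)"
    using t by (simp add: field_simps)
  then show ?thesis
    using int E0 by (simp add: has_bochner_integral_iff E_def[abs_def])
qed

text \<open>The mean value inequality for \<open>exp\<close> on the strip \<open>|Re x| \<le> |Re z|\<close>, between \<open>-z\<close> and \<open>z\<close>.\<close>

lemma norm_sinh_le: "norm (sinh z) \<le> norm z * exp \<bar>Re z\<bar>" for z :: complex
proof -
  define S where "S = {x :: complex. \<bar>Re x\<bar> \<le> \<bar>Re z\<bar>}"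
  have S: "S = {x. Re x \<le> \<bar>Re z\<bar>} \<inter> {x. Re x \<ge> - \<bar>Re z\<bar>}" by (auto simp: S_def)
  have cS: "convex S" unfolding S by (intro convex_Int convex_halfspace_Re_le convex_halfspace_Re_ge)
  have "norm (exp z - exp (- z)) \<le> exp \<bar>Re z\<bar> * norm (z - (- z))"
    by (rule field_differentiable_bound[OF cS, where f' = exp])
       (auto simp: S_def norm_exp_eq_Re intro!: derivative_eq_intros)
  also have "z - (- z) = 2 * z" by simp
  finally show ?thesis by (simp add: sinh_field_def norm_divide norm_mult mult_ac)
qed

lemma norm_cosh_le: "norm (cosh z) \<le> exp \<bar>Re z\<bar>" for z :: complex
proof -
  have "norm (exp z + exp (- z)) \<le> exp (Re z) + exp (- Re z)"
    by (rule norm_triangle_le) (simp add: norm_exp_eq_Re)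
  also have "\<dots> \<le> exp \<bar>Re z\<bar> + exp \<bar>Re z\<bar>" by (intro add_mono) auto
  finally show ?thesis by (simp add: cosh_field_def norm_divide)
qed

lemma summable_on_exp_int: "(\<lambda>n::int. exp (- \<bar>real_of_int n\<bar>)) summable_on UNIV"
proof -
  have pos: "(\<lambda>n::int. exp (- \<bar>real_of_int n\<bar>)) summable_on (int ` UNIV)"
  proof (subst summable_on_reindex)
    have "summable (\<lambda>n. (exp (-1::real)) ^ n)" by (rule summable_geometric) simp
    then have "(\<lambda>n. (exp (-1::real)) ^ n) summable_on UNIV"
      by (intro norm_summable_imp_summable_on) (simp add: power_abs)
    also have "(\<lambda>n. (exp (-1::real)) ^ n) = (\<lambda>n. exp (- \<bar>real_of_int n\<bar>)) \<circ> int"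
      by (auto simp: exp_of_nat_mult[symmetric])
    finally show "((\<lambda>n. exp (- \<bar>real_of_int n\<bar>)) \<circ> int) summable_on UNIV" .
  qed (auto intro: inj_onI)
  then have "(\<lambda>n::int. exp (- \<bar>real_of_int n\<bar>)) summable_on (uminus ` int ` UNIV)"
    by (subst summable_on_reindex) (auto intro: inj_onI simp: o_def)
  with pos have "(\<lambda>n::int. exp (- \<bar>real_of_int n\<bar>)) summable_on (int ` UNIV \<union> uminus ` int ` UNIV)"
    by (rule summable_on_union)
  moreover have "int ` UNIV \<union> uminus ` int ` UNIV = UNIV"
    by (auto simp: image_iff) (metis int_cases2)
  ultimately show ?thesis by simp
qed

lemma has_sum_int_imp_nat_sums:
  fixes f :: "int \<Rightarrow> 'a::real_normed_vector"
  assumes "(f has_sum S) UNIV"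
  shows "(\<lambda>n. f (int n + 1) + f (- int n - 1)) sums (S - f 0)"
proof -
  have e: "(\<Sum>n\<in>{- int N..int N}. f n) = f 0 + (\<Sum>n<N. f (int n + 1) + f (- int n - 1))" for N
  proof (induction N)
    case (Suc N)
    have "{- int (Suc N)..int (Suc N)} = insert (- int N - 1) (insert (int N + 1) {- int N..int N})" by auto
    then show ?case using Suc by (simp add: add_ac)
  qed simp
  have "filterlim (\<lambda>N. {- int N..int N}) (finite_subsets_at_top UNIV) sequentially"
    unfolding filterlim_finite_subsets_at_top
  proof safe
    fix X :: "int set" assume "finite X"
    then obtain b where b: "\<And>x. x \<in> X \<Longrightarrow> \<bar>x\<bar> \<le> b"
      using finite_imp_bounded[of "abs ` X"] by (metis Max_ge finite_imageI imageI)
    show "\<forall>\<^sub>F y in sequentially. finite {- int y..int y} \<and> X \<subseteq> {- int y..int y} \<and> {- int y..int y} \<subseteq> UNIV"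
      using eventually_ge_at_top[of "nat b"]
      by eventually_elim (use b in \<open>fastforce simp: abs_le_iff\<close>)
  qed
  from filterlim_compose[OF assms[unfolded has_sum_def] this]
  have "(\<lambda>N. f 0 + (\<Sum>n<N. f (int n + 1) + f (- int n - 1))) \<longlonglongrightarrow> S" by (simp add: e)
  from tendsto_diff[OF this tendsto_const[of "f 0"]] show ?thesis by (simp add: sums_def)
qed

text \<open>A majorant that is summable over the integers and stable under bounded shifts of \<open>x\<close>.\<close>

lemma linear_times_Gaussian_bound:
  fixes t u x :: real
  assumes "t > 0"
  shows "(1 + \<bar>x\<bar>) * exp (- t * x\<^sup>2 + u * x) \<le> exp ((\<bar>u\<bar> + 2)\<^sup>2 / (4 * t)) * exp (- \<bar>x\<bar>)"
proof -
  have "- t * x\<^sup>2 + (\<bar>u\<bar> + 2) * \<bar>x\<bar> \<le> (\<bar>u\<bar> + 2)\<^sup>2 / (4 * t)"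
  proof -
    have "0 \<le> (2 * t * \<bar>x\<bar> - (\<bar>u\<bar> + 2))\<^sup>2 / (4 * t)" using assms by simp
    also have "\<dots> = t * \<bar>x\<bar>\<^sup>2 - (\<bar>u\<bar> + 2) * \<bar>x\<bar> + (\<bar>u\<bar> + 2)\<^sup>2 / (4 * t)"
      using assms by (simp add: power2_eq_square field_simps)
    finally show ?thesis by simp
  qed
  moreover have "u * x \<le> \<bar>u\<bar> * \<bar>x\<bar>" by (metis abs_ge_self abs_mult)
  ultimately have "\<bar>x\<bar> + (- t * x\<^sup>2 + u * x) \<le> (\<bar>u\<bar> + 2)\<^sup>2 / (4 * t) + - \<bar>x\<bar>"
    by (simp add: distrib_right)
  then have "exp \<bar>x\<bar> * exp (- t * x\<^sup>2 + u * x) \<le> exp ((\<bar>u\<bar> + 2)\<^sup>2 / (4 * t)) * exp (- \<bar>x\<bar>)"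
    unfolding exp_add[symmetric] by simp
  moreover have "(1 + \<bar>x\<bar>) * exp (- t * x\<^sup>2 + u * x) \<le> exp \<bar>x\<bar> * exp (- t * x\<^sup>2 + u * x)"
    using exp_ge_add_one_self[of "\<bar>x\<bar>"] by (intro mult_right_mono) simp_all
  ultimately show ?thesis by linarith
qed

text \<open>Poisson summation for \<open>x exp (- t x\<^sup>2 + w x)\<close>. The parameter \<open>w\<close> is complex because the distance on the
sphere, which is \<open>-\<i> w\<close> later, will be real in one range and imaginary in the other.\<close>

theorem theta_derivative_transformation:
  fixes t :: real and w :: complex
  assumes t: "t > 0"
  defines "\<phi> \<equiv> \<lambda>x::real. of_real x * exp (of_real (- t * x\<^sup>2) + w * of_real x)"
    and "F \<equiv> \<lambda>k::int. of_real (sqrt (pi / t)) * ((w - of_real (2 * pi * of_int k) * \<i>) / (2 * t)) *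
       exp ((w - of_real (2 * pi * of_int k) * \<i>)\<^sup>2 / (4 * t))"
  shows "(\<lambda>n::int. \<phi> (of_int n)) summable_on UNIV" "F summable_on UNIV"
    "(\<Sum>\<^sub>\<infinity>n::int. \<phi> (of_int n)) = (\<Sum>\<^sub>\<infinity>k. F k)"
proof -
  define D where "D = exp ((\<bar>Re w\<bar> + 2)\<^sup>2 / (4 * t))"
  have \<phi>_bound: "norm (\<phi> x) \<le> D * exp (- \<bar>x\<bar>)" for x
  proof -
    have "norm (\<phi> x) \<le> (1 + \<bar>x\<bar>) * exp (- t * x\<^sup>2 + Re w * x)"
      unfolding \<phi>_def norm_mult norm_exp_quadratic norm_of_real by (intro mult_right_mono) auto
    also have "\<dots> \<le> D * exp (- \<bar>x\<bar>)"
      unfolding D_def by (rule linear_times_Gaussian_bound[OF t])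
    finally show ?thesis .
  qed
  have shift: "exp (- \<bar>x + y\<bar>) \<le> exp \<bar>x\<bar> * exp (- \<bar>y\<bar>)" for x y :: real
    unfolding exp_add[symmetric] by simp
  have bound1: "norm (\<phi> (x + of_int n)) \<le> (D * exp 1) * exp (- \<bar>of_int n\<bar>)" if "x \<in> {0..1}" for x and n :: int
  proof -
    have "exp (- \<bar>x + of_int n\<bar>) \<le> exp \<bar>x\<bar> * exp (- \<bar>of_int n\<bar>)" by (rule shift)
    also have "\<dots> \<le> exp 1 * exp (- \<bar>of_int n\<bar>)" using that by (intro mult_right_mono) auto
    finally have "D * exp (- \<bar>x + of_int n\<bar>) \<le> D * (exp 1 * exp (- \<bar>of_int n\<bar>))"
      by (rule mult_left_mono) (simp add: D_def)
    with \<phi>_bound[of "x + of_int n"] show ?thesis by (simp add: mult.assoc)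
  qed
  have sum1: "(\<lambda>n::int. (D * exp 1) * exp (- \<bar>real_of_int n\<bar>)) summable_on UNIV"
    by (intro summable_on_cmult_right summable_on_exp_int)
  obtain D' where D': "\<And>k. norm (F k) \<le> D' * exp (- \<bar>of_int k\<bar>)"
  proof -
    define c where "c = sqrt (pi / t) / (2 * t)"
    have c: "0 \<le> c" using t by (simp add: c_def)
    define D0 where "D0 = exp ((\<bar>0\<bar> + 2)\<^sup>2 / (4 * (1 / (4 * t))))"
    define G where "G = c * (1 + \<bar>Re w\<bar>) * exp ((Re w)\<^sup>2 / (4 * t))"
    have G: "0 \<le> G" using c by (simp add: G_def)
    show ?thesis
    proof (rule that)
      fix k :: int
      define y where "y = 2 * pi * of_int k - Im w"
      have v: "w - of_real (2 * pi * of_int k) * \<i> = Complex (Re w) (- y)"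
        by (simp add: complex_eq_iff y_def)
      have "norm (F k) = c * norm (Complex (Re w) (- y)) * exp (((Re w)\<^sup>2 - y\<^sup>2) / (4 * t))"
        unfolding F_def v norm_mult norm_divide norm_exp_eq_Re using t
        by (simp add: c_def power2_eq_square Re_divide_of_real)
      also have "\<dots> = c * exp ((Re w)\<^sup>2 / (4 * t)) * (norm (Complex (Re w) (- y)) * exp (- (1 / (4 * t)) * y\<^sup>2 + 0 * y))"
        by (simp add: exp_add[symmetric] diff_divide_distrib exp_diff exp_minus field_simps)
      also have "\<dots> \<le> c * exp ((Re w)\<^sup>2 / (4 * t)) * (((1 + \<bar>Re w\<bar>) * (1 + \<bar>y\<bar>)) * exp (- (1 / (4 * t)) * y\<^sup>2 + 0 * y))"
      proof (intro mult_left_mono mult_right_mono)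
        have "norm (Complex (Re w) (- y)) \<le> \<bar>Re w\<bar> + \<bar>y\<bar>"
          using cmod_le[of "Complex (Re w) (- y)"] by simp
        also have "\<dots> \<le> (1 + \<bar>Re w\<bar>) * (1 + \<bar>y\<bar>)" by (simp add: algebra_simps)
        finally show "norm (Complex (Re w) (- y)) \<le> (1 + \<bar>Re w\<bar>) * (1 + \<bar>y\<bar>)" .
      qed (use c in auto)
      also have "\<dots> = G * ((1 + \<bar>y\<bar>) * exp (- (1 / (4 * t)) * y\<^sup>2 + 0 * y))" by (simp add: G_def)
      also have "\<dots> \<le> G * (D0 * exp (- \<bar>y\<bar>))"
        unfolding D0_def using t by (intro mult_left_mono linear_times_Gaussian_bound G) auto
      also have "\<dots> \<le> G * (D0 * (exp \<bar>Im w\<bar> * exp (- \<bar>of_int k\<bar>)))"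
      proof (intro mult_left_mono)
        have "\<bar>real_of_int k\<bar> \<le> 2 * pi * \<bar>of_int k\<bar>"
          using mult_right_mono[of 1 "2 * pi" "\<bar>real_of_int k\<bar>"] pi_ge_two by simp
        also have "2 * pi * \<bar>of_int k\<bar> = \<bar>y + Im w\<bar>" by (simp add: y_def abs_mult)
        finally have "- \<bar>y\<bar> \<le> \<bar>Im w\<bar> + - \<bar>of_int k\<bar>" by linarith
        then show "exp (- \<bar>y\<bar>) \<le> exp \<bar>Im w\<bar> * exp (- \<bar>of_int k\<bar>)"
          unfolding exp_add[symmetric] by simp
      qed (use G in \<open>auto simp: D0_def\<close>)
      finally show "norm (F k) \<le> (G * (D0 * exp \<bar>Im w\<bar>)) * exp (- \<bar>of_int k\<bar>)"
        by (simp add: mult_ac)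
    qed
  qed
  have sum2: "(\<lambda>k. norm (F k)) summable_on UNIV"
    by (rule Infinite_Sum.abs_summable_on_comparison_test'[OF summable_on_cmult_right[OF summable_on_exp_int] D'])
  show "(\<lambda>n::int. \<phi> (of_int n)) summable_on UNIV"
    by (rule abs_summable_summable, rule Infinite_Sum.abs_summable_on_comparison_test'[OF sum1])
       (use bound1[of 0] in auto)
  show "F summable_on UNIV" by (rule abs_summable_summable[OF sum2])
  show "(\<Sum>\<^sub>\<infinity>n::int. \<phi> (of_int n)) = (\<Sum>\<^sub>\<infinity>k. F k)"
  proof (rule Poisson_summation[OF _ bound1 sum1 _ sum2])
    show "continuous_on UNIV \<phi>" unfolding \<phi>_def by (intro continuous_intros)
    show "has_bochner_integral lborel (\<lambda>x. \<phi> x * cis (- 2 * pi * of_int k * x)) (F k)" for k :: int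
    proof -
      have "\<phi> x * cis (- 2 * pi * of_int k * x) = of_real x * exp (of_real (- t * x\<^sup>2) + (w - of_real (2 * pi * of_int k) * \<i>) * of_real x)" for x
        unfolding \<phi>_def cis_conv_exp mult.assoc exp_add[symmetric]
        by (intro arg_cong2[where f = "(*)"] refl arg_cong[where f = exp]) (simp add: algebra_simps)
      then show ?thesis unfolding F_def using Gaussian_moment_1[OF t, of "w - of_real (2 * pi * of_int k) * \<i>"] by simp
    qed
  qed
qed

text \<open>For small \<open>t\<close> the transformed series is dominated by its term \<open>k = 0\<close>. The terms \<open>k\<close> and \<open>-k\<close> are combined,
so that their sum vanishes to first order at \<open>w = 0\<close>: this gives an error relative to \<open>|w|\<close>, which survives the
later division by \<open>sinh w\<close>. On \<open>|Im w| \<le> \<pi> / 2\<close> the growth \<open>exp (\<pi> k |Im w| / t)\<close> of a pair costs at most half of the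
exponent of the decay \<open>exp (- \<pi>\<^sup>2 k\<^sup>2 / t)\<close>.\<close>

lemma theta_expansion:
  fixes t :: real and w :: complex
  assumes t: "0 < t" "t \<le> 1" and w: "\<bar>Im w\<bar> \<le> pi / 2"
  obtains R where "norm R \<le> 32 * exp (- 2 / t) * norm w"
    "(\<lambda>n. of_nat (n + 1) * exp (- of_real t * of_nat (n + 1) ^ 2) * sinh (of_nat (n + 1) * w)) sums
       (of_real (sqrt pi / (4 * t powr (3 / 2))) * exp (w\<^sup>2 / (4 * t)) * (w + R))"
proof -
  define \<phi> where "\<phi> x = of_real x * exp (of_real (- t * x\<^sup>2) + w * of_real x)" for x :: real
  define V where "V k = of_real (2 * pi * of_int k) * \<i>" for k :: int
  define c where "c = sqrt (pi / t) / (2 * t)"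
  define F where "F k = of_real (sqrt (pi / t)) * ((w - V k) / (2 * t)) * exp ((w - V k)\<^sup>2 / (4 * t))" for k
  define S where "S = (\<Sum>\<^sub>\<infinity>k. F k)"
  define E where "E = exp (w\<^sup>2 / (4 * t))"
  note T = theta_derivative_transformation[OF t(1), of w, folded V_def, folded F_def, folded \<phi>_def]
  have "(F has_sum S) UNIV" unfolding S_def using T(2) by (rule has_sum_infsum)
  then have sF: "(\<lambda>n. F (int n + 1) + F (- int n - 1)) sums (S - F 0)" by (rule has_sum_int_imp_nat_sums)
  have "((\<lambda>n. \<phi> (of_int n)) has_sum S) UNIV" unfolding S_def T(3)[symmetric] using T(1) by (rule has_sum_infsum)
  then have s\<phi>: "(\<lambda>n. \<phi> (of_int (int n + 1)) + \<phi> (of_int (- int n - 1))) sums (S - \<phi> (of_int 0))"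
    by (rule has_sum_int_imp_nat_sums)
  have c_eq: "c / 2 = sqrt pi / (4 * t powr (3 / 2))" and c_pos: "c > 0"
  proof -
    have "t powr (3 / 2) = t powr (1 + 1 / 2)" by simp
    also have "\<dots> = t * sqrt t" using t by (subst powr_add) (simp add: powr_half_sqrt)
    finally show "c / 2 = sqrt pi / (4 * t powr (3 / 2))" using t by (simp add: c_def real_sqrt_divide)
  qed (use t in \<open>simp add: c_def\<close>)
  define \<rho> where "\<rho> n = 2 * w * cosh (V (int n + 1) * w / (2 * t)) + 2 * V (int n + 1) * sinh (V (int n + 1) * w / (2 * t))" for n :: nat
  define q where "q n = exp (- (pi * real (n + 1))\<^sup>2 / t)" for n :: nat
  have pair: "F (int n + 1) + F (- int n - 1) = of_real c * E * (of_real (q n) * \<rho> n)" for n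
  proof -
    define v where "v = V (int n + 1)"
    have Vm: "V (- int n - 1) = - v" by (simp add: V_def v_def algebra_simps)
    have v2: "v\<^sup>2 / (4 * t) = of_real (- (pi * real (n + 1))\<^sup>2 / t)"
    proof -
      define N where "N = real (n + 1)"
      have "v = of_real (2 * pi * N) * \<i>" by (simp add: v_def V_def N_def)
      then show ?thesis unfolding N_def[symmetric] by (simp add: power_mult_distrib)
    qed
    have e1: "exp ((w - v)\<^sup>2 / (4 * t)) = E * of_real (q n) * exp (- (v * w / (2 * t)))"
      unfolding E_def q_def exp_of_real[symmetric] v2[symmetric] exp_add[symmetric]
      by (rule arg_cong[where f = exp]) (use t in \<open>simp add: power2_eq_square field_simps\<close>)
    have e2: "exp ((w + v)\<^sup>2 / (4 * t)) = E * of_real (q n) * exp (v * w / (2 * t))"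
      unfolding E_def q_def exp_of_real[symmetric] v2[symmetric] exp_add[symmetric]
      by (rule arg_cong[where f = exp]) (use t in \<open>simp add: power2_eq_square field_simps\<close>)
    have "F (int n + 1) + F (- int n - 1) = of_real c * ((w - v) * exp ((w - v)\<^sup>2 / (4 * t)) + (w + v) * exp ((w + v)\<^sup>2 / (4 * t)))"
      unfolding F_def Vm v_def[symmetric] by (simp add: c_def add_divide_distrib diff_divide_distrib algebra_simps)
    also have "\<dots> = of_real c * E * (of_real (q n) * ((w - v) * exp (- (v * w / (2 * t))) + (w + v) * exp (v * w / (2 * t))))"
      unfolding e1 e2 by (simp add: algebra_simps)
    also have "(w - v) * exp (- (v * w / (2 * t))) + (w + v) * exp (v * w / (2 * t)) = \<rho> n"
      unfolding \<rho>_def v_def[symmetric] by (simp add: cosh_field_def sinh_field_def field_simps)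
    finally show ?thesis .
  qed
  have E0: "E \<noteq> 0" by (simp add: E_def)
  define R where "R = (S - F 0) / (of_real c * E)"
  have F0: "F 0 = of_real c * E * w" by (simp add: F_def V_def E_def c_def)
  have S_eq: "S = of_real c * E * (w + R)"
    using c_pos E0 F0 by (simp add: R_def field_simps)
  have sR: "(\<lambda>n. of_real (q n) * \<rho> n) sums R"
    using sums_divide[OF sF, of "of_real c * E"] c_pos E0 unfolding R_def pair by simp
  have bound: "norm (of_real (q n) * \<rho> n) \<le> (16 * norm w) * exp (- 2 / t) ^ (n + 1)" for n
  proof -
    define N where "N = real (n + 1)"
    have N: "N \<ge> 1" by (simp add: N_def)
    define v where "v = V (int n + 1)"
    define z where "z = v * w / (2 * t)"
    have vi: "v = of_real (2 * pi * N) * \<i>" by (simp add: v_def V_def N_def)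
    have nv: "norm v = 2 * pi * N"
      unfolding vi norm_mult norm_of_real using N by (simp add: abs_mult)
    have nz: "norm z = pi * N / t * norm w"
      using t by (simp add: z_def norm_divide norm_mult nv)
    have Rez: "\<bar>Re z\<bar> = pi * N / t * \<bar>Im w\<bar>"
    proof -
      have "z = of_real (pi * N / t) * (\<i> * w)" using t by (simp add: z_def vi field_simps)
      then have "Re z = pi * N / t * - Im w" by (simp del: of_real_mult of_real_divide)
      then show ?thesis using t N by (simp add: abs_mult)
    qed
    \<comment> \<open>Half of the exponent of \<open>q n\<close>: one half absorbs the growth of \<open>\<rho> n\<close>, the other half is left for the decay.\<close>
    define X where "X = (pi * N)\<^sup>2 / (2 * t)"
    have X: "0 \<le> X" using t by (simp add: X_def)
    have "\<bar>Re z\<bar> \<le> pi * N / t * (pi / 2)"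
      unfolding Rez using t N w by (intro mult_left_mono) auto
    also have "\<dots> = pi\<^sup>2 * N / (2 * t)" by (simp add: power2_eq_square mult_ac)
    also have "\<dots> \<le> X" unfolding X_def power_mult_distrib using t N
      by (intro divide_right_mono mult_left_mono) (auto simp: power2_eq_square)
    finally have ReX: "exp \<bar>Re z\<bar> \<le> exp X" by simp
    have "norm (\<rho> n) \<le> 2 * norm w * norm (cosh z) + 2 * norm v * norm (sinh z)"
      unfolding \<rho>_def v_def[symmetric] z_def[symmetric]
      by (rule norm_triangle_le) (simp add: norm_mult)
    also have "\<dots> \<le> 2 * norm w * exp X + 2 * norm v * (norm z * exp X)"
      using norm_cosh_le[of z] norm_sinh_le[of z] ReX
      by (intro add_mono mult_left_mono order.trans[OF norm_cosh_le] order.trans[OF norm_sinh_le]) auto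
    also have "\<dots> = norm w * ((2 + 8 * X) * exp X)"
      using t by (simp add: nv nz X_def power2_eq_square field_simps)
    finally have \<rho>: "norm (\<rho> n) \<le> norm w * ((2 + 8 * X) * exp X)" .
    have q: "q n = exp (- X) * exp (- X)" using t
      by (simp add: q_def X_def exp_add[symmetric] N_def field_simps)
    have "norm (of_real (q n) * \<rho> n) \<le> (exp (- X) * exp (- X)) * (norm w * ((2 + 8 * X) * exp X))"
      unfolding norm_mult norm_of_real q abs_mult using \<rho> by (intro mult_mono) auto
    also have "\<dots> = norm w * ((2 + 8 * X) * exp (- X))" by (simp add: exp_minus field_simps)
    also have "\<dots> \<le> norm w * (16 * exp (X / 2) * exp (- X))"
    proof (intro mult_left_mono mult_right_mono)
      have "2 + 8 * X \<le> 16 * (1 + X / 2)" by simp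
      also have "\<dots> \<le> 16 * exp (X / 2)" by (intro mult_left_mono exp_ge_add_one_self) simp
      finally show "2 + 8 * X \<le> 16 * exp (X / 2)" .
    qed auto
    also have "\<dots> = (16 * norm w) * exp (- (X / 2))" by (simp add: exp_minus field_simps flip: exp_add)
    also have "exp (- (X / 2)) \<le> exp (- 2 / t) ^ (n + 1)"
    proof -
      have "8 * N \<le> pi\<^sup>2 * N\<^sup>2"
      proof (rule mult_mono)
        have "3 * 3 \<le> pi * pi" using pi_gt3 by (intro mult_mono) auto
        then show "8 \<le> pi\<^sup>2" by (simp add: power2_eq_square)
        show "N \<le> N\<^sup>2" using N by (simp add: power2_eq_square)
      qed (use N in auto)
      then have "2 * N / t \<le> X / 2"
        using t by (simp add: X_def power_mult_distrib field_simps)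
      then have "exp (- (X / 2)) \<le> exp (N * (- 2 / t))" by (simp add: mult_ac)
      then show ?thesis unfolding N_def exp_of_nat_mult .
    qed
    finally show ?thesis by (simp add: mult_left_mono)
  qed
  define e where "e = exp (- 2 / t)"
  have e: "0 < e" "e \<le> 1 / 2"
  proof -
    have "exp (- 2 / t) \<le> exp (- 1)" using t by (simp add: field_simps)
    also have "exp (- 1) \<le> (1 / 2 :: real)"
      using exp_ge_add_one_self[of "1 :: real"] by (simp add: exp_minus field_simps)
    finally show "e \<le> 1 / 2" by (simp add: e_def)
  qed (simp add: e_def)
  have geo: "(\<lambda>n. (16 * norm w) * e ^ (n + 1)) sums ((16 * norm w) * (e / (1 - e)))"
    using sums_mult[OF geometric_sums[of e], of "16 * norm w * e"] e by (simp add: mult_ac)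
  have "norm R \<le> (16 * norm w) * (e / (1 - e))"
    unfolding sums_unique[OF sR] sums_unique[OF geo]
    by (rule norm_suminf_le[OF _ sums_summable[OF geo]]) (use bound in \<open>simp add: e_def\<close>)
  also have "\<dots> \<le> (16 * norm w) * (2 * e)"
    using e by (intro mult_left_mono) (auto simp: field_simps)
  finally have R: "norm R \<le> 32 * exp (- 2 / t) * norm w" by (simp add: e_def mult_ac)
  have s\<phi>2: "(\<lambda>n. (\<phi> (of_int (int n + 1)) + \<phi> (of_int (- int n - 1))) / 2) sums (S / 2)"
    using sums_divide[OF s\<phi>, of 2] by (simp add: \<phi>_def)
  moreover have "(\<phi> (of_int (int n + 1)) + \<phi> (of_int (- int n - 1))) / 2 =
      of_nat (n + 1) * exp (- of_real t * of_nat (n + 1) ^ 2) * sinh (of_nat (n + 1) * w)" for n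
  proof -
    define N where "N = real (n + 1)"
    have i: "real_of_int (int n + 1) = N" "real_of_int (- int n - 1) = - N" "of_nat (n + 1) = complex_of_real N"
      by (simp_all add: N_def)
    show ?thesis unfolding i
      by (simp add: \<phi>_def sinh_field_def exp_add exp_diff exp_minus field_simps)
  qed
  moreover have "S / 2 = of_real (sqrt pi / (4 * t powr (3 / 2))) * E * (w + R)"
    unfolding S_eq c_eq[symmetric] by simp
  ultimately show ?thesis using that[OF R] by (simp add: E_def)
qed

section \<open>Orbits of strongly continuous semigroups\<close>

text \<open>A linear map that is large at \<open>z\<close> is large at \<open>x + z\<close> or at \<open>x - z\<close>, by the triangle inequality.\<close>

lemma blinfun_large_on_ball:
  fixes T :: "'a::real_normed_vector \<Rightarrow>\<^sub>L 'b::real_normed_vector"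
  assumes c: "0 \<le> c" "c < norm T" and r: "0 < r"
  obtains y where "norm (y - x) \<le> r" "c * r \<le> norm (T y)"
proof -
  obtain u where u: "c * norm u < norm (T u)"
    using norm_blinfun_bound[OF c(1), of T] c(2) by (metis not_le)
  then have u0: "u \<noteq> 0" by auto
  define z where "z = (r / norm u) *\<^sub>R u"
  have nz: "norm z = r" using u0 r by (simp add: z_def)
  have "norm (T z) = (r / norm u) * norm (T u)"
    using r by (simp add: z_def blinfun.scaleR_right)
  moreover have "(r / norm u) * (c * norm u) \<le> (r / norm u) * norm (T u)"
    using u r by (intro mult_left_mono) auto
  ultimately have Tz: "c * r \<le> norm (T z)" using u0 by (simp add: mult_ac)
  have "2 * norm (T z) = norm (T (x + z) - T (x - z))"
    by (simp add: blinfun.add_right blinfun.diff_right flip: scaleR_2)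
  also have "\<dots> \<le> norm (T (x + z)) + norm (T (x - z))" by (rule norm_triangle_ineq4)
  finally consider "norm (T z) \<le> norm (T (x + z))" | "norm (T z) \<le> norm (T (x - z))" by linarith
  then show ?thesis
    using that[of "x + z"] that[of "x - z"] nz Tz by cases auto
qed

text \<open>A gliding hump: each step moves by at most \<open>3\<^sup>-\<^sup>n\<close> to a point at which \<open>T n\<close> is at least \<open>(2/3) 3\<^sup>-\<^sup>n \<parallel>T n\<parallel>\<close>. All
later steps together move by at most \<open>(1/2) 3\<^sup>-\<^sup>n\<close>, so \<open>T n\<close> is still at least \<open>(1/6) (4/3)\<^sup>n\<close> at the limit.\<close>

lemma uniform_boundedness:
  fixes T :: "nat \<Rightarrow> 'a::banach \<Rightarrow>\<^sub>L 'b::real_normed_vector"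
  assumes large: "\<And>n. 4 ^ n \<le> norm (T n)"
  shows "\<exists>x. \<not> bounded (range (\<lambda>n. T n x))"
proof -
  have "\<exists>x. \<forall>n. (n = 0 \<longrightarrow> x n = 0) \<and> (norm (x (Suc n) - x n) \<le> (1 / 3) ^ n \<and>
      (2 / 3 * norm (T n)) * (1 / 3) ^ n \<le> norm (T n (x (Suc n))))"
  proof (rule dependent_nat_choice)
    fix x :: 'a and n :: nat
    have "0 < norm (T n)" by (rule less_le_trans[OF _ large]) simp
    then obtain y where "norm (y - x) \<le> (1 / 3) ^ n" "(2 / 3 * norm (T n)) * (1 / 3) ^ n \<le> norm (T n y)"
      using blinfun_large_on_ball[of "2 / 3 * norm (T n)" "T n" "(1 / 3) ^ n" x] by auto
    then show "\<exists>y. (Suc n = 0 \<longrightarrow> y = 0) \<and> (norm (y - x) \<le> (1 / 3) ^ n \<and> (2 / 3 * norm (T n)) * (1 / 3) ^ n \<le> norm (T n y))"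
      by blast
  qed auto
  then obtain x where x0: "x 0 = 0" and step: "\<And>n. norm (x (Suc n) - x n) \<le> (1 / 3) ^ n"
    and big: "\<And>n. (2 / 3 * norm (T n)) * (1 / 3) ^ n \<le> norm (T n (x (Suc n)))" by auto
  define d where "d n = x (Suc n) - x n" for n
  have geo: "(\<lambda>k. (1 / 3 :: real) ^ (k + m)) sums ((1 / 3) ^ m * (3 / 2))" for m
    using sums_mult[OF geometric_sums[of "1 / 3 :: real"], of "(1 / 3) ^ m"] by (simp add: power_add mult_ac)
  have sd: "summable d"
    by (rule summable_comparison_test'[OF sums_summable[OF geo[of 0]], of 0]) (use step in \<open>simp add: d_def\<close>)
  define l where "l = suminf d"
  have tail: "norm (l - x (Suc n)) \<le> (1 / 3) ^ n * (1 / 2)" for n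
  proof -
    have "(\<Sum>k<Suc n. d k) = x (Suc n)" unfolding d_def sum_lessThan_telescope x0 by simp
    then have "l - x (Suc n) = (\<Sum>k. d (k + Suc n))"
      using suminf_split_initial_segment[OF sd, of "Suc n"] by (simp add: l_def)
    also have "norm \<dots> \<le> (\<Sum>k. (1 / 3) ^ (k + Suc n))"
      unfolding d_def by (rule norm_suminf_le[OF step sums_summable[OF geo]])
    also have "\<dots> = (1 / 3) ^ n * (1 / 2)"
      using sums_unique[OF geo[of "Suc n"]] by simp
    finally show ?thesis .
  qed
  have lower: "(1 / 6) * (4 / 3) ^ n \<le> norm (T n l)" for n
  proof -
    have "norm (T n (x (Suc n))) \<le> norm (T n l) + norm (T n (l - x (Suc n)))"
      using norm_triangle_ineq4[of "T n l" "T n (l - x (Suc n))"] by (simp add: blinfun.diff_right)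
    moreover have "norm (T n (l - x (Suc n))) \<le> norm (T n) * ((1 / 3) ^ n * (1 / 2))"
      by (rule order.trans[OF norm_blinfun mult_left_mono[OF tail]]) simp
    ultimately have "(1 / 6) * (norm (T n) * (1 / 3) ^ n) \<le> norm (T n l)" using big[of n] by simp
    moreover have "(1 / 6) * (4 ^ n * (1 / 3) ^ n) \<le> (1 / 6) * (norm (T n) * (1 / 3) ^ n)"
      using large[of n] by (intro mult_left_mono mult_right_mono) auto
    ultimately show ?thesis by (simp flip: power_mult_distrib)
  qed
  have "\<not> bounded (range (\<lambda>n. T n l))"
  proof
    assume "bounded (range (\<lambda>n. T n l))"
    then obtain B where "\<And>n. norm (T n l) \<le> B" unfolding bounded_iff by auto
    then have B: "(1 / 6) * (4 / 3) ^ n \<le> B" for n using lower order.trans by blast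
    obtain n where "6 * B < (4 / 3) ^ n" using real_arch_pow[of "4 / 3" "6 * B"] by auto
    with B[of n] show False by simp
  qed
  then show ?thesis ..
qed

text \<open>Otherwise operators \<open>P (s n)\<close> with \<open>s n\<close> tending to 0 would be unbounded at some vector, where
they converge by strong continuity.\<close>

lemma C0_semigroup_locally_bounded:
  assumes C0: "C0_semigroup P"
  obtains \<delta> M where "0 < \<delta>" "\<And>s. 0 \<le> s \<Longrightarrow> s \<le> \<delta> \<Longrightarrow> norm (P s) \<le> M"
proof -
  have "\<exists>\<delta>>0. \<exists>M. \<forall>s. 0 \<le> s \<longrightarrow> s \<le> \<delta> \<longrightarrow> norm (P s) \<le> M"
  proof (rule ccontr)
    assume neg: "\<not> (\<exists>\<delta>>0. \<exists>M. \<forall>s. 0 \<le> s \<longrightarrow> s \<le> \<delta> \<longrightarrow> norm (P s) \<le> M)"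
    have "\<exists>s. 0 \<le> s \<and> s \<le> 1 / real (Suc n) \<and> 4 ^ n < norm (P s)" for n
    proof -
      have "0 < 1 / real (Suc n)" by simp
      with neg show ?thesis by (meson not_le)
    qed
    then obtain s where s: "\<And>n. 0 \<le> s n" "\<And>n. s n \<le> 1 / real (Suc n)" "\<And>n. 4 ^ n < norm (P (s n))"
      by metis
    have s_pos: "0 < s n" for n
    proof -
      have "norm (P 0) \<le> 1" using C0 norm_blinfun_id_le by (simp add: C0_semigroup_def)
      also have "1 \<le> (4::real) ^ n" by simp
      finally have "s n \<noteq> 0" using s(3)[of n] by auto
      then show ?thesis using s(1)[of n] by simp
    qed
    have "s \<longlonglongrightarrow> 0"
      by (rule tendsto_sandwich[OF _ _ tendsto_const LIMSEQ_inverse_real_of_nat])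
         (use s in \<open>auto simp: inverse_eq_divide\<close>)
    then have lim: "filterlim s (at_right 0) sequentially"
      unfolding at_within_def filterlim_inf filterlim_principal using s_pos by (simp add: s_pos less_imp_neq[symmetric])
    have "bounded (range (\<lambda>n. P (s n) x))" for x
    proof -
      have "((\<lambda>t. P t x) \<longlongrightarrow> x) (at_right 0)" using C0 by (simp add: C0_semigroup_def)
      from filterlim_compose[OF this lim] show ?thesis by (rule convergent_imp_bounded)
    qed
    moreover have "\<exists>x. \<not> bounded (range (\<lambda>n. P (s n) x))"
      by (rule uniform_boundedness) (use s(3) less_imp_le in blast)
    ultimately show False by blast
  qed
  then show ?thesis using that by blast
qed

lemma C0_semigroup_left_bounded:
  assumes C0: "C0_semigroup P" and t: "0 < t"
  obtains C where "eventually (\<lambda>s. norm (P (t - s)) \<le> C) (at_right 0)"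
proof -
  obtain \<delta> M where d: "0 < \<delta>" "\<And>s. 0 \<le> s \<Longrightarrow> s \<le> \<delta> \<Longrightarrow> norm (P s) \<le> M"
    using C0_semigroup_locally_bounded[OF C0] by blast
  define e where "e = min \<delta> t"
  have e: "0 < e" "e \<le> \<delta>" "e \<le> t" using d t by (auto simp: e_def)
  have "eventually (\<lambda>s. norm (P (t - s)) \<le> norm (P (t - e)) * M) (at_right 0)"
    using eventually_at_right_less[of 0] eventually_at_right_real[OF e(1)]
  proof eventually_elim
    case (elim s)
    then have s: "0 \<le> e - s" "e - s \<le> \<delta>" using e by auto
    have "P (t - s) = P ((t - e) + (e - s))" by simp
    also have "\<dots> = P (t - e) o\<^sub>L P (e - s)"
      using C0 e s unfolding C0_semigroup_def by (meson diff_ge_0_iff_ge)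
    finally have "norm (P (t - s)) \<le> norm (P (t - e)) * norm (P (e - s))"
      by (simp add: norm_blinfun_compose)
    also have "\<dots> \<le> norm (P (t - e)) * M" using d(2)[OF s] by (intro mult_left_mono) auto
    finally show ?case .
  qed
  then show ?thesis by (rule that)
qed

text \<open>Strong continuity only controls \<open>P\<close> from the right; the left derivative of an orbit needs that the operators
\<open>P (t - s)\<close> are bounded for small \<open>s\<close>.\<close>

lemma C0_semigroup_left_limit:
  assumes C0: "C0_semigroup P" and t: "0 < t" and g: "(g \<longlongrightarrow> 0) (at_right 0)"
  shows "((\<lambda>s. P (t - s) (g s)) \<longlongrightarrow> 0) (at_right 0)"
proof -
  obtain C where C: "eventually (\<lambda>s. norm (P (t - s)) \<le> C) (at_right 0)"
    using C0_semigroup_left_bounded[OF C0 t] by blast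
  have "((\<lambda>s. C * norm (g s)) \<longlongrightarrow> C * 0) (at_right 0)"
    by (intro tendsto_mult tendsto_const tendsto_norm_zero g)
  then have z: "((\<lambda>s. C * norm (g s)) \<longlongrightarrow> 0) (at_right 0)" by simp
  show ?thesis
  proof (rule Lim_null_comparison[OF _ z])
    show "eventually (\<lambda>s. norm (P (t - s) (g s)) \<le> C * norm (g s)) (at_right 0)"
      using C by eventually_elim (meson norm_blinfun order.trans mult_right_mono norm_ge_zero)
  qed
qed

lemma C0_semigroup_add:
  assumes C0: "C0_semigroup P" and "0 < t"
  shows "eventually (\<lambda>s. P (t + s) f = P t (P s f) \<and> P t f = P (t - s) (P s f)) (at_right 0)"
  using eventually_at_right_less[of 0] eventually_at_right_real[OF assms(2)]
proof eventually_elim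
  case (elim s)
  have "P (t + s) = P t o\<^sub>L P s" "P (t - s + s) = P (t - s) o\<^sub>L P s"
    using C0 elim assms(2) unfolding C0_semigroup_def
    by (meson less_imp_le, meson less_imp_le diff_ge_0_iff_ge greaterThanLessThan_iff)
  then show ?case by simp
qed

text \<open>The left difference quotient is \<open>P (t - s)\<close> applied to the quotient \<open>(P s f - f) / s\<close>, which tends to \<open>h\<close>; it is
compared with \<open>P t h = P (t - s) (P s h)\<close>.\<close>

theorem C0_semigroup_orbit_derivative:
  assumes C0: "C0_semigroup P" and gen: "(f, h) \<in> generator P" and l: "bounded_linear l" and t: "0 < t"
  shows "((\<lambda>t. l (P t f)) has_real_derivative l (P t h)) (at t)"
proof -
  interpret l: bounded_linear l by fact
  have q: "((\<lambda>s. (P s f - f) /\<^sub>R s) \<longlongrightarrow> h) (at_right 0)" using gen by (simp add: generator_def)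
  have h0: "((\<lambda>s. P s h) \<longlongrightarrow> h) (at_right 0)" using C0 by (simp add: C0_semigroup_def)
  have right: "((\<lambda>s. (l (P (t + s) f) - l (P t f)) / s) \<longlongrightarrow> l (P t h)) (at_right 0)"
  proof (rule Lim_transform_eventually)
    show "((\<lambda>s. l (P t ((P s f - f) /\<^sub>R s))) \<longlongrightarrow> l (P t h)) (at_right 0)"
      by (intro l.tendsto blinfun.tendsto tendsto_const q)
    show "eventually (\<lambda>s. l (P t ((P s f - f) /\<^sub>R s)) = (l (P (t + s) f) - l (P t f)) / s) (at_right 0)"
      using C0_semigroup_add[OF C0 t, of f]
    proof eventually_elim
      case (elim s)
      have "P (t + s) f = P t (P s f)" using elim by blast
      then show ?case by (simp add: blinfun.diff_right blinfun.scaleR_right l.diff l.scaleR divide_inverse algebra_simps)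
    qed
  qed
  have left: "((\<lambda>s. (l (P (t + - s) f) - l (P t f)) / (- s)) \<longlongrightarrow> l (P t h)) (at_right 0)"
  proof (rule Lim_transform_eventually)
    have "((\<lambda>s. ((P s f - f) /\<^sub>R s - h) + (h - P s h)) \<longlongrightarrow> (h - h) + (h - h)) (at_right 0)"
      by (intro tendsto_add tendsto_diff tendsto_const q h0)
    then have z: "((\<lambda>s. P (t - s) (((P s f - f) /\<^sub>R s - h) + (h - P s h))) \<longlongrightarrow> 0) (at_right 0)"
      by (intro C0_semigroup_left_limit[OF C0 t]) simp
    show "((\<lambda>s. l (P (t - s) (((P s f - f) /\<^sub>R s - h) + (h - P s h)) + P t h)) \<longlongrightarrow> l (P t h)) (at_right 0)"
      using l.tendsto[OF tendsto_add[OF z tendsto_const[of "P t h"]]] unfolding add_0 .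
    show "eventually (\<lambda>s. l (P (t - s) (((P s f - f) /\<^sub>R s - h) + (h - P s h)) + P t h) =
        (l (P (t + - s) f) - l (P t f)) / (- s)) (at_right 0)"
      using C0_semigroup_add[OF C0 t, of f] C0_semigroup_add[OF C0 t, of h] eventually_at_right_less[of 0]
    proof eventually_elim
      case (elim s)
      have "P (t - s) (((P s f - f) /\<^sub>R s - h) + (h - P s h)) + P t h = (P t f - P (t - s) f) /\<^sub>R s"
        using elim by (simp add: blinfun.diff_right blinfun.add_right blinfun.scaleR_right)
      then show ?case by (simp only:) (simp add: l.diff l.scaleR divide_inverse algebra_simps)
    qed
  qed
  have "((\<lambda>s. (l (P (t + s) f) - l (P t f)) / s) \<longlongrightarrow> l (P t h)) (at 0)"
    by (rule filterlim_split_at[OF _ right]) (use left in \<open>simp add: filterlim_at_left_to_right[where a = 0]\<close>)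
  then show ?thesis by (simp add: DERIV_def)
qed

lemma C0_semigroup_orbit_tendsto_0:
  assumes C0: "C0_semigroup P" and l: "bounded_linear l"
  shows "((\<lambda>t. l (P t f)) \<longlongrightarrow> l f) (at_right 0)"
  using C0 by (intro bounded_linear.tendsto[OF l]) (simp add: C0_semigroup_def)

section \<open>The subelliptic operator on monomials\<close>

definition entry_a :: "mat2 \<Rightarrow> complex" where "entry_a A = A $ 1 $ 1"
definition entry_b :: "mat2 \<Rightarrow> complex" where "entry_b A = A $ 1 $ 2"

lemma mat_of_times: "mat_of (g * h) = mat_of g ** mat_of h"
  by (rule times_SU2.rep_eq)

lemma entries_one: "entry_a (mat_of 1) = 1" "entry_b (mat_of 1) = 0"
  by (simp_all add: entry_a_def entry_b_def one_SU2.rep_eq mat_def)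

lemma entries_unit: "entry_a (mat_of g) * cnj (entry_a (mat_of g)) + entry_b (mat_of g) * cnj (entry_b (mat_of g)) = 1"
proof -
  have "(mat_of g ** cadjoint (mat_of g)) $ 1 $ 1 = (mat 1 :: mat2) $ 1 $ 1"
    using mat_of[of g] by simp
  then show ?thesis by (simp add: matrix_matrix_mult_def cadjoint_def sum_2 mat_def entry_a_def entry_b_def)
qed

lemma norm_entry_le_1: "norm (entry_a (mat_of g)) \<le> 1" "norm (entry_b (mat_of g)) \<le> 1"
proof -
  have "complex_of_real ((norm (entry_a (mat_of g)))\<^sup>2 + (norm (entry_b (mat_of g)))\<^sup>2) = of_real 1"
    using entries_unit[of g] by (simp only: complex_norm_square of_real_add of_real_1)
  then have "(norm (entry_a (mat_of g)))\<^sup>2 + (norm (entry_b (mat_of g)))\<^sup>2 = 1"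
    by (simp only: of_real_eq_iff)
  then have "(norm (entry_a (mat_of g)))\<^sup>2 \<le> 1" "(norm (entry_b (mat_of g)))\<^sup>2 \<le> 1"
    using zero_le_power2[of "norm (entry_a (mat_of g))"] zero_le_power2[of "norm (entry_b (mat_of g))"] by linarith+
  then show "norm (entry_a (mat_of g)) \<le> 1" "norm (entry_b (mat_of g)) \<le> 1"
    by (simp_all add: power_le_one_iff abs_square_le_1)
qed

lemma mat_of_exp_axis:
  shows "mat_of (exp_SU2 (s *\<^sub>R X_su2)) = cos s *\<^sub>R mat 1 + sin s *\<^sub>R X_su2"
    and "mat_of (exp_SU2 (s *\<^sub>R Y_su2)) = cos s *\<^sub>R mat 1 + sin s *\<^sub>R Y_su2"
    and "mat_of (exp_SU2 (s *\<^sub>R Z_su2)) = cos s *\<^sub>R mat 1 + sin s *\<^sub>R Z_su2"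
proof -
  have e: "sin \<bar>s\<bar> / \<bar>s\<bar> * s = sin s" "cos \<bar>s\<bar> = cos s" by (auto simp: abs_if)
  show "mat_of (exp_SU2 (s *\<^sub>R X_su2)) = cos s *\<^sub>R mat 1 + sin s *\<^sub>R X_su2"
    using mat_of_exp_SU2[of s 0 0] mat_exp_closed_form[of s 0 0] e by simp
  show "mat_of (exp_SU2 (s *\<^sub>R Y_su2)) = cos s *\<^sub>R mat 1 + sin s *\<^sub>R Y_su2"
    using mat_of_exp_SU2[of 0 s 0] mat_exp_closed_form[of 0 s 0] e by simp
  show "mat_of (exp_SU2 (s *\<^sub>R Z_su2)) = cos s *\<^sub>R mat 1 + sin s *\<^sub>R Z_su2"
    using mat_of_exp_SU2[of 0 0 s] mat_exp_closed_form[of 0 0 s] e by simp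
qed

lemma entries_flow_X:
  "entry_a (mat_of (g * exp_SU2 (s *\<^sub>R X_su2))) = entry_a (mat_of g) * of_real (cos s) - entry_b (mat_of g) * of_real (sin s)"
  "entry_b (mat_of (g * exp_SU2 (s *\<^sub>R X_su2))) = entry_b (mat_of g) * of_real (cos s) + entry_a (mat_of g) * of_real (sin s)"
  unfolding mat_of_times mat_of_exp_axis by (simp_all add: entry_a_def entry_b_def matrix_matrix_mult_def sum_2 mat_def X_su2_def scaleR_conv_of_real[where 'a = complex])

lemma entries_flow_Y:
  "entry_a (mat_of (g * exp_SU2 (s *\<^sub>R Y_su2))) = entry_a (mat_of g) * of_real (cos s) + \<i> * entry_b (mat_of g) * of_real (sin s)"
  "entry_b (mat_of (g * exp_SU2 (s *\<^sub>R Y_su2))) = entry_b (mat_of g) * of_real (cos s) + \<i> * entry_a (mat_of g) * of_real (sin s)"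
  unfolding mat_of_times mat_of_exp_axis by (simp_all add: entry_a_def entry_b_def matrix_matrix_mult_def sum_2 mat_def Y_su2_def scaleR_conv_of_real[where 'a = complex])

text \<open>The exponents belong to \<open>a\<close>, \<open>cnj a\<close> and \<open>b\<close>. Monomials with powers of \<open>cnj b\<close> reduce to these monomials and their
conjugates by \<open>b (cnj b) = 1 - a (cnj a)\<close>.\<close>

definition cmono :: "nat \<Rightarrow> nat \<Rightarrow> nat \<Rightarrow> mat2 \<Rightarrow> complex" where
  "cmono i j k A = entry_a A ^ i * cnj (entry_a A) ^ j * entry_b A ^ k"

text \<open>The eigenvalue, up to sign, of the subelliptic operator whose eigenfunction has leading term
\<open>cmono i j k\<close>. For \<open>k = 0\<close> it is \<open>m (m + 2) - n\<^sup>2\<close> with \<open>m = i + j\<close> and \<open>n = i - j\<close>: the eigenvalue of the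
sphere minus that of \<open>-Z\<^sup>2\<close>.\<close>

definition disc_eig :: "nat \<Rightarrow> nat \<Rightarrow> nat \<Rightarrow> real" where
  "disc_eig i j k = 4 * real i * real j + 2 * real i + 2 * real j + 2 * real k + 4 * real i * real k"

lemma has_vector_derivative_real_axis:
  "(f has_field_derivative D) (at (0::complex)) \<Longrightarrow> ((\<lambda>s. f (of_real s)) has_vector_derivative D) (at 0)"
  using has_vector_derivative_real_field[of f D 0] by simp

lemma left_inv_field_Re:
  assumes "\<And>g. ((\<lambda>s. F (g * exp_SU2 (s *\<^sub>R V))) has_vector_derivative F' g) (at 0)"
  shows "left_inv_field V (\<lambda>g. Re (F g)) = (\<lambda>g. Re (F' g))"
proof
  fix g
  have "((\<lambda>s. Re (F (g * exp_SU2 (s *\<^sub>R V)))) has_vector_derivative Re (F' g)) (at 0)"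
    by (rule bounded_linear.has_vector_derivative[OF bounded_linear_Re assms])
  then show "left_inv_field V (\<lambda>g. Re (F g)) g = Re (F' g)"
    unfolding left_inv_field_def by (intro DERIV_imp_deriv) (simp add: has_real_derivative_iff_has_vector_derivative)
qed

text \<open>Along the flows of \<open>X\<close> and \<open>Y\<close> the pair \<open>(a, b)\<close> moves on great circles, so the second derivatives are those of an
explicit function of one variable. The squares of the velocities of \<open>a\<close> along \<open>X\<close> and \<open>Y\<close> cancel, and so do those of \<open>b\<close>,
so that only mixed products of velocities remain; the relation \<open>b (cnj b) = 1 - a (cnj a)\<close> then makes the result
triangular.\<close>

lemma subLaplacian_cmono:
  "subLaplacian (\<lambda>g. Re (c * cmono i j k (mat_of g))) =
    (\<lambda>g. Re (c * (- of_real (disc_eig i j k) * cmono i j k (mat_of g) + of_nat (4 * i * j) * cmono (i - 1) (j - 1) k (mat_of g))))"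
proof
  fix g0 :: SU2
  define a where "a g = entry_a (mat_of g)" for g
  define b where "b g = entry_b (mat_of g)" for g
  define M where "M x x' y = c * (x ^ i * x' ^ j * y ^ k)" for x x' y :: complex
  \<comment> \<open>First and second derivative of \<open>M\<close> along a curve with velocity \<open>(dx, dx', dy)\<close> and acceleration \<open>(ddx, ddx', ddy)\<close>.\<close>
  define D where "D x x' y dx dx' dy = c * (of_nat i * x ^ (i - 1) * dx * x' ^ j * y ^ k +
     x ^ i * (of_nat j * x' ^ (j - 1) * dx') * y ^ k + x ^ i * x' ^ j * (of_nat k * y ^ (k - 1) * dy))" for x x' y dx dx' dy :: complex
  define D2 where "D2 x x' y dx dx' dy ddx ddx' ddy =
     c * (of_nat i * (of_nat (i - 1) * x ^ (i - 1 - 1) * dx) * dx * x' ^ j * y ^ k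
        + of_nat i * x ^ (i - 1) * ddx * x' ^ j * y ^ k
        + x ^ i * (of_nat j * (of_nat (j - 1) * x' ^ (j - 1 - 1) * dx') * dx') * y ^ k
        + x ^ i * (of_nat j * x' ^ (j - 1) * ddx') * y ^ k
        + x ^ i * x' ^ j * (of_nat k * (of_nat (k - 1) * y ^ (k - 1 - 1) * dy) * dy)
        + x ^ i * x' ^ j * (of_nat k * y ^ (k - 1) * ddy)
        + 2 * (of_nat i * x ^ (i - 1) * dx) * (of_nat j * x' ^ (j - 1) * dx') * y ^ k
        + 2 * (of_nat i * x ^ (i - 1) * dx) * x' ^ j * (of_nat k * y ^ (k - 1) * dy)
        + 2 * x ^ i * (of_nat j * x' ^ (j - 1) * dx') * (of_nat k * y ^ (k - 1) * dy))"
     for x x' y dx dx' dy ddx ddx' ddy :: complex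
  have first: "((\<lambda>z. M (f z) (f' z) (h z)) has_field_derivative D (f 0) (f' 0) (h 0) df df' dh) (at 0)"
    if "(f has_field_derivative df) (at 0)" "(f' has_field_derivative df') (at 0)" "(h has_field_derivative dh) (at 0)" for f f' h df df' dh
    unfolding M_def D_def by (rule derivative_eq_intros that refl | simp)+ (simp add: algebra_simps)
  have second: "((\<lambda>z. D (f z) (f' z) (h z) (u z) (u' z) (v z)) has_field_derivative D2 (f 0) (f' 0) (h 0) (u 0) (u' 0) (v 0) du du' dv) (at 0)"
    if "(f has_field_derivative u 0) (at 0)" "(f' has_field_derivative u' 0) (at 0)" "(h has_field_derivative v 0) (at 0)"
      "(u has_field_derivative du) (at 0)" "(u' has_field_derivative du') (at 0)" "(v has_field_derivative dv) (at 0)" for f f' h u u' v du du' dv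
    unfolding D_def D2_def by (rule derivative_eq_intros that refl | simp)+ (simp add: algebra_simps)
  \<comment> \<open>Both flows rotate the pair \<open>(a, b)\<close>: \<open>e = -1, e' = 1\<close> for \<open>X\<close> and \<open>e = e' = \<i>\<close> for \<open>Y\<close>.\<close>
  have flow: "left_inv_field V (left_inv_field V (\<lambda>g. Re (M (a g) (cnj (a g)) (b g)))) =
      (\<lambda>g. Re (D2 (a g) (cnj (a g)) (b g) (e * b g) (cnj e * cnj (b g)) (e' * a g) (- a g) (- cnj (a g)) (- b g)))"
    if Va: "\<And>g s. a (g * exp_SU2 (s *\<^sub>R V)) = a g * of_real (cos s) + e * b g * of_real (sin s)"
      and Vb: "\<And>g s. b (g * exp_SU2 (s *\<^sub>R V)) = b g * of_real (cos s) + e' * a g * of_real (sin s)"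
      and ee: "e * e' = - 1" for V e e'
  proof -
    have ee': "e' * e = - 1" "cnj e * cnj e' = - 1"
      using ee by (simp_all add: mult.commute flip: complex_cnj_mult)
    define ra where "ra g z = a g * cos z + e * b g * sin z" for g z
    define ra' where "ra' g z = cnj (a g) * cos z + cnj e * cnj (b g) * sin z" for g z
    define rb where "rb g z = b g * cos z + e' * a g * sin z" for g z
    define rb' where "rb' g z = cnj (b g) * cos z + cnj e' * cnj (a g) * sin z" for g z
    have r0: "ra g 0 = a g" "ra' g 0 = cnj (a g)" "rb g 0 = b g" "rb' g 0 = cnj (b g)" for g
      by (simp_all add: ra_def ra'_def rb_def rb'_def)
    have r: "a (g * exp_SU2 (s *\<^sub>R V)) = ra g (of_real s)" "cnj (ra g (of_real s)) = ra' g (of_real s)"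
      "b (g * exp_SU2 (s *\<^sub>R V)) = rb g (of_real s)" "cnj (rb g (of_real s)) = rb' g (of_real s)" for g s
      by (simp_all add: Va Vb ra_def ra'_def rb_def rb'_def cos_of_real sin_of_real)
    have d: "(ra g has_field_derivative e * b g) (at 0)" "(ra' g has_field_derivative cnj e * cnj (b g)) (at 0)"
      "(rb g has_field_derivative e' * a g) (at 0)" for g
      unfolding ra_def[abs_def] ra'_def[abs_def] rb_def[abs_def] by (auto intro!: derivative_eq_intros)
    have "((\<lambda>z. e * rb g z) has_field_derivative (e * e') * a g) (at 0)"
      "((\<lambda>z. cnj e * rb' g z) has_field_derivative (cnj e * cnj e') * cnj (a g)) (at 0)"
      "((\<lambda>z. e' * ra g z) has_field_derivative (e' * e) * b g) (at 0)" for g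
      unfolding ra_def rb_def rb'_def by (auto intro!: derivative_eq_intros)
    then have dd: "((\<lambda>z. e * rb g z) has_field_derivative - a g) (at 0)"
      "((\<lambda>z. cnj e * rb' g z) has_field_derivative - cnj (a g)) (at 0)"
      "((\<lambda>z. e' * ra g z) has_field_derivative - b g) (at 0)" for g
      unfolding ee ee' by simp_all
    have "left_inv_field V (\<lambda>g. Re (M (a g) (cnj (a g)) (b g))) =
        (\<lambda>g. Re (D (a g) (cnj (a g)) (b g) (e * b g) (cnj e * cnj (b g)) (e' * a g)))"
      by (rule left_inv_field_Re, unfold r)
         (rule has_vector_derivative_real_axis, rule first[where f = "ra _" and f' = "ra' _" and h = "rb _", OF d, unfolded r0])
    moreover have "left_inv_field V (\<lambda>g. Re (D (a g) (cnj (a g)) (b g) (e * b g) (cnj e * cnj (b g)) (e' * a g))) =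
        (\<lambda>g. Re (D2 (a g) (cnj (a g)) (b g) (e * b g) (cnj e * cnj (b g)) (e' * a g) (- a g) (- cnj (a g)) (- b g)))"
    proof (rule left_inv_field_Re, unfold r)
      fix g
      have "((\<lambda>z. D (ra g z) (ra' g z) (rb g z) (e * rb g z) (cnj e * rb' g z) (e' * ra g z)) has_field_derivative
          D2 (ra g 0) (ra' g 0) (rb g 0) (e * rb g 0) (cnj e * rb' g 0) (e' * ra g 0) (- a g) (- cnj (a g)) (- b g)) (at 0)"
        by (rule second) (simp_all only: d dd r0)
      from has_vector_derivative_real_axis[OF this[unfolded r0]]
      show "((\<lambda>s. D (ra g (of_real s)) (ra' g (of_real s)) (rb g (of_real s)) (e * rb g (of_real s)) (cnj e * rb' g (of_real s)) (e' * ra g (of_real s))) has_vector_derivative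
          D2 (a g) (cnj (a g)) (b g) (e * b g) (cnj e * cnj (b g)) (e' * a g) (- a g) (- cnj (a g)) (- b g)) (at 0)" .
    qed
    ultimately show ?thesis by simp
  qed
  have X: "left_inv_field X_su2 (left_inv_field X_su2 (\<lambda>g. Re (M (a g) (cnj (a g)) (b g)))) =
      (\<lambda>g. Re (D2 (a g) (cnj (a g)) (b g) (- 1 * b g) (cnj (- 1) * cnj (b g)) (1 * a g) (- a g) (- cnj (a g)) (- b g)))"
    by (rule flow) (simp_all add: a_def b_def entries_flow_X)
  have Y: "left_inv_field Y_su2 (left_inv_field Y_su2 (\<lambda>g. Re (M (a g) (cnj (a g)) (b g)))) =
      (\<lambda>g. Re (D2 (a g) (cnj (a g)) (b g) (\<i> * b g) (cnj \<i> * cnj (b g)) (\<i> * a g) (- a g) (- cnj (a g)) (- b g)))"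
    by (rule flow) (simp_all add: a_def b_def entries_flow_Y)
  have algebra: "D2 x x' y (- 1 * y) (cnj (- 1) * y') (1 * x) (- x) (- x') (- y) + D2 x x' y (\<i> * y) (cnj \<i> * y') (\<i> * x) (- x) (- x') (- y) =
     c * (- of_real (disc_eig i 0 k + 2 * real j) * (x ^ i * x' ^ j * y ^ k) + of_nat (4 * i * j) * (x ^ (i - 1) * x' ^ (j - 1) * y ^ k) * (y * y'))" for x x' y y'
    unfolding D2_def disc_eig_def
    by (cases i; cases j; cases k) (simp_all add: algebra_simps)
  define x where "x = a g0"
  define y where "y = b g0"
  have yy: "y * cnj y = 1 - x * cnj x"
    using entries_unit[of g0] by (simp add: x_def y_def a_def b_def algebra_simps)
  have red: "of_nat (4 * i * j) * (x ^ (i - 1) * cnj x ^ (j - 1) * y ^ k) * (x * cnj x) = of_nat (4 * i * j) * (x ^ i * cnj x ^ j * y ^ k)"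
    by (cases i; cases j) simp_all
  have "subLaplacian (\<lambda>g. Re (M (a g) (cnj (a g)) (b g))) g0 =
      Re (D2 x (cnj x) y (- 1 * y) (cnj (- 1) * cnj y) (1 * x) (- x) (- cnj x) (- y)) + Re (D2 x (cnj x) y (\<i> * y) (cnj \<i> * cnj y) (\<i> * x) (- x) (- cnj x) (- y))"
    unfolding subLaplacian_def X Y x_def y_def ..
  also have "\<dots> = Re (c * (- of_real (disc_eig i 0 k + 2 * real j) * (x ^ i * cnj x ^ j * y ^ k) + of_nat (4 * i * j) * (x ^ (i - 1) * cnj x ^ (j - 1) * y ^ k) * (y * cnj y)))"
    unfolding algebra[symmetric] by simp
  also have "\<dots> = Re (c * (- of_real (disc_eig i j k) * (x ^ i * cnj x ^ j * y ^ k) + of_nat (4 * i * j) * (x ^ (i - 1) * cnj x ^ (j - 1) * y ^ k)))"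
  proof -
    have "- of_real (disc_eig i 0 k + 2 * real j) * (x ^ i * cnj x ^ j * y ^ k) + of_nat (4 * i * j) * (x ^ (i - 1) * cnj x ^ (j - 1) * y ^ k) * (y * cnj y) =
      - of_real (disc_eig i 0 k + 2 * real j) * (x ^ i * cnj x ^ j * y ^ k) + of_nat (4 * i * j) * (x ^ (i - 1) * cnj x ^ (j - 1) * y ^ k)
        - of_nat (4 * i * j) * (x ^ i * cnj x ^ j * y ^ k)"
      unfolding yy red[symmetric] by (simp add: algebra_simps)
    also have "\<dots> = - of_real (disc_eig i j k) * (x ^ i * cnj x ^ j * y ^ k) + of_nat (4 * i * j) * (x ^ (i - 1) * cnj x ^ (j - 1) * y ^ k)"
      by (simp add: disc_eig_def algebra_simps)
    finally show ?thesis by (simp only:)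
  qed
  finally show "subLaplacian (\<lambda>g. Re (c * cmono i j k (mat_of g))) g0 =
     Re (c * (- of_real (disc_eig i j k) * cmono i j k (mat_of g0) + of_nat (4 * i * j) * cmono (i - 1) (j - 1) k (mat_of g0)))"
    by (simp only: M_def cmono_def a_def b_def x_def y_def)
qed

section \<open>Moments of the heat kernel\<close>

lemma continuous_on_mat_of: "continuous_on A mat_of"
  by (auto simp: continuous_on_iff dist_SU2_def)

lemma compact_range_mat_of: "compact (range mat_of)"
proof -
  have r: "range mat_of = {A. A ** cadjoint A = mat 1} \<inter> {A. cadjoint A ** A = mat 1} \<inter> {A. det A = 1}"
    using type_definition.Rep_range[OF type_definition_SU2] by auto
  have cont: "continuous_on UNIV (\<lambda>A::mat2. A ** cadjoint A)" "continuous_on UNIV (\<lambda>A::mat2. cadjoint A ** A)"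
    "continuous_on UNIV (\<lambda>A::mat2. det A)"
    unfolding matrix_matrix_mult_def cadjoint_def det_2
    by (intro continuous_intros continuous_on_vec_lambda | simp)+
  have "closed (range mat_of)"
    unfolding r by (intro closed_Int closed_Collect_eq cont continuous_intros)
  moreover have "bounded (range mat_of)"
  proof (rule boundedI)
    fix A assume "A \<in> range mat_of"
    then have A: "A ** cadjoint A = mat 1" using r by auto
    have le: "norm (A $ i $ j) \<le> 1" for i j
    proof -
      have "(A ** cadjoint A) $ i $ i = 1" unfolding A by (simp add: mat_def)
      then have "A $ i $ 1 * cnj (A $ i $ 1) + A $ i $ 2 * cnj (A $ i $ 2) = 1"
        by (simp add: matrix_matrix_mult_def cadjoint_def sum_2)
      then have "complex_of_real ((norm (A $ i $ 1))\<^sup>2 + (norm (A $ i $ 2))\<^sup>2) = of_real 1"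
        by (simp only: complex_norm_square of_real_add of_real_1)
      then have "(norm (A $ i $ 1))\<^sup>2 + (norm (A $ i $ 2))\<^sup>2 = 1" by (simp only: of_real_eq_iff)
      then have "(norm (A $ i $ j))\<^sup>2 \<le> 1"
        using zero_le_power2[of "norm (A $ i $ 1)"] zero_le_power2[of "norm (A $ i $ 2)"] exhaust_2[of j]
        by (metis add_increasing2 le_add_same_cancel1 le_add_same_cancel2)
      then show ?thesis by (simp add: power_le_one_iff abs_square_le_1)
    qed
    have "norm A \<le> (\<Sum>i\<in>UNIV. norm (A $ i))" unfolding norm_vec_def by (rule L2_set_le_sum) simp
    also have "\<dots> \<le> (\<Sum>i\<in>(UNIV :: 2 set). \<Sum>j\<in>(UNIV :: 2 set). norm (A $ i $ j))"
      by (intro sum_mono) (simp add: norm_vec_def L2_set_le_sum)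
    also have "\<dots> \<le> (\<Sum>i\<in>(UNIV :: 2 set). \<Sum>j\<in>(UNIV :: 2 set). 1)" by (intro sum_mono le)
    finally show "norm A \<le> 4" by simp
  qed
  ultimately show ?thesis by (rule compact_eq_bounded_closed[THEN iffD2, OF conjI, rotated])
qed

lemma compact_UNIV_SU2: "compact (UNIV :: SU2 set)"
proof -
  have "continuous_on (range mat_of) Abs_SU2"
    by (auto simp: continuous_on_iff dist_SU2_def mat_of_inverse)
  from compact_continuous_image[OF this compact_range_mat_of] show ?thesis
    by (simp add: image_image mat_of_inverse)
qed

lemma apply_Bcontfun:
  fixes f :: "SU2 \<Rightarrow> real"
  assumes "continuous_on UNIV f"
  shows "apply_bcontfun (Bcontfun f) = f"
proof (rule Bcontfun_inverse)
  have "bounded (range f)" by (intro compact_imp_bounded compact_continuous_image assms compact_UNIV_SU2)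
  then show "f \<in> bcontfun" using assms by (simp add: bcontfun_def)
qed

lemma real_polynomial_function_derivative:
  fixes f :: "'a::real_normed_vector \<Rightarrow> real"
  assumes "real_polynomial_function f"
  shows "\<exists>f'. (\<forall>x. (f has_derivative f' x) (at x)) \<and> (\<forall>v. real_polynomial_function (\<lambda>x. f' x v))"
  using assms
proof induction
  case (linear f)
  then show ?case
    by (intro exI[of _ "\<lambda>_. f"]) (auto intro: bounded_linear_imp_has_derivative)
next
  case (const c)
  then show ?case by (intro exI[of _ "\<lambda>_ _. 0"]) auto
next
  case (add f g)
  then obtain f' g' where "\<And>x. (f has_derivative f' x) (at x)" "\<And>v. real_polynomial_function (\<lambda>x. f' x v)"
    "\<And>x. (g has_derivative g' x) (at x)" "\<And>v. real_polynomial_function (\<lambda>x. g' x v)" by auto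
  then show ?case
    by (intro exI[of _ "\<lambda>x v. f' x v + g' x v"]) (auto intro!: has_derivative_add)
next
  case (mult f g)
  then obtain f' g' where "\<And>x. (f has_derivative f' x) (at x)" "\<And>v. real_polynomial_function (\<lambda>x. f' x v)"
    "\<And>x. (g has_derivative g' x) (at x)" "\<And>v. real_polynomial_function (\<lambda>x. g' x v)" by auto
  with mult(1,2) show ?case
    by (intro exI[of _ "\<lambda>x v. f x * g' x v + f' x v * g x"]) (auto intro!: has_derivative_mult real_polynomial_function.intros(3,4))
qed

text \<open>Directional derivatives of polynomials are polynomials.\<close>

lemma C_k_real_polynomial_function: "real_polynomial_function f \<Longrightarrow> C_k k f"
proof (induction k arbitrary: f)
  case 0
  then show ?case
    using continuous_on_eq_continuous_at continuous_real_polymonial_function by auto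
next
  case (Suc k)
  obtain f' where f': "\<And>x. (f has_derivative f' x) (at x)" "\<And>v. real_polynomial_function (\<lambda>x. f' x v)"
    using real_polynomial_function_derivative[OF Suc.prems] by auto
  have "frechet_derivative f (at x) = f' x" for x
    using frechet_derivative_at[OF f'(1)] by simp
  then show ?case using f' Suc.IH by (auto simp: differentiable_def)
qed

definition complex_polynomial_function :: "('a::real_normed_vector \<Rightarrow> complex) \<Rightarrow> bool" where
  "complex_polynomial_function f \<longleftrightarrow>
     real_polynomial_function (\<lambda>x. Re (f x)) \<and> real_polynomial_function (\<lambda>x. Im (f x))"

lemma complex_polynomial_function_intros:
  "complex_polynomial_function (\<lambda>_. c)"
  "complex_polynomial_function f \<Longrightarrow> complex_polynomial_function (\<lambda>x. cnj (f x))"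
  "complex_polynomial_function f \<Longrightarrow> complex_polynomial_function g \<Longrightarrow> complex_polynomial_function (\<lambda>x. f x * g x)"
  by (auto simp: complex_polynomial_function_def)

lemma complex_polynomial_function_power:
  "complex_polynomial_function f \<Longrightarrow> complex_polynomial_function (\<lambda>x. f x ^ n)"
  by (induction n) (auto intro: complex_polynomial_function_intros)

lemma real_polynomial_function_cmono:
  "real_polynomial_function (\<lambda>A. Re (c * cmono i j k A))"
proof -
  have lin: "bounded_linear (\<lambda>A::mat2. A $ i $ j)" for i j
    by (rule bounded_linear_compose[OF bounded_linear_vec_nth bounded_linear_vec_nth])
  have e: "complex_polynomial_function entry_a" "complex_polynomial_function entry_b"
    unfolding complex_polynomial_function_def entry_a_def entry_b_def
    by (auto intro!: real_polynomial_function.intros(1) bounded_linear_compose[OF bounded_linear_Re lin] bounded_linear_compose[OF bounded_linear_Im lin])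
  have "complex_polynomial_function (\<lambda>A. c * cmono i j k A)"
    unfolding cmono_def by (intro complex_polynomial_function_intros complex_polynomial_function_power e)
  then show ?thesis by (simp add: complex_polynomial_function_def)
qed

lemma continuous_on_real_polynomial_SU2:
  "real_polynomial_function F \<Longrightarrow> continuous_on UNIV (\<lambda>g. F (mat_of g))"
  by (rule continuous_on_compose2[OF _ continuous_on_mat_of[of UNIV], of UNIV])
     (auto intro: continuous_at_imp_continuous_on continuous_real_polymonial_function)

definition cmono_bcf :: "complex \<Rightarrow> nat \<Rightarrow> nat \<Rightarrow> nat \<Rightarrow> SU2 \<Rightarrow>\<^sub>C real" where
  "cmono_bcf c i j k = Bcontfun (\<lambda>g. Re (c * cmono i j k (mat_of g)))"

lemma apply_cmono_bcf: "apply_bcontfun (cmono_bcf c i j k) = (\<lambda>g. Re (c * cmono i j k (mat_of g)))"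
  unfolding cmono_bcf_def
  by (intro apply_Bcontfun continuous_on_real_polynomial_SU2 real_polynomial_function_cmono)

lemma cmono_in_generator:
  assumes "heat_semigroup P"
  shows "(cmono_bcf c i j k, (- disc_eig i j k) *\<^sub>R cmono_bcf c i j k + real (4 * i * j) *\<^sub>R cmono_bcf c (i - 1) (j - 1) k) \<in> generator P"
proof -
  have "apply_bcontfun ((- disc_eig i j k) *\<^sub>R cmono_bcf c i j k + real (4 * i * j) *\<^sub>R cmono_bcf c (i - 1) (j - 1) k) =
      subLaplacian (apply_bcontfun (cmono_bcf c i j k))"
    unfolding apply_cmono_bcf subLaplacian_cmono
    by (rule ext) (simp add: apply_cmono_bcf algebra_simps)
  moreover have "smooth_SU2 (apply_bcontfun (cmono_bcf c i j k))"
    unfolding smooth_SU2_def apply_cmono_bcf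
    by (rule exI[of _ "\<lambda>A. Re (c * cmono i j k A)"])
       (intro conjI allI refl C_k_real_polynomial_function real_polynomial_function_cmono)
  ultimately show ?thesis
    using assms unfolding heat_semigroup_def by (auto intro!: closure_subset[THEN subsetD])
qed

text \<open>The value at the identity of \<open>e\<^sup>t\<^sup>\<L>\<close> applied to \<open>a\<^sup>i (cnj a)\<^sup>j\<close>: the expansion of this monomial in disc
polynomials, each of which takes the value 1 at the identity.\<close>

definition disc_moment :: "nat \<Rightarrow> nat \<Rightarrow> real \<Rightarrow> real" where
  "disc_moment i j t = (\<Sum>d\<le>min i j. (real (i + j + 1) - 2 * real d) / (fact d * fact (i + j + 1 - d)) *
      (fact i * fact j) * exp (- disc_eig (i - d) (j - d) 0 * t))"

lemma disc_moment_0: "disc_moment i j 0 = 1"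
proof -
  define m where "m = min i j"
  have "disc_moment i j 0 = (\<Sum>d\<le>m. (real (i + j + 1) - 2 * real d) / (fact d * fact (i + j + 1 - d))) * (fact i * fact j)"
    by (simp add: disc_moment_def m_def sum_distrib_right)
  also have "\<dots> = 1 / (fact m * fact (i + j + 1 - 1 - m)) * (fact i * fact j)"
    by (subst sum_disc_weights) (auto simp: m_def)
  also have "\<dots> = 1" by (auto simp: m_def min_def)
  finally show ?thesis .
qed

text \<open>The coefficient of the exponential with index \<open>d\<close>, multiplied by the difference \<open>4 d (i + j + 1 - d)\<close> of the
eigenvalues, is \<open>4 i j\<close> times the coefficient with index \<open>d - 1\<close> for the lowered monomial.\<close>

lemma disc_moment_ODE:
  "(disc_moment i j has_real_derivative
     (- disc_eig i j 0 * disc_moment i j t + real (4 * i * j) * disc_moment (i - 1) (j - 1) t)) (at t)"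
proof -
  define w where "w i j d = (real (i + j + 1) - 2 * real d) / (fact d * fact (i + j + 1 - d)) * (fact i * fact j)" for i j d
  define e where "e d = exp (- disc_eig (i - d) (j - d) 0 * t)" for d
  have D: "(disc_moment i j has_real_derivative (\<Sum>d\<le>min i j. w i j d * (- disc_eig (i - d) (j - d) 0 * e d))) (at t)"
    unfolding disc_moment_def[abs_def] w_def e_def
    by (auto intro!: derivative_eq_intros sum.cong)
  have DM: "disc_moment i j t = (\<Sum>d\<le>min i j. w i j d * e d)"
    unfolding disc_moment_def w_def e_def by simp
  \<comment> \<open>Subtract the diagonal part of the equation; the term \<open>d = 0\<close> of the rest vanishes.\<close>
  have split: "(\<Sum>d\<le>min i j. w i j d * (- disc_eig (i - d) (j - d) 0 * e d)) =
      - disc_eig i j 0 * disc_moment i j t + (\<Sum>d\<le>min i j. w i j d * (disc_eig i j 0 - disc_eig (i - d) (j - d) 0) * e d)"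
    unfolding DM sum_distrib_left sum.distrib[symmetric] by (intro sum.cong refl) (simp add: algebra_simps)
  also have "(\<Sum>d\<le>min i j. w i j d * (disc_eig i j 0 - disc_eig (i - d) (j - d) 0) * e d) = real (4 * i * j) * disc_moment (i - 1) (j - 1) t"
  proof (cases "i = 0 \<or> j = 0")
    case True
    then show ?thesis by auto
  next
    case False
    then obtain i' j' where ij: "i = Suc i'" "j = Suc j'" by (metis not0_implies_Suc)
    have coeff: "w i j (Suc d) * (disc_eig i j 0 - disc_eig (i - Suc d) (j - Suc d) 0) = real (4 * i * j) * w i' j' d" if d: "d \<le> min i' j'" for d
    proof -
      obtain a b where ab: "i' = d + a" "j' = d + b" using d by (metis le_Suc_ex min.boundedE)
      have q: "disc_eig i j 0 - disc_eig (i - Suc d) (j - Suc d) 0 = 4 * real (Suc d) * real (d + a + b + 2)"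
        by (simp add: disc_eig_def ij ab algebra_simps)
      have n: "i + j + 1 - Suc d = Suc (Suc (d + a + b))" "i' + j' + 1 - d = Suc (d + a + b)" using ij ab by auto
      define X where "X = real (i + j + 1) - 2 * real (Suc d)"
      have X': "real (i' + j' + 1) - 2 * real d = X" by (simp add: X_def ij)
      define F where "F = (fact (Suc (d + a + b)) :: real)"
      have F: "fact (Suc (Suc (d + a + b))) = real (d + a + b + 2) * F"
        unfolding F_def by (subst fact_Suc) (simp del: fact_Suc)
      have F0: "F \<noteq> 0" unfolding F_def by (rule fact_nonzero)
      define f where "f = (fact d :: real)"
      have f: "fact (Suc d) = real (Suc d) * f" "f \<noteq> 0" by (simp_all add: f_def)
      have i: "fact i = real i * fact i'" "fact j = real j * (fact j' :: real)" by (simp_all add: ij)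
      have pos: "real (d + a + b + 2) \<noteq> 0" "real (Suc d) \<noteq> 0" by simp_all
      have alg: "X / ((s * f) * (r * F)) * ((x * fi) * (y * fj)) * (4 * s * r) = 4 * x * y * (X / (f * F) * (fi * fj))"
        if "s \<noteq> 0" "r \<noteq> 0" for s r x y fi fj :: real
        using that F0 f(2) by (simp add: divide_simps)
      show ?thesis
        unfolding w_def n q X' X_def[symmetric] F f F_def[symmetric] f_def[symmetric] i
        using alg[OF pos(2,1)] by simp
    qed
    have m: "min i j = Suc (min i' j')" by (simp add: ij)
    have "(\<Sum>d\<le>min i j. w i j d * (disc_eig i j 0 - disc_eig (i - d) (j - d) 0) * e d) =
        (\<Sum>d\<le>min i' j'. w i j (Suc d) * (disc_eig i j 0 - disc_eig (i - Suc d) (j - Suc d) 0) * e (Suc d))"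
      unfolding m by (subst sum.atMost_Suc_shift) simp
    also have "\<dots> = (\<Sum>d\<le>min i' j'. real (4 * i * j) * w i' j' d * e (Suc d))"
      by (intro sum.cong refl) (simp only: coeff atMost_iff)
    also have "\<dots> = real (4 * i * j) * disc_moment (i - 1) (j - 1) t"
      by (simp add: disc_moment_def ij w_def e_def sum_distrib_left mult_ac)
    finally show ?thesis .
  qed
  finally show ?thesis using D by simp
qed

lemma linear_ODE_zero:
  fixes D :: "real \<Rightarrow> real"
  assumes D': "\<And>t. 0 < t \<Longrightarrow> (D has_real_derivative - q * D t) (at t)"
    and D0: "(D \<longlongrightarrow> 0) (at_right 0)" and t: "0 < t"
  shows "D t = 0"
proof -
  define E where "E t = exp (q * t) * D t" for t
  have "\<exists>c. \<forall>x\<in>{0<..}. E x = c"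
  proof (rule has_field_derivative_zero_constant)
    fix x :: real assume "x \<in> {0<..}"
    then have x: "0 < x" by simp
    have "((\<lambda>t. exp (q * t)) has_real_derivative q * exp (q * x)) (at x)"
      by (auto intro!: derivative_eq_intros)
    from DERIV_mult[OF this D'[OF x]] have "(E has_real_derivative 0) (at x)"
      by (simp add: E_def[abs_def] algebra_simps)
    then show "(E has_field_derivative 0) (at x within {0<..})" by (rule DERIV_subset) simp
  qed simp
  then obtain c where c: "\<And>x. 0 < x \<Longrightarrow> E x = c" by auto
  have "(E \<longlongrightarrow> exp (q * 0) * 0) (at_right 0)"
    unfolding E_def by (intro tendsto_intros D0)
  moreover have "(E \<longlongrightarrow> c) (at_right 0)"
    by (intro tendsto_eventually) (use c in \<open>auto simp: eventually_at_filter\<close>)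
  ultimately have "c = 0" using tendsto_unique[of "at_right (0::real)"] by (metis mult_zero_right trivial_limit_at_right_real)
  then show ?thesis using c[OF t] by (simp add: E_def)
qed

lemma bounded_linear_eval: "bounded_linear (\<lambda>f. apply_bcontfun f x)"
proof (rule bounded_linear_intro[where K = 1])
  fix f :: "'a \<Rightarrow>\<^sub>C 'b"
  show "norm (apply_bcontfun f x) \<le> norm f * 1" using norm_bounded[of f x] by simp
qed simp_all

text \<open>Both sides satisfy the same linear differential equation with the same limit at 0, by induction along
the lowering of \<open>i\<close> and \<open>j\<close>. For \<open>k > 0\<close> the initial values vanish, because \<open>b\<close> is 0 at the identity, and so
does the solution.\<close>

theorem heat_semigroup_cmono:
  assumes P: "heat_semigroup P" and t: "0 < t"
  shows "apply_bcontfun (P t (cmono_bcf c i j k)) 1 = (if k = 0 then Re c * disc_moment i j t else 0)"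
proof -
  have C0: "C0_semigroup P" using P by (simp add: heat_semigroup_def)
  define \<phi> where "\<phi> i j t = apply_bcontfun (P t (cmono_bcf c i j k)) 1" for i j t
  define G where "G i j t = (if k = 0 then Re c * disc_moment i j t else 0)" for i j t
  have \<phi>': "(\<phi> i j has_real_derivative (- disc_eig i j k * \<phi> i j t + real (4 * i * j) * \<phi> (i - 1) (j - 1) t)) (at t)" if "0 < t" for i j t
    using C0_semigroup_orbit_derivative[OF C0 cmono_in_generator[OF P, of c i j k] bounded_linear_eval[of 1] that]
    by (simp add: \<phi>_def[abs_def] blinfun.add_right blinfun.scaleR_right blinfun.diff_right blinfun.minus_right)
  have \<phi>0: "(\<phi> i j \<longlongrightarrow> (if k = 0 then Re c else 0)) (at_right 0)" for i j
    using C0_semigroup_orbit_tendsto_0[OF C0 bounded_linear_eval[of 1], of "cmono_bcf c i j k"]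
    by (simp add: \<phi>_def[abs_def] apply_cmono_bcf cmono_def entries_one power_0_left split: if_splits)
  have G': "(G i j has_real_derivative (- disc_eig i j k * G i j t + real (4 * i * j) * G (i - 1) (j - 1) t)) (at t)" for i j t
  proof (cases "k = 0")
    case True
    have "((\<lambda>t. Re c * disc_moment i j t) has_real_derivative Re c * (- disc_eig i j 0 * disc_moment i j t + real (4 * i * j) * disc_moment (i - 1) (j - 1) t)) (at t)"
      by (intro DERIV_cmult disc_moment_ODE)
    then show ?thesis using True by (simp add: G_def[abs_def] algebra_simps)
  qed (simp add: G_def[abs_def])
  have G0: "(G i j \<longlongrightarrow> (if k = 0 then Re c else 0)) (at_right 0)" for i j
  proof -
    have "isCont (disc_moment i j) 0" using DERIV_isCont[OF disc_moment_ODE] .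
    then have "(disc_moment i j \<longlongrightarrow> 1) (at_right 0)"
      unfolding isCont_def disc_moment_0 by (rule tendsto_within_subset) simp
    from tendsto_mult_left[OF this, of "Re c"] show ?thesis by (simp add: G_def[abs_def])
  qed
  have step: "\<phi> i j t = G i j t" if prev: "\<And>t. 0 < t \<Longrightarrow> real (4 * i * j) * \<phi> (i - 1) (j - 1) t = real (4 * i * j) * G (i - 1) (j - 1) t" and t: "0 < t" for i j t
  proof -
    have "\<phi> i j t - G i j t = 0"
    proof (rule linear_ODE_zero[OF _ _ t])
      fix s :: real assume s: "0 < s"
      show "((\<lambda>t. \<phi> i j t - G i j t) has_real_derivative - disc_eig i j k * (\<phi> i j s - G i j s)) (at s)"
        using DERIV_diff[OF \<phi>'[OF s] G', of i j i j] unfolding prev[OF s] by (simp add: algebra_simps)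
    next
      show "((\<lambda>t. \<phi> i j t - G i j t) \<longlongrightarrow> 0) (at_right 0)"
        using tendsto_diff[OF \<phi>0 G0] by simp
    qed
    then show ?thesis by simp
  qed
  have "\<phi> i j t = G i j t"
    using t
  proof (induction i arbitrary: j t)
    case 0
    then show ?case using step[of 0 j t] by simp
  next
    case (Suc i)
    then show ?case using step[of "Suc i" j t] by simp
  qed
  then show ?thesis by (simp add: \<phi>_def G_def)
qed

section \<open>Haar integrals\<close>

lemma mat_of_cylindric:
  "mat_of (cylindric r \<theta> z) =
     (cos r *\<^sub>R mat 1 + (sin r * cos \<theta>) *\<^sub>R X_su2 + (sin r * sin \<theta>) *\<^sub>R Y_su2) ** (cos z *\<^sub>R mat 1 + sin z *\<^sub>R Z_su2)"
proof -
  have "(r * cos \<theta>)\<^sup>2 + (r * sin \<theta>)\<^sup>2 + 0\<^sup>2 = r\<^sup>2 * ((sin \<theta>)\<^sup>2 + (cos \<theta>)\<^sup>2)"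
    unfolding power_mult_distrib distrib_left by simp
  then have n: "sqrt ((r * cos \<theta>)\<^sup>2 + (r * sin \<theta>)\<^sup>2 + 0\<^sup>2) = \<bar>r\<bar>" by simp
  have e: "sin \<bar>r\<bar> * (r * x) / \<bar>r\<bar> = sin r * x" "cos \<bar>r\<bar> = cos r" for x by (auto simp: abs_if)
  have "mat_of (exp_SU2 ((r * cos \<theta>) *\<^sub>R X_su2 + (r * sin \<theta>) *\<^sub>R Y_su2)) =
      cos r *\<^sub>R mat 1 + (sin r * cos \<theta>) *\<^sub>R X_su2 + (sin r * sin \<theta>) *\<^sub>R Y_su2"
    using mat_of_exp_SU2[of "r * cos \<theta>" "r * sin \<theta>" 0] mat_exp_closed_form[of "r * cos \<theta>" "r * sin \<theta>" 0]
    unfolding n by (simp add: e scaleR_add_right add.assoc)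
  then show ?thesis by (simp add: cylindric_def mat_of_times mat_of_exp_axis)
qed

lemma entries_cylindric:
  "entry_a (mat_of (cylindric r \<theta> z)) = of_real (cos r) * cis z"
  "entry_b (mat_of (cylindric r \<theta> z)) = of_real (sin r) * cis (\<theta> - z)"
  unfolding mat_of_cylindric
  by (simp_all add: entry_a_def entry_b_def matrix_matrix_mult_def sum_2 mat_def X_su2_def Y_su2_def Z_su2_def
      complex_eq_iff cos_diff sin_diff algebra_simps)

lemma continuous_on_cylindric: "continuous_on S (\<lambda>(r, \<theta>, z). cylindric r \<theta> z)"
proof -
  have "continuous_on S (\<lambda>x. mat_of (case x of (r, \<theta>, z) \<Rightarrow> cylindric r \<theta> z))"
    unfolding case_prod_beta mat_of_cylindric matrix_matrix_mult_def
    by (intro continuous_intros continuous_on_vec_lambda)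
  then show ?thesis by (simp add: continuous_on_iff dist_SU2_def)
qed

definition cyl_box :: "(real \<times> real \<times> real) set" where
  "cyl_box = cbox (0, 0, - pi) (pi / 2, 2 * pi, pi)"

lemma mem_cyl_box: "(r, \<theta>, z) \<in> cyl_box \<longleftrightarrow> r \<in> {0..pi / 2} \<and> \<theta> \<in> {0..2 * pi} \<and> z \<in> {- pi..pi}"
  by (simp add: cyl_box_def cbox_Pair_eq)

text \<open>In the defining density the box is half open in \<open>r\<close>; the density vanishes at \<open>r = \<pi> / 2\<close>, so the compact
box gives the same measure and iterated integrals of continuous functions become available.\<close>

lemma haar_integral:
  fixes f :: "SU2 \<Rightarrow> 'b::euclidean_space"
  assumes f: "continuous_on UNIV f"
  defines "F \<equiv> \<lambda>x. (sin (2 * fst x) / (4 * pi\<^sup>2)) *\<^sub>R f (case x of (r, \<theta>, z) \<Rightarrow> cylindric r \<theta> z)"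
  shows "integrable haar_SU2 f" "(\<integral>g. f g \<partial>haar_SU2) = integral cyl_box F" "continuous_on cyl_box F"
proof -
  define c where "c = (\<lambda>(r, \<theta>, z). cylindric r \<theta> z)"
  define w where "w x = indicator cyl_box x * (sin (2 * fst x) / (4 * pi\<^sup>2))" for x :: "real \<times> real \<times> real"
  have w0: "0 \<le> w x" for x
  proof (cases "x \<in> cyl_box")
    case True
    then have "0 \<le> sin (2 * fst x)"
      by (cases x) (auto simp: mem_cyl_box intro!: sin_ge_zero)
    then show ?thesis by (simp add: w_def)
  qed (simp add: w_def)
  have dens: "(\<lambda>(r, \<theta>, z). ennreal (sin (2 * r) / (4 * pi\<^sup>2)) * indicator ({0..<pi / 2} \<times> {0..2 * pi} \<times> {- pi..pi}) (r, \<theta>, z)) =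
      (\<lambda>x. ennreal (w x))"
  proof
    fix x :: "real \<times> real \<times> real"
    obtain r \<theta> z where x: "x = (r, \<theta>, z)" by (cases x)
    show "(case x of (r, \<theta>, z) \<Rightarrow> ennreal (sin (2 * r) / (4 * pi\<^sup>2)) * indicator ({0..<pi / 2} \<times> {0..2 * pi} \<times> {- pi..pi}) (r, \<theta>, z)) = ennreal (w x)"
    proof (cases "r = pi / 2")
      case True
      then have "2 * r = pi" by simp
      then have "sin (2 * r) = 0" by (simp only: sin_pi)
      then show ?thesis by (simp add: x w_def)
    qed (auto simp: x w_def mem_cyl_box indicator_def)
  qed
  have haar: "haar_SU2 = distr (density lborel (\<lambda>x. ennreal (w x))) borel c"
    unfolding haar_SU2_def dens c_def ..
  have c_meas: "c \<in> borel_measurable lborel"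
    using borel_measurable_continuous_onI[OF continuous_on_cylindric[of UNIV]] by (simp add: c_def)
  have w_meas: "w \<in> borel_measurable lborel"
    unfolding w_def[abs_def] cyl_box_def
    by (intro borel_measurable_times borel_measurable_indicator) (auto intro!: borel_measurable_continuous_onI continuous_intros)
  have f_meas: "f \<in> borel_measurable borel" using f by (rule borel_measurable_continuous_onI)
  have fc_meas: "(\<lambda>x. f (c x)) \<in> borel_measurable lborel" by (rule measurable_compose[OF c_meas f_meas])
  show F_cont: "continuous_on cyl_box F"
    unfolding F_def by (intro continuous_intros continuous_on_compose2[OF f continuous_on_cylindric]) auto
  have set_int: "set_integrable lborel cyl_box F"
    unfolding set_integrable_def by (rule borel_integrable_compact[OF _ F_cont]) (simp add: cyl_box_def)
  have eq: "w x *\<^sub>R f (c x) = indicator cyl_box x *\<^sub>R F x" for x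
    by (simp add: w_def F_def c_def)
  show "integrable haar_SU2 f"
    unfolding haar using set_int[unfolded set_integrable_def]
    by (subst integrable_distr_eq) (use c_meas f_meas w_meas fc_meas w0 in \<open>auto simp: integrable_density eq\<close>)
  have "(\<integral>g. f g \<partial>haar_SU2) = (\<integral>x. w x *\<^sub>R f (c x) \<partial>lborel)"
    unfolding haar
    by (subst integral_distr) (use c_meas f_meas w_meas fc_meas w0 in \<open>auto simp: integral_density\<close>)
  also have "\<dots> = (LINT x:cyl_box|lborel. F x)" unfolding eq set_lebesgue_integral_def ..
  also have "\<dots> = integral cyl_box F" by (rule set_borel_integral_eq_integral(2)[OF set_int])
  finally show "(\<integral>g. f g \<partial>haar_SU2) = integral cyl_box F" .
qed

lemma has_integral_cis_full_period:
  "((\<lambda>x. cis (of_int n * x)) has_integral (if n = 0 then of_real (2 * pi) else 0)) {a..a + 2 * pi}"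
proof (cases "n = 0")
  case True
  then show ?thesis using has_integral_const_real[of "1::complex" a "a + 2 * pi"] by (simp add: scaleR_conv_of_real)
next
  case False
  have "((\<lambda>x. cis (of_int n * x)) has_integral
      (cis (of_int n * (a + 2 * pi)) / (\<i> * of_int n) - cis (of_int n * a) / (\<i> * of_int n))) {a..a + 2 * pi}"
  proof (rule fundamental_theorem_of_calculus)
    fix x :: real
    have "((\<lambda>z. exp (\<i> * of_int n * z) / (\<i> * of_int n)) has_field_derivative exp (\<i> * of_int n * of_real x)) (at (of_real x))"
      using False by (auto intro!: derivative_eq_intros)
    from has_vector_derivative_real_field[OF this]
    show "((\<lambda>x. cis (of_int n * x) / (\<i> * of_int n)) has_vector_derivative cis (of_int n * x)) (at x within {a..a + 2 * pi})"
      by (simp add: cis_conv_exp mult.assoc has_vector_derivative_at_within)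
  qed simp
  moreover have "cis (of_int n * (a + 2 * pi)) = cis (of_int n * a)"
  proof -
    have "cis (of_int n * (a + 2 * pi)) = cis (of_int n * a) * cis (2 * pi * of_int n)"
      unfolding cis_mult by (rule arg_cong[where f = cis]) (simp add: algebra_simps)
    also have "cis (2 * pi * of_int n) = 1" by (rule cis_multiple_2pi) simp
    finally show ?thesis by simp
  qed
  ultimately show ?thesis using False by simp
qed

text \<open>The integrals over \<open>\<theta>\<close> and \<open>z\<close> select \<open>k = 0\<close> and \<open>i = j\<close>.\<close>

lemma haar_cmono:
  "(\<integral>g. cmono i j k (mat_of g) \<partial>haar_SU2) = (if k = 0 \<and> i = j then 1 / of_nat (i + 1) else 0)"
proof -
  have cont: "continuous_on UNIV (\<lambda>g. cmono i j k (mat_of g))"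
    unfolding cmono_def entry_a_def entry_b_def
    by (intro continuous_intros continuous_on_mat_of)
  define \<rho> where "\<rho> r = sin (2 * r) / (4 * pi\<^sup>2) * (cos r ^ (i + j) * sin r ^ k)" for r
  have F: "(sin (2 * r) / (4 * pi\<^sup>2)) *\<^sub>R cmono i j k (mat_of (cylindric r \<theta> z)) =
      of_real (\<rho> r) * (cis (of_int (int k) * \<theta>) * cis (of_int (int i - int j - int k) * z))" for r \<theta> z
  proof -
    have "cis z ^ i * cnj (cis z) ^ j * cis (\<theta> - z) ^ k = cis (of_int (int k) * \<theta>) * cis (of_int (int i - int j - int k) * z)"
      unfolding cis_cnj Complex.DeMoivre cis_mult by (rule arg_cong[where f = cis]) (simp add: algebra_simps)
    then show ?thesis
      unfolding cmono_def entries_cylindric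
      by (simp add: \<rho>_def scaleR_conv_of_real power_mult_distrib power_add mult_ac)
  qed
  have "(\<integral>g. cmono i j k (mat_of g) \<partial>haar_SU2) = integral (cbox (0, (0, - pi)) (pi / 2, (2 * pi, pi)))
       (\<lambda>x. of_real (\<rho> (fst x)) * (cis (of_int (int k) * fst (snd x)) * cis (of_int (int i - int j - int k) * snd (snd x))))"
    unfolding haar_integral(2)[OF cont] cyl_box_def
    by (intro arg_cong[where f = "integral _"] ext) (auto simp: F)
  also have "\<dots> = integral (cbox 0 (pi / 2)) (\<lambda>r. integral (cbox (0, - pi) (2 * pi, pi))
       (\<lambda>y. of_real (\<rho> r) * (cis (of_int (int k) * fst y) * cis (of_int (int i - int j - int k) * snd y))))"
    by (subst integral_prod_continuous) (auto intro!: continuous_intros simp: \<rho>_def)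
  also have "(\<lambda>r. integral (cbox (0, - pi) (2 * pi, pi))
       (\<lambda>y. of_real (\<rho> r) * (cis (of_int (int k) * fst y) * cis (of_int (int i - int j - int k) * snd y)))) =
     (\<lambda>r. of_real (\<rho> r) * (integral (cbox 0 (2 * pi)) (\<lambda>\<theta>. cis (of_int (int k) * \<theta>)) * integral (cbox (- pi) pi) (\<lambda>z. cis (of_int (int i - int j - int k) * z))))"
    by (rule ext, subst integral_prod_continuous) (auto intro!: continuous_intros)
  also have "integral (cbox 0 (2 * pi)) (\<lambda>\<theta>. cis (of_int (int k) * \<theta>)) = (if k = 0 then of_real (2 * pi) else 0)"
    using integral_unique[OF has_integral_cis_full_period[of "int k" 0]] by simp
  also have "integral (cbox (- pi) pi) (\<lambda>z. cis (of_int (int i - int j - int k) * z)) = (if int i - int j - int k = 0 then of_real (2 * pi) else 0)"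
    using integral_unique[OF has_integral_cis_full_period[of "int i - int j - int k" "- pi"]] by simp
  finally have I: "(\<integral>g. cmono i j k (mat_of g) \<partial>haar_SU2) = integral (cbox 0 (pi / 2)) (\<lambda>r. of_real (\<rho> r) *
     ((if k = 0 then of_real (2 * pi) else 0) * (if int i - int j - int k = 0 then of_real (2 * pi) else 0)))" .
  show ?thesis
  proof (cases "k = 0 \<and> i = j")
    case False
    then show ?thesis unfolding I by auto
  next
    case True
    have "((\<lambda>r. \<rho> r * (4 * pi\<^sup>2)) has_integral ((- (cos (pi / 2) ^ (2 * i + 2) / (i + 1))) - (- (cos 0 ^ (2 * i + 2) / (i + 1))))) {0..pi / 2}"
    proof (rule fundamental_theorem_of_calculus)
      fix r :: real
      have e: "\<rho> r * (4 * pi\<^sup>2) = 2 * sin r * cos r ^ (2 * i + 1)"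
        using True by (simp add: \<rho>_def sin_double mult_2[symmetric] power_add)
      have "((\<lambda>r. - (cos r ^ (2 * i + 2) / (i + 1))) has_real_derivative 2 * sin r * cos r ^ (2 * i + 1)) (at r within {0..pi / 2})"
        by (rule derivative_eq_intros refl | simp)+ (simp add: field_simps)
      then show "((\<lambda>r. - (cos r ^ (2 * i + 2) / (i + 1))) has_vector_derivative \<rho> r * (4 * pi\<^sup>2)) (at r within {0..pi / 2})"
        unfolding e has_real_derivative_iff_has_vector_derivative .
    qed simp
    then have "((\<lambda>r. complex_of_real (\<rho> r * (4 * pi\<^sup>2))) has_integral complex_of_real (1 / (i + 1))) {0..pi / 2}"
      by (intro has_integral_of_real) simp
    then have "integral (cbox 0 (pi / 2)) (\<lambda>r. complex_of_real (\<rho> r * (4 * pi\<^sup>2))) = of_real (1 / (i + 1))"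
      unfolding cbox_interval by (rule integral_unique)
    moreover have eq: "complex_of_real (\<rho> r * (4 * pi\<^sup>2)) = of_real (\<rho> r) *
        ((if k = 0 then of_real (2 * pi) else 0) * (if int i - int j - int k = 0 then of_real (2 * pi) else 0))" for r
      using True by (simp add: power2_eq_square)
    ultimately have "(\<integral>g. cmono i j k (mat_of g) \<partial>haar_SU2) = of_real (1 / (i + 1))"
      unfolding I eq[symmetric] by simp
    then show ?thesis using True by simp
  qed
qed

section \<open>The kernel series on the disc\<close>

lemma continuous_on_entries: "continuous_on S (\<lambda>g. entry_a (mat_of g))" "continuous_on S (\<lambda>g. entry_b (mat_of g))"
  unfolding entry_a_def entry_b_def by (intro continuous_intros continuous_on_mat_of)+

lemma continuous_on_cmono: "continuous_on S (\<lambda>g. cmono i j k (mat_of g))"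
  unfolding cmono_def by (intro continuous_intros continuous_on_entries)

lemma continuous_on_disc_poly:
  fixes f g :: "'a::topological_space \<Rightarrow> complex"
  assumes "continuous_on S f" "continuous_on S g"
  shows "continuous_on S (\<lambda>x. disc_poly i j (f x) (g x))"
  by (induction i j "0::real" "0::real" rule: disc_poly.induct) (auto intro!: continuous_intros assms)

lemma disc_poly_commute: "disc_poly i j z w = disc_poly j i w z"
  by (induction i j z w rule: disc_poly.induct) (simp_all add: algebra_simps)

lemma cnj_disc_poly: "cnj (disc_poly i j z w) = disc_poly i j (cnj z) (cnj w)"
  by (induction i j z w rule: disc_poly.induct) simp_all

text \<open>The integral of \<open>disc_poly i j\<close> against \<open>a\<^sup>p (cnj a)\<^sup>q\<close>. That it vanishes for \<open>p < j\<close> is the orthogonality of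
\<open>disc_poly i j\<close> to all polynomials of lower degree.\<close>

definition disc_pairing :: "nat \<Rightarrow> nat \<Rightarrow> nat \<Rightarrow> nat \<Rightarrow> real" where
  "disc_pairing i j p q = (if i + p = j + q \<and> j \<le> p then fact p * fact q / (fact (p - j) * fact (p + i + 1)) else 0)"

lemma disc_pairing_recursion:
  "disc_pairing (Suc i) (Suc j) p q = disc_pairing i (Suc j) (Suc p) q + disc_pairing (Suc i) j p (Suc q) - disc_pairing i j p q"
proof (cases "i + p = j + q \<and> j \<le> p")
  case False
  then show ?thesis by (auto simp: disc_pairing_def)
next
  case True
  show ?thesis
  proof (cases "p = j")
    case True': True
    then have "q = i" using True by simp
    define F where "F = (fact (j + i + 1) :: real)"
    have F: "fact (j + Suc i + 1) = real (j + i + 2) * F" "fact (Suc j + i + 1) = real (j + i + 2) * F" "F \<noteq> 0"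
      by (simp_all add: F_def del: fact_Suc) (simp_all add: algebra_simps)
    have P: "fact (Suc j) = real (Suc j) * fact j" "fact (Suc i) = real (Suc i) * (fact i :: real)" by simp_all
    have "(x * P) * Q / (n * F) + P * (y * Q) / (n * F) - P * Q / F = 0"
      if "n \<noteq> 0" "x + y = n" for P Q n x y :: real
    proof -
      have "(x * P) * Q / (n * F) + P * (y * Q) / (n * F) = (x + y) * (P * Q) / (n * F)"
        by (simp add: add_divide_distrib algebra_simps)
      then show ?thesis using that by simp
    qed
    from this[of "real (j + i + 2)" "real (Suc j)" "real (Suc i)" "fact j" "fact i"] show ?thesis
      unfolding disc_pairing_def True' \<open>q = i\<close> F P by (simp add: F_def del: fact_Suc of_nat_Suc of_nat_add)
  next
    case False
    then obtain d where d: "p = Suc (j + d)" using True by (metis add_Suc_right le_Suc_ex le_neq_implies_less less_iff_Suc_add)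
    then have q: "q = Suc (i + d)" using True by simp
    define f where "f = (fact d :: real)"
    define F where "F = (fact (p + i + 1) :: real)"
    have s: "p - Suc j = d" "p - j = Suc d" "Suc p - Suc j = Suc d" using d by auto
    have f: "fact (Suc d) = real (Suc d) * f" "f \<noteq> 0" by (simp_all add: f_def)
    have F: "fact (p + Suc i + 1) = real (p + i + 2) * F" "fact (Suc p + i + 1) = real (p + i + 2) * F" "F \<noteq> 0"
      by (simp_all add: F_def del: fact_Suc) (simp_all add: algebra_simps)
    have P: "fact (Suc p) = real (Suc p) * fact p" "fact (Suc q) = real (Suc q) * (fact q :: real)" by simp_all
    have pos: "real (Suc d) \<noteq> 0" "real (p + i + 2) \<noteq> 0" by simp_all
    have sum: "real (Suc p) + real (Suc q) - real (p + i + 2) = real (Suc d)" using q by simp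
    have "P * Q / (f * (n * F)) = (x * P) * Q / ((m * f) * (n * F)) + P * (y * Q) / ((m * f) * (n * F)) - P * Q / ((m * f) * F)"
      if "m \<noteq> 0" "n \<noteq> 0" "x + y - n = m" for P Q n m x y :: real
    proof -
      have "(x * P) * Q / ((m * f) * (n * F)) + P * (y * Q) / ((m * f) * (n * F)) - P * Q / ((m * f) * F) =
          (x + y - n) * (P * Q / ((m * f) * (n * F)))"
        using that(1,2) f(2) F(3) by (simp add: divide_simps) (simp add: algebra_simps)
      then show ?thesis using that by simp
    qed
    from this[OF pos sum, of "fact p" "fact q"] show ?thesis
      using True d unfolding disc_pairing_def s f P F f_def[symmetric] F_def[symmetric] by simp
  qed
qed

text \<open>The recursion of the disc polynomials moves factors \<open>a\<close> and \<open>cnj a\<close> to the monomial, and \<open>disc_pairing\<close>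
satisfies the matching recursion, so orthogonality and norms come out of one induction.\<close>

lemma haar_disc_poly_cmono:
  "(\<integral>g. disc_poly i j (entry_a (mat_of g)) (cnj (entry_a (mat_of g))) * cmono p q k (mat_of g) \<partial>haar_SU2) =
     (if k = 0 then of_real (disc_pairing i j p q) else 0)"
proof (induction i j "0::real" "0::real" arbitrary: p q rule: disc_poly.induct)
  case 1
  then show ?case by (simp add: haar_cmono disc_pairing_def)
next
  case (2 i)
  have e: "disc_poly (Suc i) 0 (entry_a A) (cnj (entry_a A)) * cmono p q k A = disc_poly i 0 (entry_a A) (cnj (entry_a A)) * cmono (Suc p) q k A" for A
    by (simp add: cmono_def mult_ac)
  have dm: "disc_pairing (Suc i) 0 p q = disc_pairing i 0 (Suc p) q" by (simp add: disc_pairing_def)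
  show ?case by (simp only: e dm 2)
next
  case (3 j)
  have e: "disc_poly 0 (Suc j) (entry_a A) (cnj (entry_a A)) * cmono p q k A = disc_poly 0 j (entry_a A) (cnj (entry_a A)) * cmono p (Suc q) k A" for A
    by (simp add: cmono_def mult_ac)
  have dm: "disc_pairing 0 (Suc j) p q = disc_pairing 0 j p (Suc q)"
  proof (cases "p = Suc j + q")
    case True
    then have "p - j = Suc q" by simp
    then show ?thesis using True by (simp add: disc_pairing_def)
  qed (auto simp: disc_pairing_def)
  show ?case by (simp only: e dm 3)
next
  case (4 i j)
  have int: "integrable haar_SU2 (\<lambda>g. disc_poly i j (entry_a (mat_of g)) (cnj (entry_a (mat_of g))) * cmono p q k (mat_of g))" for i j p q
    by (intro haar_integral(1) continuous_intros continuous_on_disc_poly continuous_on_cmono continuous_on_entries)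
  have e: "disc_poly (Suc i) (Suc j) (entry_a A) (cnj (entry_a A)) * cmono p q k A =
      disc_poly i (Suc j) (entry_a A) (cnj (entry_a A)) * cmono (Suc p) q k A + disc_poly (Suc i) j (entry_a A) (cnj (entry_a A)) * cmono p (Suc q) k A
       - disc_poly i j (entry_a A) (cnj (entry_a A)) * cmono p q k A" for A
    by (simp add: cmono_def algebra_simps)
  show ?case
    unfolding e disc_pairing_recursion
    by (simp only: Bochner_Integration.integral_diff[OF Bochner_Integration.integrable_add[OF int int] int]
        Bochner_Integration.integral_add[OF int int] 4) simp
qed

lemma summable_cubic_exp:
  assumes t: "0 < (t::real)"
  shows "summable (\<lambda>m. real (m + 1) ^ 3 * exp (- t * real m))"
proof -
  \<comment> \<open>With this \<open>c\<close> the cube of \<open>m + 1\<close> is at most \<open>c\<^sup>3\<close> times the square root of \<open>exp (t m)\<close>.\<close>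
  define c where "c = max 1 (6 / t)"
  have c: "1 \<le> c" "6 / t \<le> c" by (auto simp: c_def)
  have bound: "real (m + 1) ^ 3 * exp (- t * real m) \<le> c ^ 3 * exp (- t / 2) ^ m" for m
  proof -
    have "real m \<le> c * (t / 6 * real m)"
      using mult_right_mono[OF c(2), of "t / 6 * real m"] t by simp
    then have "real (m + 1) \<le> c * (1 + t / 6 * real m)" using c(1) by (simp add: distrib_left)
    also have "\<dots> \<le> c * exp (t / 6 * real m)"
      using c(1) exp_ge_add_one_self[of "t / 6 * real m"] by (intro mult_left_mono) auto
    finally have "real (m + 1) ^ 3 \<le> (c * exp (t / 6 * real m)) ^ 3" by (intro power_mono) auto
    also have "\<dots> = c ^ 3 * exp (t / 2 * real m)"
      unfolding power_mult_distrib exp_of_nat_mult[symmetric] by simp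
    finally have "real (m + 1) ^ 3 * exp (- t * real m) \<le> c ^ 3 * exp (t / 2 * real m) * exp (- t * real m)"
      by (intro mult_right_mono) auto
    also have "\<dots> = c ^ 3 * exp (- t / 2) ^ m"
      unfolding mult.assoc exp_add[symmetric] exp_of_nat_mult[symmetric] by (simp add: field_simps)
    finally show ?thesis .
  qed
  have "summable (\<lambda>m. c ^ 3 * exp (- t / 2) ^ m)"
    using t by (intro summable_mult summable_geometric) simp
  then show ?thesis
    by (rule summable_comparison_test'[of _ 0]) (use bound in simp)
qed

definition kernel_term :: "real \<Rightarrow> nat \<Rightarrow> complex \<Rightarrow> complex" where
  "kernel_term t m a = of_nat (m + 1) * (\<Sum>i\<le>m. of_real (exp (- disc_eig i (m - i) 0 * t)) * disc_poly i (m - i) a (cnj a))"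

text \<open>The heat kernel as a function of \<open>a\<close>. The factor \<open>m + 1\<close> in its terms is the inverse of the squared norm of
the disc polynomials of degree \<open>m\<close>.\<close>

definition disc_kernel :: "real \<Rightarrow> complex \<Rightarrow> complex" where
  "disc_kernel t a = (\<Sum>m. kernel_term t m a)"

lemma disc_eig_ge: "i \<le> m \<Longrightarrow> 2 * real m \<le> disc_eig i (m - i) 0"
  by (simp add: disc_eig_def of_nat_diff)

lemma norm_kernel_term_le:
  assumes t: "0 < t" and a: "norm a \<le> 1"
  shows "norm (kernel_term t m a) \<le> real (m + 1) ^ 3 * exp (- (2 * t) * real m)"
proof -
  have "norm (\<Sum>i\<le>m. of_real (exp (- disc_eig i (m - i) 0 * t)) * disc_poly i (m - i) a (cnj a)) \<le>
      (\<Sum>i\<le>m. exp (- (2 * t) * real m) * real (m + 1))"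
  proof (rule sum_norm_le)
    fix i assume i: "i \<in> {..m}"
    have "exp (- disc_eig i (m - i) 0 * t) \<le> exp (- (2 * t) * real m)"
      using mult_right_mono[OF disc_eig_ge, of i m t] i t by (simp add: mult_ac)
    moreover have "norm (disc_poly i (m - i) a (cnj a)) \<le> real (m + 1)"
      using norm_disc_poly_le[OF a, of i m] i by simp
    ultimately show "norm (of_real (exp (- disc_eig i (m - i) 0 * t)) * disc_poly i (m - i) a (cnj a)) \<le> exp (- (2 * t) * real m) * real (m + 1)"
      unfolding norm_mult by (intro mult_mono) auto
  qed
  also have "\<dots> = real (m + 1) * (exp (- (2 * t) * real m) * real (m + 1))" by simp
  finally have "norm (kernel_term t m a) \<le> real (m + 1) * (real (m + 1) * (exp (- (2 * t) * real m) * real (m + 1)))"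
    unfolding kernel_term_def norm_mult norm_of_nat by (rule mult_left_mono) simp
  then show ?thesis by (simp add: power3_eq_cube mult_ac)
qed

lemma summable_kernel_term:
  assumes "0 < t" "norm a \<le> 1"
  shows "summable (\<lambda>m. norm (kernel_term t m a))" "summable (\<lambda>m. kernel_term t m a)"
proof -
  show "summable (\<lambda>m. norm (kernel_term t m a))"
    by (rule summable_comparison_test'[OF summable_cubic_exp[of "2 * t"], of 0])
       (use assms norm_kernel_term_le in auto)
  then show "summable (\<lambda>m. kernel_term t m a)" by (rule summable_norm_cancel)
qed

lemma continuous_on_kernel_term: "continuous_on S (kernel_term t m)"
  unfolding kernel_term_def by (intro continuous_intros continuous_on_disc_poly)

lemma continuous_on_disc_kernel:
  assumes t: "0 < t"
  shows "continuous_on {a. norm a \<le> 1} (disc_kernel t)"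
proof -
  have "uniform_limit {a. norm a \<le> 1} (\<lambda>n a. \<Sum>m<n. kernel_term t m a) (disc_kernel t) sequentially"
    unfolding disc_kernel_def[abs_def]
    by (rule Weierstrass_m_test[OF _ summable_cubic_exp[of "2 * t"]]) (use t norm_kernel_term_le in auto)
  then show ?thesis
    by (rule uniform_limit_theorem[rotated]) (auto intro!: always_eventually continuous_intros continuous_on_kernel_term)
qed

lemma cnj_disc_kernel:
  assumes "0 < t" "norm a \<le> 1"
  shows "cnj (disc_kernel t a) = disc_kernel t a"
proof -
  have "cnj (kernel_term t m a) = kernel_term t m a" for m
  proof -
    define h where "h i = of_real (exp (- disc_eig i (m - i) 0 * t)) * disc_poly i (m - i) a (cnj a)" for i
    have "cnj (of_real (exp (- disc_eig i (m - i) 0 * t)) * disc_poly i (m - i) a (cnj a)) = h (m - i)" if "i \<in> {..m}" for i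
      using that by (simp add: h_def cnj_disc_poly disc_poly_commute[of i] disc_eig_def mult_ac add_ac)
    then have "cnj (kernel_term t m a) = of_nat (m + 1) * (\<Sum>i\<le>m. h (m - i))"
      unfolding kernel_term_def complex_cnj_mult cnj_sum by (simp del: complex_cnj_mult of_nat_Suc)
    also have "(\<Sum>i\<le>m. h (m - i)) = (\<Sum>i\<le>m. h i)"
      by (rule sum.reindex_bij_witness[where i = "\<lambda>i. m - i" and j = "\<lambda>i. m - i"]) auto
    also have "of_nat (m + 1) * (\<Sum>i\<le>m. h i) = kernel_term t m a" by (simp add: kernel_term_def h_def)
    finally show ?thesis .
  qed
  then show ?thesis unfolding disc_kernel_def
    by (simp add: bounded_linear.suminf[OF bounded_linear_cnj summable_kernel_term(2)[OF assms]])
qed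

text \<open>Only the disc polynomials with indices \<open>(q - d, p - d)\<close> pair with \<open>a\<^sup>p (cnj a)\<^sup>q\<close>.\<close>

lemma disc_moment_sums:
  "(\<lambda>m. real (m + 1) * (\<Sum>i\<le>m. exp (- disc_eig i (m - i) 0 * t) * disc_pairing i (m - i) p q)) sums disc_moment p q t"
proof -
  define h where "h = (\<lambda>(m, i). real (m + 1) * (exp (- disc_eig i (m - i) 0 * t) * disc_pairing i (m - i) p q))"
  define S where "S = Sigma {..p + q} (\<lambda>m. {..m})"
  \<comment> \<open>The pairs \<open>(m, i)\<close> at which the pairing does not vanish.\<close>
  define \<sigma> where "\<sigma> d = (p + q - 2 * d, q - d)" for d
  have zero: "disc_pairing i (m - i) p q = 0" if "i \<le> m" "(m, i) \<notin> \<sigma> ` {..min p q}" for m i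
  proof (rule ccontr)
    assume "disc_pairing i (m - i) p q \<noteq> 0"
    then have c: "i + p = (m - i) + q" "m - i \<le> p" by (auto simp: disc_pairing_def split: if_splits)
    define d where "d = p - (m - i)"
    have "(m, i) = \<sigma> d" "d \<le> min p q" using c that(1) by (auto simp: \<sigma>_def d_def)
    then show False using that(2) by auto
  qed
  have fin: "(\<Sum>i\<le>m. exp (- disc_eig i (m - i) 0 * t) * disc_pairing i (m - i) p q) = 0" if "m \<notin> {..p + q}" for m
  proof (intro sum.neutral ballI)
    fix i assume "i \<in> {..m}"
    moreover have "(m, i) \<notin> \<sigma> ` {..min p q}" using that by (auto simp: \<sigma>_def)
    ultimately show "exp (- disc_eig i (m - i) 0 * t) * disc_pairing i (m - i) p q = 0" using zero by simp
  qed
  have sums: "(\<lambda>m. real (m + 1) * (\<Sum>i\<le>m. exp (- disc_eig i (m - i) 0 * t) * disc_pairing i (m - i) p q)) sums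
      (\<Sum>m\<in>{..p + q}. real (m + 1) * (\<Sum>i\<le>m. exp (- disc_eig i (m - i) 0 * t) * disc_pairing i (m - i) p q))"
    by (rule sums_finite) (use fin in auto)
  have "(\<Sum>m\<in>{..p + q}. real (m + 1) * (\<Sum>i\<le>m. exp (- disc_eig i (m - i) 0 * t) * disc_pairing i (m - i) p q)) = sum h S"
    unfolding S_def h_def sum_distrib_left by (subst sum.Sigma) auto
  also have "\<dots> = sum h (\<sigma> ` {..min p q})"
  proof (rule sum.mono_neutral_right)
    show "\<sigma> ` {..min p q} \<subseteq> S" by (auto simp: S_def \<sigma>_def)
    show "\<forall>x\<in>S - \<sigma> ` {..min p q}. h x = 0" using zero by (auto simp: S_def h_def)
  qed (simp add: S_def)
  also have "\<dots> = (\<Sum>d\<le>min p q. h (\<sigma> d))"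
    by (subst sum.reindex) (auto simp: inj_on_def \<sigma>_def)
  also have "\<dots> = disc_moment p q t"
    unfolding disc_moment_def
  proof (rule sum.cong)
    fix d assume "d \<in> {..min p q}"
    then obtain a b where ab: "p = d + a" "q = d + b" by (metis atMost_iff le_Suc_ex min.boundedE)
    have \<sigma>: "\<sigma> d = (a + b, b)" by (simp add: \<sigma>_def ab)
    have q: "disc_eig b a 0 = disc_eig a b 0" by (simp add: disc_eig_def)
    have n: "d + a - d = a" "d + b - d = b" "a + b - b = a" "d + a + (d + b) + 1 - d = d + a + b + 1" "d + a - a = d" by auto
    show "h (\<sigma> d) = (real (p + q + 1) - 2 * real d) / (fact d * fact (p + q + 1 - d)) * (fact p * fact q) * exp (- disc_eig (p - d) (q - d) 0 * t)"
      unfolding \<sigma> h_def prod.case unfolding ab n q by (simp add: disc_pairing_def n mult_ac)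
  qed simp
  finally show ?thesis using sums by simp
qed

theorem haar_disc_kernel_cmono:
  assumes t: "0 < t"
  shows "(\<integral>g. disc_kernel t (entry_a (mat_of g)) * cmono p q k (mat_of g) \<partial>haar_SU2) =
    (if k = 0 then of_real (disc_moment p q t) else 0)"
proof -
  define f where "f m g = kernel_term t m (entry_a (mat_of g)) * cmono p q k (mat_of g)" for m and g :: SU2
  define M where "M m = real (m + 1) ^ 3 * exp (- (2 * t) * real m)" for m :: nat
  have f_cont: "continuous_on UNIV (f m)" for m
    unfolding f_def by (intro continuous_intros continuous_on_cmono continuous_on_compose2[OF continuous_on_kernel_term continuous_on_entries(1)]) auto
  have norm_cm: "norm (cmono p q k (mat_of g)) \<le> 1" for g
    unfolding cmono_def norm_mult norm_power complex_mod_cnj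
    using norm_entry_le_1(1)[of g] norm_entry_le_1(2)[of g] by (intro mult_le_one power_le_one) (auto intro!: mult_nonneg_nonneg)
  have norm_f: "norm (f m g) \<le> M m" for m g
    unfolding f_def norm_mult M_def
    using mult_mono[OF norm_kernel_term_le[OF t norm_entry_le_1(1)] norm_cm, of m g g] by simp
  have sM: "summable M" unfolding M_def using summable_cubic_exp[of "2 * t"] t by simp
  have int: "integrable haar_SU2 (f m)" for m by (rule haar_integral(1)[OF f_cont])
  have const: "integrable haar_SU2 (\<lambda>_. c :: real)" for c by (rule haar_integral(1)) simp
  have "(\<integral>g. (\<Sum>m. f m g) \<partial>haar_SU2) = (\<Sum>m. \<integral>g. f m g \<partial>haar_SU2)"
  proof (rule integral_suminf[OF int])
    show "AE g in haar_SU2. summable (\<lambda>m. norm (f m g))"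
      by (rule AE_I2, rule summable_comparison_test'[OF sM, of 0]) (use norm_f in simp)
    have "(\<integral>g. norm (f m g) \<partial>haar_SU2) \<le> M m * (\<integral>g. 1 \<partial>haar_SU2)" for m
    proof -
      have "(\<integral>g. norm (f m g) \<partial>haar_SU2) \<le> (\<integral>g. M m \<partial>haar_SU2)"
        by (rule integral_mono) (use int norm_f const in auto)
      also have "\<dots> = M m * (\<integral>g. 1 \<partial>haar_SU2)"
        by (simp flip: Bochner_Integration.integral_mult_right_zero)
      finally show ?thesis .
    qed
    then show "summable (\<lambda>m. \<integral>g. norm (f m g) \<partial>haar_SU2)"
      by (intro summable_comparison_test'[OF summable_mult2[OF sM], of 0]) auto
  qed
  also have "(\<lambda>g. \<Sum>m. f m g) = (\<lambda>g. disc_kernel t (entry_a (mat_of g)) * cmono p q k (mat_of g))"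
    unfolding f_def disc_kernel_def
    by (rule ext, rule suminf_mult2[symmetric], rule summable_kernel_term(2)[OF t norm_entry_le_1(1)])
  also have "(\<lambda>m. \<integral>g. f m g \<partial>haar_SU2) =
      (\<lambda>m. if k = 0 then of_real (real (m + 1) * (\<Sum>i\<le>m. exp (- disc_eig i (m - i) 0 * t) * disc_pairing i (m - i) p q)) else 0)"
  proof
    fix m
    have i: "integrable haar_SU2 (\<lambda>g. of_nat (m + 1) * of_real (exp (- disc_eig i (m - i) 0 * t)) * (disc_poly i (m - i) (entry_a (mat_of g)) (cnj (entry_a (mat_of g))) * cmono p q k (mat_of g)))" for i
      by (intro haar_integral(1) continuous_intros continuous_on_disc_poly continuous_on_cmono continuous_on_entries)
    have "f m = (\<lambda>g. \<Sum>i\<le>m. of_nat (m + 1) * of_real (exp (- disc_eig i (m - i) 0 * t)) * (disc_poly i (m - i) (entry_a (mat_of g)) (cnj (entry_a (mat_of g))) * cmono p q k (mat_of g)))"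
      unfolding f_def kernel_term_def by (simp add: sum_distrib_left sum_distrib_right mult.assoc del: of_nat_Suc)
    then have "(\<integral>g. f m g \<partial>haar_SU2) = (\<Sum>i\<le>m. of_nat (m + 1) * of_real (exp (- disc_eig i (m - i) 0 * t)) * (if k = 0 then of_real (disc_pairing i (m - i) p q) else 0))"
      by (simp only: Bochner_Integration.integral_sum[OF i] integral_mult_right_zero haar_disc_poly_cmono)
    then show "(\<integral>g. f m g \<partial>haar_SU2) = (if k = 0 then of_real (real (m + 1) * (\<Sum>i\<le>m. exp (- disc_eig i (m - i) 0 * t) * disc_pairing i (m - i) p q)) else 0)"
      by (simp add: sum_distrib_left mult.assoc del: of_nat_Suc exp_of_real)
  qed
  also have "(\<Sum>m. if k = 0 then of_real (real (m + 1) * (\<Sum>i\<le>m. exp (- disc_eig i (m - i) 0 * t) * disc_pairing i (m - i) p q)) else 0) =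
      (if k = 0 then complex_of_real (disc_moment p q t) else 0)"
    using sums_of_real[OF disc_moment_sums[of t p q], where 'a = complex] by (auto dest: sums_unique)
  finally show ?thesis .
qed

section \<open>Identification of the heat kernel\<close>

text \<open>The inverse of a matrix of determinant 1 is both its adjugate and its adjoint.\<close>

lemma second_row_mat_of:
  "mat_of g $ 2 $ 1 = - cnj (entry_b (mat_of g))" "mat_of g $ 2 $ 2 = cnj (entry_a (mat_of g))"
proof -
  define a b c d where "a = mat_of g $ 1 $ 1" and "b = mat_of g $ 1 $ 2" and "c = mat_of g $ 2 $ 1" and "d = mat_of g $ 2 $ 2"
  have unit: "a * cnj a + b * cnj b = 1" using entries_unit[of g] by (simp add: a_def b_def entry_a_def entry_b_def)
  have "(mat_of g ** cadjoint (mat_of g)) $ 1 $ 2 = (mat 1 :: mat2) $ 1 $ 2" using mat_of[of g] by simp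
  then have "a * cnj c + b * cnj d = 0"
    by (simp add: matrix_matrix_mult_def cadjoint_def sum_2 mat_def a_def b_def c_def d_def)
  then have orth: "cnj a * c + cnj b * d = 0"
    by (metis complex_cnj_add complex_cnj_cnj complex_cnj_mult complex_cnj_zero)
  have det: "a * d - b * c = 1" using mat_of[of g] by (simp add: det_2 a_def b_def c_def d_def)
  have "d = d * (a * cnj a + b * cnj b)" using unit by simp
  also have "\<dots> = cnj a * (a * d - b * c) + b * (cnj a * c + cnj b * d)" by (simp add: algebra_simps)
  finally show "mat_of g $ 2 $ 2 = cnj (entry_a (mat_of g))" using det orth by (simp add: d_def a_def entry_a_def)
  have "c = c * (a * cnj a + b * cnj b)" using unit by simp
  also have "\<dots> = a * (cnj a * c + cnj b * d) - cnj b * (a * d - b * c)" by (simp add: algebra_simps)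
  finally show "mat_of g $ 2 $ 1 = - cnj (entry_b (mat_of g))" using det orth by (simp add: c_def b_def entry_b_def)
qed

definition full_monomial :: "nat \<Rightarrow> nat \<Rightarrow> nat \<Rightarrow> nat \<Rightarrow> mat2 \<Rightarrow> complex" where
  "full_monomial i j k l A = entry_a A ^ i * cnj (entry_a A) ^ j * entry_b A ^ k * cnj (entry_b A) ^ l"

definition annihilates_monomials :: "(SU2 \<Rightarrow> complex) \<Rightarrow> bool" where
  "annihilates_monomials H \<longleftrightarrow> continuous_on UNIV H \<and>
     (\<forall>i j k l. (\<integral>g. H g * full_monomial i j k l (mat_of g) \<partial>haar_SU2) = 0)"

text \<open>Cancel pairs \<open>b (cnj b)\<close> until no \<open>b\<close> or no \<open>cnj b\<close> is left; in the second case conjugate, using that \<open>H\<close> is real.\<close>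

lemma annihilates_monomialsI:
  fixes H :: "SU2 \<Rightarrow> real"
  assumes cont: "continuous_on UNIV H"
    and zero: "\<And>i j k. (\<integral>g. of_real (H g) * cmono i j k (mat_of g) \<partial>haar_SU2) = 0"
  shows "annihilates_monomials (\<lambda>g. of_real (H g))"
proof -
  have int: "integrable haar_SU2 (\<lambda>g. of_real (H g) * full_monomial i j k l (mat_of g))" for i j k l
    unfolding full_monomial_def by (intro haar_integral(1) continuous_intros cont continuous_on_entries)
  have b: "full_monomial i j k 0 A = cmono i j k A" for i j k A by (simp add: full_monomial_def cmono_def)
  have b': "of_real (H g) * full_monomial i j 0 l A = cnj (of_real (H g) * cmono j i l A)" for i j l A g
    by (simp add: full_monomial_def cmono_def mult_ac)
  have "(\<integral>g. of_real (H g) * full_monomial i j k l (mat_of g) \<partial>haar_SU2) = 0" for i j k l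
  proof (induction k arbitrary: i j l)
    case 0
    show ?case unfolding b' using zero[of j i l] by (simp only: Bochner_Integration.integral_cnj complex_cnj_zero)
  next
    case (Suc k)
    show ?case
    proof (cases l)
      case 0
      then show ?thesis by (simp only: b zero)
    next
      case l: (Suc l')
      have e: "of_real (H g) * full_monomial i j (Suc k) (Suc l') (mat_of g) =
          of_real (H g) * full_monomial i j k l' (mat_of g) - of_real (H g) * full_monomial (Suc i) (Suc j) k l' (mat_of g)" for g
      proof -
        have "entry_b (mat_of g) * cnj (entry_b (mat_of g)) = 1 - entry_a (mat_of g) * cnj (entry_a (mat_of g))"
          using entries_unit[of g] by (simp add: algebra_simps)
        then have "full_monomial i j (Suc k) (Suc l') (mat_of g) = full_monomial i j k l' (mat_of g) * (1 - entry_a (mat_of g) * cnj (entry_a (mat_of g)))"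
          unfolding full_monomial_def by (simp add: mult_ac)
        moreover have "full_monomial (Suc i) (Suc j) k l' (mat_of g) = full_monomial i j k l' (mat_of g) * (entry_a (mat_of g) * cnj (entry_a (mat_of g)))"
          unfolding full_monomial_def by (simp add: mult_ac)
        ultimately show ?thesis by (simp only: right_diff_distrib mult_1_right)
      qed
      show ?thesis unfolding l e by (simp only: Bochner_Integration.integral_diff[OF int int] Suc diff_0_right)
    qed
  qed
  then show ?thesis using cont unfolding annihilates_monomials_def by (auto intro!: continuous_intros)
qed

text \<open>Being orthogonal to all monomials is not inherited by a product from its factors, but acting on the
annihilator is: functions with this property form an algebra, which makes the induction over
polynomials work.\<close>

definition preserves_annihilation :: "(SU2 \<Rightarrow> complex) \<Rightarrow> bool" where
  "preserves_annihilation F \<longleftrightarrow> continuous_on UNIV F \<and>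
     (\<forall>H. annihilates_monomials H \<longrightarrow> annihilates_monomials (\<lambda>g. H g * F g))"

lemma preserves_annihilation_const: "preserves_annihilation (\<lambda>_. c)"
  unfolding preserves_annihilation_def annihilates_monomials_def
proof (safe intro!: continuous_intros)
  fix H i j k l
  assume "\<forall>i j k l. (\<integral>g. H g * full_monomial i j k l (mat_of g) \<partial>haar_SU2) = 0"
  then show "(\<integral>g. H g * c * full_monomial i j k l (mat_of g) \<partial>haar_SU2) = 0"
    by (simp add: mult.commute[of _ c] mult.assoc)
qed

lemma preserves_annihilation_mult:
  assumes F: "preserves_annihilation F" and G: "preserves_annihilation G"
  shows "preserves_annihilation (\<lambda>g. F g * G g)"
  unfolding preserves_annihilation_def
proof (intro conjI allI impI)
  show "continuous_on UNIV (\<lambda>g. F g * G g)"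
    using F G by (auto simp: preserves_annihilation_def intro!: continuous_intros)
  fix H assume "annihilates_monomials H"
  then have "annihilates_monomials (\<lambda>g. H g * F g * G g)" using F G by (simp add: preserves_annihilation_def)
  then show "annihilates_monomials (\<lambda>g. H g * (F g * G g))" by (simp add: mult.assoc)
qed

lemma preserves_annihilation_add:
  assumes F: "preserves_annihilation F" and G: "preserves_annihilation G"
  shows "preserves_annihilation (\<lambda>g. F g + G g)"
  unfolding preserves_annihilation_def
proof (intro conjI allI impI)
  show "continuous_on UNIV (\<lambda>g. F g + G g)"
    using F G by (auto simp: preserves_annihilation_def intro!: continuous_intros)
  fix H assume H: "annihilates_monomials H"
  have 1: "annihilates_monomials (\<lambda>g. H g * F g)" and 2: "annihilates_monomials (\<lambda>g. H g * G g)"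
    using F G H by (simp_all add: preserves_annihilation_def)
  have int: "integrable haar_SU2 (\<lambda>g. K g * full_monomial i j k l (mat_of g))" if "annihilates_monomials K" for K i j k l
    using that unfolding full_monomial_def annihilates_monomials_def
    by (intro haar_integral(1) continuous_intros continuous_on_entries) auto
  have "(\<integral>g. H g * (F g + G g) * full_monomial i j k l (mat_of g) \<partial>haar_SU2) = 0" for i j k l
    unfolding distrib_left distrib_right
    using 1 2 by (subst Bochner_Integration.integral_add) (auto intro: int[OF 1] int[OF 2] simp: annihilates_monomials_def)
  then show "annihilates_monomials (\<lambda>g. H g * (F g + G g))"
    using 1 2 unfolding annihilates_monomials_def by (auto simp: distrib_left intro!: continuous_intros)
qed

lemma preserves_annihilation_entries:
  "preserves_annihilation (\<lambda>g. entry_a (mat_of g))" "preserves_annihilation (\<lambda>g. cnj (entry_a (mat_of g)))"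
  "preserves_annihilation (\<lambda>g. entry_b (mat_of g))" "preserves_annihilation (\<lambda>g. cnj (entry_b (mat_of g)))"
proof -
  have m: "entry_a A * full_monomial i j k l A = full_monomial (Suc i) j k l A" "cnj (entry_a A) * full_monomial i j k l A = full_monomial i (Suc j) k l A"
    "entry_b A * full_monomial i j k l A = full_monomial i j (Suc k) l A" "cnj (entry_b A) * full_monomial i j k l A = full_monomial i j k (Suc l) A" for A i j k l
    by (simp_all add: full_monomial_def mult_ac)
  show "preserves_annihilation (\<lambda>g. entry_a (mat_of g))" "preserves_annihilation (\<lambda>g. cnj (entry_a (mat_of g)))"
    "preserves_annihilation (\<lambda>g. entry_b (mat_of g))" "preserves_annihilation (\<lambda>g. cnj (entry_b (mat_of g)))"
    unfolding preserves_annihilation_def annihilates_monomials_def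
    by (auto simp: mult.assoc m intro!: continuous_intros continuous_on_entries)
qed

lemma preserves_annihilation_Re_Im:
  assumes "preserves_annihilation F" "preserves_annihilation (\<lambda>g. cnj (F g))"
  shows "preserves_annihilation (\<lambda>g. of_real (Re (F g)))" "preserves_annihilation (\<lambda>g. of_real (Im (F g)))"
proof -
  have r: "(\<lambda>g. of_real (Re (F g))) = (\<lambda>g. (1 / 2) * (F g + cnj (F g)))"
    by (rule ext) (simp add: complex_add_cnj)
  have i: "(\<lambda>g. of_real (Im (F g))) = (\<lambda>g. (- \<i> / 2) * (F g + (- 1) * cnj (F g)))"
    by (rule ext) (simp add: complex_eq_iff)
  show "preserves_annihilation (\<lambda>g. of_real (Re (F g)))" "preserves_annihilation (\<lambda>g. of_real (Im (F g)))"
    unfolding r i by (intro preserves_annihilation_mult preserves_annihilation_add preserves_annihilation_const assms)+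
qed

lemma preserves_annihilation_polynomial:
  assumes "real_polynomial_function F"
  shows "preserves_annihilation (\<lambda>g. of_real (F (mat_of g)))"
  using assms
proof induction
  case (linear F)
  have entries: "preserves_annihilation (\<lambda>g. mat_of g $ i $ j) \<and> preserves_annihilation (\<lambda>g. cnj (mat_of g $ i $ j))" for i j :: 2
  proof -
    have 21: "(\<lambda>g. mat_of g $ 2 $ 1) = (\<lambda>g. (- 1) * cnj (entry_b (mat_of g)))" "(\<lambda>g. cnj (mat_of g $ 2 $ 1)) = (\<lambda>g. (- 1) * entry_b (mat_of g))"
      by (simp_all add: second_row_mat_of)
    have 22: "(\<lambda>g. mat_of g $ 2 $ 2) = (\<lambda>g. cnj (entry_a (mat_of g)))" "(\<lambda>g. cnj (mat_of g $ 2 $ 2)) = (\<lambda>g. entry_a (mat_of g))"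
      by (simp_all add: second_row_mat_of)
    show ?thesis
      using exhaust_2[of i] exhaust_2[of j] preserves_annihilation_entries[unfolded entry_a_def entry_b_def]
        preserves_annihilation_entries[folded 22] preserves_annihilation_mult[OF preserves_annihilation_const[of "- 1"] preserves_annihilation_entries(3)]
        preserves_annihilation_mult[OF preserves_annihilation_const[of "- 1"] preserves_annihilation_entries(4)]
      by (auto simp: 21 22 simp del: mult_minus1)
  qed
  have basis: "preserves_annihilation (\<lambda>g. of_real (mat_of g \<bullet> e))" if e_Basis: "e \<in> Basis" for e :: mat2
  proof -
    obtain i j u where e: "e = axis i (axis j u)" and u: "u = 1 \<or> u = \<i>"
      using e_Basis by (auto simp: Basis_vec_def Basis_complex_def)
    have "mat_of g \<bullet> e = (if u = 1 then Re (mat_of g $ i $ j) else Im (mat_of g $ i $ j))" for g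
      using u by (auto simp: e inner_axis)
    then show ?thesis
      using preserves_annihilation_Re_Im[of "\<lambda>g. mat_of g $ i $ j"] entries[of i j] by (cases "u = 1") auto
  qed
  have sum: "preserves_annihilation (\<lambda>g. \<Sum>e\<in>S. of_real (mat_of g \<bullet> e) * of_real (F e))" if "finite S" "S \<subseteq> Basis" for S
    using that
  proof induction
    case empty
    then show ?case using preserves_annihilation_const[of 0] by simp
  next
    case (insert e S)
    then show ?case
      by (auto intro!: preserves_annihilation_add preserves_annihilation_mult preserves_annihilation_const basis)
  qed
  have expand: "F A = (\<Sum>e\<in>Basis. (A \<bullet> e) * F e)" for A
  proof -
    interpret bounded_linear F by fact
    have "F (\<Sum>e\<in>Basis. (A \<bullet> e) *\<^sub>R e) = (\<Sum>e\<in>Basis. (A \<bullet> e) * F e)"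
      by (simp add: sum scaleR)
    then show ?thesis by (simp add: euclidean_representation)
  qed
  have "of_real (F (mat_of g)) = (\<Sum>e\<in>Basis. complex_of_real (mat_of g \<bullet> e) * of_real (F e))" for g
    by (subst expand) (simp only: of_real_sum of_real_mult)
  then show ?case using sum[of Basis] by (simp only: finite_Basis subset_refl simp_thms)
next
  case (const c)
  then show ?case by (simp add: preserves_annihilation_const)
next
  case (add f g)
  then show ?case by (simp add: preserves_annihilation_add)
next
  case (mult f g)
  then show ?case by (simp add: preserves_annihilation_mult)
qed

text \<open>By Stone and Weierstrass \<open>H\<close> is a uniform limit of polynomials, so the integral of \<open>H\<^sup>2\<close> is 0. The
density of Haar measure is positive inside the coordinate box, so \<open>H\<close> vanishes there.\<close>

theorem annihilates_monomials_imp_zero: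
  fixes H :: "SU2 \<Rightarrow> real"
  assumes ann: "annihilates_monomials (\<lambda>g. of_real (H g))" and cont: "continuous_on UNIV H"
    and r: "r \<in> {0<..<pi / 2}" and \<theta>: "\<theta> \<in> {0..2 * pi}" and z: "z \<in> {- pi..pi}"
  shows "H (cylindric r \<theta> z) = 0"
proof -
  define B where "B = (\<integral>g. \<bar>H g\<bar> \<partial>haar_SU2)"
  have B: "0 \<le> B" by (simp add: B_def)
  have poly: "(\<integral>g. H g * F (mat_of g) \<partial>haar_SU2) = 0" if "real_polynomial_function F" for F
  proof -
    have "annihilates_monomials (\<lambda>g. of_real (H g) * of_real (F (mat_of g)))"
      using preserves_annihilation_polynomial[OF that] ann by (simp add: preserves_annihilation_def)
    then have "(\<integral>g. complex_of_real (H g) * of_real (F (mat_of g)) * full_monomial 0 0 0 0 (mat_of g) \<partial>haar_SU2) = 0"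
      unfolding annihilates_monomials_def by blast
    then have "(\<integral>g. complex_of_real (H g * F (mat_of g)) \<partial>haar_SU2) = 0" by (simp add: full_monomial_def)
    then show ?thesis unfolding integral_complex_of_real by simp
  qed
  have sq: "(\<integral>g. H g * H g \<partial>haar_SU2) = 0"
  proof (rule ccontr)
    assume nz: "(\<integral>g. H g * H g \<partial>haar_SU2) \<noteq> 0"
    define I where "I = (\<integral>g. H g * H g \<partial>haar_SU2)"
    have "0 \<le> I" unfolding I_def by (rule Bochner_Integration.integral_nonneg) simp
    then have I: "0 < I" using nz[folded I_def] by simp
    \<comment> \<open>Chosen so that \<open>e B < I\<close> even if \<open>B = 0\<close>.\<close>
    define e where "e = I / (B + 1)"
    have e: "0 < e" using I B by (simp add: e_def)
    have "continuous_on (range mat_of) (\<lambda>A. H (Abs_SU2 A))"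
    proof -
      have "continuous_on (range mat_of) Abs_SU2"
        by (auto simp: continuous_on_iff dist_SU2_def mat_of_inverse)
      then show ?thesis by (rule continuous_on_compose2[OF cont]) auto
    qed
    from Stone_Weierstrass_real_polynomial_function[OF compact_range_mat_of this e]
    obtain F where F: "real_polynomial_function F" "\<And>A. A \<in> range mat_of \<Longrightarrow> \<bar>H (Abs_SU2 A) - F A\<bar> < e" by blast
    have close: "\<bar>H g - F (mat_of g)\<bar> \<le> e" for g
      using F(2)[of "mat_of g"] by (simp add: mat_of_inverse)
    have cF: "continuous_on UNIV (\<lambda>g. F (mat_of g))" by (rule continuous_on_real_polynomial_SU2[OF F(1)])
    have "I = (\<integral>g. H g * H g - H g * F (mat_of g) \<partial>haar_SU2)"
      unfolding I_def
      by (subst Bochner_Integration.integral_diff) (auto simp: poly[OF F(1)] intro!: haar_integral(1) continuous_intros cont cF)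
    also have "\<dots> \<le> (\<integral>g. e * \<bar>H g\<bar> \<partial>haar_SU2)"
    proof (rule integral_mono)
      show "H g * H g - H g * F (mat_of g) \<le> e * \<bar>H g\<bar>" for g
      proof -
        have "H g * H g - H g * F (mat_of g) = H g * (H g - F (mat_of g))" by (simp add: algebra_simps)
        also have "\<dots> \<le> \<bar>H g\<bar> * \<bar>H g - F (mat_of g)\<bar>" by (metis abs_ge_self abs_mult)
        also have "\<dots> \<le> \<bar>H g\<bar> * e" by (intro mult_left_mono close) simp
        finally show ?thesis by (simp add: mult.commute)
      qed
    qed (intro haar_integral(1) continuous_intros cont cF)+
    also have "\<dots> = e * B" by (simp add: B_def)
    also have "\<dots> < I" using I B by (simp add: e_def field_simps)
    finally show False by simp
  qed
  define F where "F x = (sin (2 * fst x) / (4 * pi\<^sup>2)) *\<^sub>R (H (case x of (r, \<theta>, z) \<Rightarrow> cylindric r \<theta> z) * H (case x of (r, \<theta>, z) \<Rightarrow> cylindric r \<theta> z))" for x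
  have cHH: "continuous_on UNIV (\<lambda>g. H g * H g)" by (intro continuous_intros cont)
  have F_cont: "continuous_on cyl_box F" unfolding F_def[abs_def] by (rule haar_integral(3)[OF cHH])
  have F_int: "integral cyl_box F = 0" using haar_integral(2)[OF cHH] sq unfolding F_def[abs_def] by simp
  have "F (r, \<theta>, z) = 0"
  proof (rule has_integral_0_cbox_imp_0[of "(0, 0, - pi)" "(pi / 2, 2 * pi, pi)" F "(r, \<theta>, z)"])
    show "continuous_on (cbox (0, 0, - pi) (pi / 2, 2 * pi, pi)) F" using F_cont by (simp add: cyl_box_def)
    show "(F has_integral 0) (cbox (0, 0, - pi) (pi / 2, 2 * pi, pi))"
      using integrable_integral[OF integrable_continuous[OF F_cont[unfolded cyl_box_def]]] F_int
      by (simp add: cyl_box_def)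
    show "0 \<le> F x" if "x \<in> box (0, 0, - pi) (pi / 2, 2 * pi, pi)" for x
    proof -
      have "x \<in> cyl_box" using that box_subset_cbox unfolding cyl_box_def by blast
      then have "0 \<le> sin (2 * fst x)" by (cases x) (auto simp: mem_cyl_box intro!: sin_ge_zero)
      then show ?thesis by (simp add: F_def)
    qed
    show "(r, \<theta>, z) \<in> cbox (0, 0, - pi) (pi / 2, 2 * pi, pi)"
      using r \<theta> z by (simp add: cyl_box_def[symmetric] mem_cyl_box)
    show "box (0, 0, - pi) (pi / 2, 2 * pi, pi) \<noteq> {}"
      by (auto simp: box_ne_empty Basis_prod_def)
  qed
  moreover have "0 < sin (2 * r)" using r by (intro sin_gt_zero) auto
  ultimately show ?thesis by (simp add: F_def)
qed

text \<open>The difference of the two kernels is continuous and orthogonal to all monomials.\<close>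

theorem heat_kernel_eq_disc_kernel:
  assumes P: "heat_semigroup P" and p: "heat_kernel P p" and t: "0 < t"
    and r: "r \<in> {0<..<pi / 2}" and \<theta>: "\<theta> \<in> {0..2 * pi}" and z: "z \<in> {- pi..pi}"
  shows "of_real (p t (cylindric r \<theta> z)) = disc_kernel t (of_real (cos r) * cis z)"
proof -
  have p_cont: "continuous_on UNIV (p t)"
  proof -
    obtain F where F: "C_k 0 F" "\<And>g. p t g = F (mat_of g)"
      using p t unfolding heat_kernel_def smooth_SU2_def by blast
    have "continuous_on UNIV (\<lambda>g. F (mat_of g))"
      using F(1) by (intro continuous_on_compose2[OF _ continuous_on_mat_of[of UNIV], of UNIV]) auto
    then show ?thesis using F(2) by (simp cong: continuous_on_cong)
  qed
  define K where "K g = Re (disc_kernel t (entry_a (mat_of g)))" for g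
  have K: "of_real (K g) = disc_kernel t (entry_a (mat_of g))" for g
    using cnj_disc_kernel[OF t norm_entry_le_1(1)[of g]] by (auto simp: K_def complex_eq_iff)
  have K_cont: "continuous_on UNIV K"
    unfolding K_def
    by (intro continuous_intros continuous_on_compose2[OF continuous_on_disc_kernel[OF t] continuous_on_entries(1)])
       (auto simp: norm_entry_le_1(1))
  have moment: "(\<integral>g. of_real (p t g) * cmono i j k (mat_of g) \<partial>haar_SU2) = (if k = 0 then of_real (disc_moment i j t) else 0)" for i j k
  proof -
    have int: "integrable haar_SU2 (\<lambda>g. of_real (p t g) * cmono i j k (mat_of g))"
      by (intro haar_integral(1) continuous_intros p_cont continuous_on_cmono)
    have "Re (c * (\<integral>g. of_real (p t g) * cmono i j k (mat_of g) \<partial>haar_SU2)) = (if k = 0 then Re c * disc_moment i j t else 0)" for c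
    proof -
      have "Re (c * (\<integral>g. of_real (p t g) * cmono i j k (mat_of g) \<partial>haar_SU2)) = Re (\<integral>g. c * (of_real (p t g) * cmono i j k (mat_of g)) \<partial>haar_SU2)"
        by simp
      also have "\<dots> = (\<integral>g. Re (c * (of_real (p t g) * cmono i j k (mat_of g))) \<partial>haar_SU2)"
        by (rule integral_Re[symmetric]) (intro integrable_mult_right int)
      also have "\<dots> = (\<integral>g. p t g * apply_bcontfun (cmono_bcf c i j k) g \<partial>haar_SU2)"
        unfolding apply_cmono_bcf by (intro arg_cong[where f = "integral\<^sup>L haar_SU2"] ext) (simp add: algebra_simps)
      also have "\<dots> = apply_bcontfun (P t (cmono_bcf c i j k)) 1"
        using p t by (simp add: heat_kernel_def)
      finally show ?thesis using heat_semigroup_cmono[OF P t] by simp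
    qed
    \<comment> \<open>Real and imaginary part of the integral.\<close>
    from this[of 1] this[of "- \<i>"] show ?thesis by (auto simp: complex_eq_iff)
  qed
  have cont: "continuous_on UNIV (\<lambda>g. p t g - K g)" by (intro continuous_intros p_cont K_cont)
  have "annihilates_monomials (\<lambda>g. of_real (p t g - K g))"
  proof (rule annihilates_monomialsI[OF cont])
    fix i j k
    have "(\<integral>g. of_real (p t g - K g) * cmono i j k (mat_of g) \<partial>haar_SU2) =
      (\<integral>g. of_real (p t g) * cmono i j k (mat_of g) - of_real (K g) * cmono i j k (mat_of g) \<partial>haar_SU2)"
      by (simp add: algebra_simps)
    also have "\<dots> = (\<integral>g. of_real (p t g) * cmono i j k (mat_of g) \<partial>haar_SU2) - (\<integral>g. of_real (K g) * cmono i j k (mat_of g) \<partial>haar_SU2)"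
      by (intro Bochner_Integration.integral_diff haar_integral(1) continuous_intros p_cont K_cont continuous_on_cmono)
    also have "\<dots> = 0" unfolding moment K haar_disc_kernel_cmono[OF t] by simp
    finally show "(\<integral>g. of_real (p t g - K g) * cmono i j k (mat_of g) \<partial>haar_SU2) = 0" .
  qed
  from annihilates_monomials_imp_zero[OF this cont r \<theta> z]
  have "p t (cylindric r \<theta> z) = K (cylindric r \<theta> z)" by simp
  then show ?thesis by (simp add: K entries_cylindric)
qed

section \<open>Reduction to the heat kernel of the three-sphere\<close>

text \<open>The heat kernel at time \<open>t\<close> of the three-sphere with its full Laplacian, as a function of the
cosine \<open>x\<close> of the distance. The series also makes sense for \<open>x > 1\<close>.\<close>

definition radial_kernel :: "real \<Rightarrow> real \<Rightarrow> real" where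
  "radial_kernel t x = (\<Sum>m. real (m + 1) * exp (- (real m * (real m + 2) * t)) * cheb_U m x)"

lemma real_Gaussian_moment:
  assumes t: "0 < t"
  shows "has_bochner_integral lborel (\<lambda>y. exp (- y\<^sup>2 / (4 * t) + n * y)) (sqrt (4 * pi * t) * exp (n\<^sup>2 * t))"
proof -
  have "has_bochner_integral lborel (\<lambda>y. exp (of_real (- (1 / (4 * t)) * y\<^sup>2) + of_real n * of_real y))
     (of_real (sqrt (pi / (1 / (4 * t)))) * exp ((of_real n)\<^sup>2 / complex_of_real (4 * (1 / (4 * t)))))"
    using Gaussian_moment_0[of "1 / (4 * t)" "of_real n"] t by simp
  also have "(\<lambda>y. exp (of_real (- (1 / (4 * t)) * y\<^sup>2) + of_real n * of_real y)) = (\<lambda>y. complex_of_real (exp (- y\<^sup>2 / (4 * t) + n * y)))"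
    unfolding exp_of_real[symmetric] by (simp add: mult.commute)
  also have "of_real (sqrt (pi / (1 / (4 * t)))) * exp ((of_real n)\<^sup>2 / complex_of_real (4 * (1 / (4 * t)))) = complex_of_real (sqrt (4 * pi * t) * exp (n\<^sup>2 * t))"
    using t unfolding of_real_mult exp_of_real[symmetric] by (simp add: mult_ac)
  finally show ?thesis using has_bochner_integral_bounded_linear[OF bounded_linear_Re] by (fastforce simp del: of_real_mult of_real_exp)
qed

lemma cheb_U_cosh_expansion:
  "cheb_U m (k * cosh y) = (\<Sum>i\<le>m. exp ((2 * real i - real m) * y) * disc_poly i (m - i) k k)" for k y :: real
proof -
  have "exp y * k + exp (- y) * k = 2 * (k * cosh y)" by (simp add: cosh_field_def algebra_simps)
  from sum_disc_poly_eq_cheb_U[OF this, of m]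
  have "cheb_U m (k * cosh y) = (\<Sum>i\<le>m. exp y ^ i * exp (- y) ^ (m - i) * disc_poly i (m - i) k k)"
    by (simp add: disc_poly_torus flip: exp_add)
  also have "\<dots> = (\<Sum>i\<le>m. exp ((2 * real i - real m) * y) * disc_poly i (m - i) k k)"
    by (intro sum.cong refl arg_cong2[where f = "(*)"])
       (simp add: exp_of_nat_mult[symmetric] exp_add[symmetric] of_nat_diff algebra_simps)
  finally show ?thesis .
qed

lemma abs_disc_poly_le:
  assumes "\<bar>k\<bar> \<le> (1::real)" "i \<le> m"
  shows "\<bar>disc_poly i (m - i) k k\<bar> \<le> real (m + 1)"
proof -
  have "norm (complex_of_real (disc_poly i (m - i) k k)) \<le> real (m + 1)"
    unfolding disc_poly_of_real[symmetric] using norm_disc_poly_le[of "of_real k" i m] assms by simp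
  then show ?thesis by simp
qed

lemma disc_eig_split:
  assumes "i \<le> m"
  shows "(2 * real i - real m)\<^sup>2 - real m * (real m + 2) = - disc_eig i (m - i) 0"
  using assms by (simp add: disc_eig_def of_nat_diff power2_eq_square algebra_simps)

text \<open>The disc polynomial with indices \<open>(i, m - i)\<close> contributes \<open>exp ((2 i - m) y)\<close> to \<open>cheb_U m (k cosh y)\<close>, whose
Gaussian average is \<open>exp ((2 i - m)\<^sup>2 t)\<close>. Together with the factor \<open>exp (- m (m + 2) t)\<close> this is the
exponential in \<open>kernel_term\<close>.\<close>

theorem disc_kernel_eq_Gaussian_integral:
  assumes t: "0 < t" and k: "0 < k" "k < 1"
  shows "disc_kernel t (of_real k) =
    of_real (\<integral>y. exp (- y\<^sup>2 / (4 * t)) / sqrt (4 * pi * t) * radial_kernel t (k * cosh y) \<partial>lborel)"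
proof -
  define N where "N y = exp (- y\<^sup>2 / (4 * t)) / sqrt (4 * pi * t)" for y
  define w where "w m = real (m + 1) * exp (- (real m * (real m + 2) * t))" for m :: nat
  define f where "f m y = N y * (w m * cheb_U m (k * cosh y))" for m y
  define M where "M m = real (m + 1) ^ 3 * exp (- (2 * t) * real m)" for m :: nat
  define s where "s = sqrt (4 * pi * t)"
  have s: "0 < s" using t by (simp add: s_def)
  have sM: "summable M" unfolding M_def using summable_cubic_exp[of "2 * t"] t by simp
  have w0: "0 \<le> w m" for m by (simp add: w_def)
  have N0: "0 \<le> N y" for y using t by (simp add: N_def)
  have k1: "\<bar>k\<bar> \<le> 1" using k by simp
  have Nexp: "has_bochner_integral lborel (\<lambda>y. N y * exp (n * y)) (exp (n\<^sup>2 * t))" for n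
  proof -
    have "has_bochner_integral lborel (\<lambda>y. exp (- y\<^sup>2 / (4 * t) + n * y) / s) (sqrt (4 * pi * t) * exp (n\<^sup>2 * t) / s)"
      by (rule has_bochner_integral_divide[OF real_Gaussian_moment[OF t]]) 
    moreover have "exp (- y\<^sup>2 / (4 * t) + n * y) / s = N y * exp (n * y)" for y
      unfolding N_def s_def exp_add by simp
    ultimately show ?thesis using s by (simp add: s_def[symmetric])
  qed
  have weight: "w m * exp ((2 * real i - real m)\<^sup>2 * t) = real (m + 1) * exp (- disc_eig i (m - i) 0 * t)" if "i \<le> m" for i m
    unfolding w_def mult.assoc exp_add[symmetric] disc_eig_split[OF that, symmetric]
    by (simp add: algebra_simps)
  have f_sum: "f m y = (\<Sum>i\<le>m. (w m * disc_poly i (m - i) k k) * (N y * exp ((2 * real i - real m) * y)))" for m y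
    by (simp add: f_def cheb_U_cosh_expansion sum_distrib_left mult_ac)
  have f_int: "has_bochner_integral lborel (f m) (\<Sum>i\<le>m. (w m * disc_poly i (m - i) k k) * exp ((2 * real i - real m)\<^sup>2 * t))" for m
    unfolding f_sum[abs_def] by (intro has_bochner_integral_sum has_bochner_integral_mult_right Nexp)
  \<comment> \<open>A majorant of \<open>f m\<close> whose integral and whose values are both summable over \<open>m\<close>.\<close>
  define G where "G m y = (\<Sum>i\<le>m. (w m * real (m + 1)) * (N y * exp ((2 * real i - real m) * y)))" for m y
  have norm_f: "norm (f m y) \<le> G m y" for m y
    unfolding f_sum G_def real_norm_def
  proof (rule order.trans[OF sum_abs sum_mono])
    fix i assume "i \<in> {..m}"
    then have "\<bar>disc_poly i (m - i) k k\<bar> \<le> real (m + 1)" using abs_disc_poly_le[OF k1] by simp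
    then show "\<bar>(w m * disc_poly i (m - i) k k) * (N y * exp ((2 * real i - real m) * y))\<bar> \<le> (w m * real (m + 1)) * (N y * exp ((2 * real i - real m) * y))"
      using w0[of m] N0[of y] unfolding abs_mult by (intro mult_mono) auto
  qed
  have G_int: "has_bochner_integral lborel (G m) (\<Sum>i\<le>m. (w m * real (m + 1)) * exp ((2 * real i - real m)\<^sup>2 * t))" for m
    unfolding G_def[abs_def] by (intro has_bochner_integral_sum has_bochner_integral_mult_right Nexp)
  have G_bound: "(\<Sum>i\<le>m. (w m * real (m + 1)) * exp ((2 * real i - real m)\<^sup>2 * t)) \<le> M m" for m
  proof -
    have "(\<Sum>i\<le>m. (w m * real (m + 1)) * exp ((2 * real i - real m)\<^sup>2 * t)) \<le> (\<Sum>i\<le>m. real (m + 1) ^ 2 * exp (- (2 * t) * real m))"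
    proof (rule sum_mono)
      fix i assume i: "i \<in> {..m}"
      have "(w m * real (m + 1)) * exp ((2 * real i - real m)\<^sup>2 * t) = real (m + 1) ^ 2 * exp (- disc_eig i (m - i) 0 * t)"
        using weight[of i m] i by (simp add: power2_eq_square mult_ac)
      also have "\<dots> \<le> real (m + 1) ^ 2 * exp (- (2 * t) * real m)"
        using mult_right_mono[OF disc_eig_ge, of i m t] i t by (intro mult_left_mono) (auto simp: mult_ac)
      finally show "(w m * real (m + 1)) * exp ((2 * real i - real m)\<^sup>2 * t) \<le> real (m + 1) ^ 2 * exp (- (2 * t) * real m)" .
    qed
    also have "\<dots> = M m" by (simp add: M_def power2_eq_square power3_eq_cube)
    finally show ?thesis .
  qed
  have f_summable: "summable (\<lambda>m. norm (f m y))" for y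
  proof -
    have G_pt: "G m y \<le> (N y * exp (y\<^sup>2 / (4 * t))) * M m" for m
    proof -
      have "G m y \<le> (\<Sum>i\<le>m. (real (m + 1) ^ 2 * exp (- (2 * t) * real m)) * (N y * exp (y\<^sup>2 / (4 * t))))"
        unfolding G_def
      proof (rule sum_mono)
        fix i assume i: "i \<in> {..m}"
        have "(2 * real i - real m) * y \<le> \<bar>2 * real i - real m\<bar> * \<bar>y\<bar>" by (metis abs_ge_self abs_mult)
        also have "\<dots> \<le> real m * \<bar>y\<bar>" using i by (intro mult_right_mono) (auto simp: abs_le_iff)
        \<comment> \<open>The first summand is compensated by the factor \<open>w m\<close>, the second one by \<open>N y\<close>.\<close>
        also have "\<dots> \<le> (real m)\<^sup>2 * t + y\<^sup>2 / (4 * t)"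
        proof -
          have "0 \<le> (2 * t * real m - \<bar>y\<bar>)\<^sup>2 / (4 * t)" using t by simp
          also have "\<dots> = (real m)\<^sup>2 * t - real m * \<bar>y\<bar> + y\<^sup>2 / (4 * t)"
            using t by (simp add: power2_eq_square field_simps)
          finally show ?thesis by simp
        qed
        finally have "exp ((2 * real i - real m) * y) \<le> exp ((real m)\<^sup>2 * t) * exp (y\<^sup>2 / (4 * t))"
          unfolding exp_add[symmetric] by simp
        then have "(w m * real (m + 1)) * (N y * exp ((2 * real i - real m) * y)) \<le>
           (w m * real (m + 1)) * (N y * (exp ((real m)\<^sup>2 * t) * exp (y\<^sup>2 / (4 * t))))"
          using w0 N0 by (intro mult_left_mono) auto
        also have "\<dots> = (real (m + 1) ^ 2 * (exp (- (real m * (real m + 2) * t)) * exp ((real m)\<^sup>2 * t))) * (N y * exp (y\<^sup>2 / (4 * t)))"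
          by (simp add: w_def power2_eq_square mult_ac)
        also have "exp (- (real m * (real m + 2) * t)) * exp ((real m)\<^sup>2 * t) = exp (- (2 * t) * real m)"
          unfolding exp_add[symmetric] by (simp add: power2_eq_square algebra_simps)
        finally show "(w m * real (m + 1)) * (N y * exp ((2 * real i - real m) * y)) \<le> (real (m + 1) ^ 2 * exp (- (2 * t) * real m)) * (N y * exp (y\<^sup>2 / (4 * t)))" .
      qed
      also have "\<dots> = (N y * exp (y\<^sup>2 / (4 * t))) * M m" by (simp add: M_def power2_eq_square power3_eq_cube mult_ac)
      finally show ?thesis .
    qed
    show "summable (\<lambda>m. norm (f m y))"
      by (rule summable_comparison_test'[OF summable_mult[OF sM, of "N y * exp (y\<^sup>2 / (4 * t))"], of 0])
         (use order.trans[OF norm_f G_pt] in simp)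
  qed
  have "(\<integral>y. (\<Sum>m. f m y) \<partial>lborel) = (\<Sum>m. \<integral>y. f m y \<partial>lborel)"
  proof (rule integral_suminf)
    show "integrable lborel (f m)" for m using f_int by (auto simp: has_bochner_integral_iff)
    show "AE y in lborel. summable (\<lambda>m. norm (f m y))" using f_summable by simp
    have "(\<integral>y. norm (f m y) \<partial>lborel) \<le> M m" for m
    proof -
      have "(\<integral>y. norm (f m y) \<partial>lborel) \<le> (\<integral>y. G m y \<partial>lborel)"
        using f_int[of m] G_int[of m] norm_f by (intro integral_mono) (auto simp: has_bochner_integral_iff)
      also have "\<dots> \<le> M m" using G_int[of m] G_bound[of m] by (simp add: has_bochner_integral_iff)
      finally show ?thesis .
    qed
    then show "summable (\<lambda>m. \<integral>y. norm (f m y) \<partial>lborel)"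
      by (intro summable_comparison_test'[OF sM, of 0]) auto
  qed
  moreover have "(\<Sum>m. f m y) = exp (- y\<^sup>2 / (4 * t)) / sqrt (4 * pi * t) * radial_kernel t (k * cosh y)" for y
  proof -
    have nz: "N y \<noteq> 0" using t by (simp add: N_def)
    have "summable (\<lambda>m. f m y)" by (rule summable_norm_cancel[OF f_summable])
    from suminf_divide[OF this, of "N y"] have "(\<Sum>m. f m y) / N y = (\<Sum>m. f m y / N y)" by simp
    also have "\<dots> = radial_kernel t (k * cosh y)"
      using nz by (simp only: f_def radial_kernel_def w_def nonzero_mult_div_cancel_left not_False_eq_True)
    finally show ?thesis using nz by (simp only: N_def[symmetric] divide_eq_eq) (simp add: mult.commute)
  qed
  moreover have kt: "of_real (\<integral>y. f m y \<partial>lborel) = kernel_term t m (of_real k)" for m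
  proof -
    have "(\<integral>y. f m y \<partial>lborel) = real (m + 1) * (\<Sum>i\<le>m. exp (- disc_eig i (m - i) 0 * t) * disc_poly i (m - i) k k)"
    proof -
      have "(w m * disc_poly i (m - i) k k) * exp ((2 * real i - real m)\<^sup>2 * t) =
          real (m + 1) * (exp (- disc_eig i (m - i) 0 * t) * disc_poly i (m - i) k k)" if "i \<in> {..m}" for i
      proof -
        have "(w m * disc_poly i (m - i) k k) * exp ((2 * real i - real m)\<^sup>2 * t) =
            (w m * exp ((2 * real i - real m)\<^sup>2 * t)) * disc_poly i (m - i) k k" by (simp only: mult_ac)
        also have "w m * exp ((2 * real i - real m)\<^sup>2 * t) = real (m + 1) * exp (- disc_eig i (m - i) 0 * t)"
          using that by (intro weight) simp
        finally show ?thesis by (simp only: mult.assoc)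
      qed
      then show ?thesis
        using f_int[of m] by (simp only: has_bochner_integral_iff sum_distrib_left cong: sum.cong)
    qed
    then show ?thesis by (simp add: kernel_term_def disc_poly_of_real del: of_nat_Suc)
  qed
  moreover have "disc_kernel t (of_real k) = of_real (\<Sum>m. \<integral>y. f m y \<partial>lborel)"
  proof -
    have "summable (\<lambda>m. complex_of_real (\<integral>y. f m y \<partial>lborel))"
      unfolding kt by (rule summable_kernel_term(2)[OF t]) (use k in simp)
    then have "summable (\<lambda>m. \<integral>y. f m y \<partial>lborel)" by (rule summable_of_real_iff[THEN iffD1])
    from suminf_of_real[OF this, where 'a = complex] show ?thesis
      unfolding disc_kernel_def kt by simp
  qed
  ultimately show ?thesis by simp
qed

lemma square_completion: "real m * (real m + 2) * t = real (m + 1) ^ 2 * t - t"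
  by (simp add: power2_eq_square algebra_simps)

text \<open>Multiplying by \<open>sinh w\<close> turns the Chebyshev polynomials at \<open>cosh w\<close> into hyperbolic sines, and the series into the
theta series of \<open>theta_expansion\<close>. The real numbers \<open>S\<close> and \<open>Q\<close> allow real and imaginary \<open>w\<close> to be treated alike.\<close>

lemma radial_kernel_expansion:
  fixes x :: real and w :: complex
  assumes t: "0 < t" "t \<le> 1" and w: "\<bar>Im w\<bar> \<le> pi / 2" "w \<noteq> 0" "sinh w \<noteq> 0" "cosh w = of_real x"
    and S: "w / sinh w = of_real S" and Q: "w\<^sup>2 = of_real Q"
  obtains \<rho> where "\<bar>\<rho>\<bar> \<le> 32 * exp (- 2 / t)"
    "radial_kernel t x = sqrt pi * exp t / (4 * t powr (3 / 2)) * (exp (Q / (4 * t)) * S * (1 + \<rho>))"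
proof -
  obtain R where R: "norm R \<le> 32 * exp (- 2 / t) * norm w"
    and sums: "(\<lambda>n. of_nat (n + 1) * exp (- of_real t * of_nat (n + 1) ^ 2) * sinh (of_nat (n + 1) * w)) sums
       (of_real (sqrt pi / (4 * t powr (3 / 2))) * exp (w\<^sup>2 / (4 * t)) * (w + R))"
    by (rule theta_expansion[OF t w(1)])
  define c where "c = sqrt pi / (4 * t powr (3 / 2))"
  have summand: "of_nat (n + 1) * exp (- of_real t * of_nat (n + 1) ^ 2) * sinh (of_nat (n + 1) * w) =
      of_real (real (n + 1) * exp (- (real n * (real n + 2) * t)) * cheb_U n x) * (of_real (exp (- t)) * sinh w)" for n
  proof -
    have "of_real (cheb_U n x) * sinh w = sinh (of_nat (n + 1) * w)"
      using cheb_U_cosh[of n w] unfolding w(4) cheb_U_of_real .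
    moreover have "exp (- of_real t * of_nat (n + 1) ^ 2) = complex_of_real (exp (- (real n * (real n + 2) * t)) * exp (- t))"
      unfolding exp_add[symmetric] square_completion by (simp add: exp_of_real[symmetric] mult.commute)
    ultimately show ?thesis by (simp add: mult_ac)
  qed
  have "(\<lambda>n. of_real (real (n + 1) * exp (- (real n * (real n + 2) * t)) * cheb_U n x)) sums
      ((of_real c * exp (w\<^sup>2 / (4 * t)) * (w + R)) / (of_real (exp (- t)) * sinh w))"
    using sums_divide[OF sums[unfolded summand], of "of_real (exp (- t)) * sinh w"] w(3) by (simp add: c_def)
  moreover have "(of_real c * exp (w\<^sup>2 / (4 * t)) * (w + R)) / (of_real (exp (- t)) * sinh w) =
     of_real (c * exp t * exp (Q / (4 * t))) * (w / sinh w * (1 + R / w))"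
  proof -
    have "exp (w\<^sup>2 / (4 * t)) = complex_of_real (exp (Q / (4 * t)))" by (simp add: Q exp_of_real[symmetric])
    moreover have "1 / complex_of_real (exp (- t)) = of_real (exp t)" by (simp add: exp_minus divide_inverse)
    ultimately show ?thesis using w(2,3) by (simp add: field_simps exp_minus)
  qed
  ultimately have s: "(\<lambda>n. complex_of_real (real (n + 1) * exp (- (real n * (real n + 2) * t)) * cheb_U n x)) sums
     (of_real (c * exp t * exp (Q / (4 * t))) * (of_real S * (1 + R / w)))" by (simp only: S)
  define \<rho> where "\<rho> = Re (R / w)"
  have "(\<lambda>n. real (n + 1) * exp (- (real n * (real n + 2) * t)) * cheb_U n x) sums (c * exp t * exp (Q / (4 * t)) * (S * (1 + \<rho>)))"
    using bounded_linear.sums[OF bounded_linear_Re s] by (simp add: \<rho>_def)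
  then have "radial_kernel t x = c * exp t * exp (Q / (4 * t)) * (S * (1 + \<rho>))"
    unfolding radial_kernel_def by (rule sums_unique[symmetric])
  moreover have "\<bar>\<rho>\<bar> \<le> 32 * exp (- 2 / t)"
  proof -
    have "\<bar>\<rho>\<bar> \<le> norm (R / w)" unfolding \<rho>_def by (rule abs_Re_le_cmod)
    also have "\<dots> \<le> 32 * exp (- 2 / t)" using R w(2) by (simp add: norm_divide divide_le_eq)
    finally show ?thesis .
  qed
  ultimately show ?thesis using that by (simp add: c_def)
qed

section \<open>The phase and the amplitude\<close>

text \<open>The square of \<open>arccos x\<close>, continued analytically beyond 1, where \<open>arccos x\<close> is \<open>\<i> arcosh x\<close>.\<close>

definition geodesic_sq :: "real \<Rightarrow> real" where
  "geodesic_sq x = (if x \<le> 1 then (arccos x)\<^sup>2 else - (arcosh x)\<^sup>2)"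

text \<open>\<open>d / sin d\<close> at \<open>d = arccos x\<close>, continued analytically beyond 1.\<close>

definition amplitude :: "real \<Rightarrow> real" where
  "amplitude x = (if x < 1 then arccos x / sqrt (1 - x\<^sup>2) else if x = 1 then 1 else arcosh x / sqrt (x\<^sup>2 - 1))"

text \<open>The formulas for \<open>geodesic_sq\<close> and \<open>amplitude\<close> change at 1, where only continuity is at hand.\<close>

lemma mono_except_point:
  fixes f :: "real \<Rightarrow> real"
  assumes ab: "a \<le> b" and cont: "continuous_on {a..b} f"
    and deriv: "\<And>x. a < x \<Longrightarrow> x < b \<Longrightarrow> x \<noteq> p \<Longrightarrow> \<exists>y. (f has_real_derivative y) (at x) \<and> 0 \<le> y"
  shows "f a \<le> f b"
proof (cases "a \<le> p \<and> p \<le> b")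
  case True
  have "f a \<le> f p"
    by (rule DERIV_nonneg_imp_increasing_open) (use True deriv in \<open>auto intro!: continuous_on_subset[OF cont]\<close>)
  also have "f p \<le> f b"
    by (rule DERIV_nonneg_imp_increasing_open) (use True deriv in \<open>auto intro!: continuous_on_subset[OF cont]\<close>)
  finally show ?thesis .
next
  case False
  show ?thesis
    by (rule DERIV_nonneg_imp_increasing_open[OF ab _ cont]) (use False deriv in fastforce)
qed

lemma sinh_ge_self: "0 \<le> x \<Longrightarrow> x \<le> sinh (x::real)"
proof -
  assume x: "0 \<le> x"
  have "sinh 0 - 0 \<le> sinh x - x"
  proof (rule DERIV_nonneg_imp_nondecreasing[OF x])
    fix y :: real
    have "((\<lambda>x. sinh x - x) has_real_derivative cosh y - 1) (at y)"
      by (auto intro!: derivative_eq_intros)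
    then show "\<exists>z. ((\<lambda>x. sinh x - x) has_real_derivative z) (at y) \<and> 0 \<le> z"
      using cosh_real_ge_1[of y] by force
  qed
  then show ?thesis by simp
qed

lemma sinh_le_self_cosh: "0 \<le> x \<Longrightarrow> sinh x \<le> x * cosh (x::real)"
proof -
  assume x: "0 \<le> x"
  have "0 * cosh 0 - sinh 0 \<le> x * cosh x - sinh x"
  proof (rule DERIV_nonneg_imp_nondecreasing[OF x])
    fix y :: real assume y: "0 \<le> y"
    have "((\<lambda>x. x * cosh x - sinh x) has_real_derivative y * sinh y) (at y)"
      by (auto intro!: derivative_eq_intros)
    then show "\<exists>z. ((\<lambda>x. x * cosh x - sinh x) has_real_derivative z) (at y) \<and> 0 \<le> z" using y by auto
  qed
  then show ?thesis by simp
qed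

lemma cos_self_le_sin: "0 \<le> x \<Longrightarrow> x \<le> pi \<Longrightarrow> x * cos x \<le> sin (x::real)"
proof -
  assume x: "0 \<le> x" "x \<le> pi"
  have "sin 0 - 0 * cos 0 \<le> sin x - x * cos x"
  proof (rule DERIV_nonneg_imp_nondecreasing[OF x(1)])
    fix y :: real assume y: "0 \<le> y" "y \<le> x"
    have "((\<lambda>x. sin x - x * cos x) has_real_derivative y * sin y) (at y)"
      by (auto intro!: derivative_eq_intros)
    moreover have "0 \<le> y * sin y" using x y by (intro mult_nonneg_nonneg sin_ge_zero) auto
    ultimately show "\<exists>z. ((\<lambda>x. sin x - x * cos x) has_real_derivative z) (at y) \<and> 0 \<le> z" by auto
  qed
  then show ?thesis by simp
qed

lemma amplitude_bounds:
  assumes "0 < x"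
  shows "min 1 (1 / x) \<le> amplitude x" "amplitude x \<le> max 1 (1 / x)"
    "x < 1 \<Longrightarrow> 1 \<le> amplitude x" "1 < x \<Longrightarrow> amplitude x \<le> 1"
proof -
  consider "x < 1" | "x = 1" | "1 < x" by linarith
  then have "min 1 (1 / x) \<le> amplitude x \<and> amplitude x \<le> max 1 (1 / x) \<and> (x < 1 \<longrightarrow> 1 \<le> amplitude x) \<and> (1 < x \<longrightarrow> amplitude x \<le> 1)"
  proof cases
    case 1
    define d where "d = arccos x"
    have x: "cos d = x" using 1 assms by (simp add: d_def)
    have d: "0 < d" "d < pi" using 1 assms arccos_lt_bounded[of x] by (auto simp: d_def)
    have s: "sqrt (1 - x\<^sup>2) = sin d" using sin_arccos_abs[of x] 1 assms by (simp add: d_def)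
    have sd: "0 < sin d" using d by (rule sin_gt_zero)
    have A: "amplitude x = d / sin d" using 1 by (simp add: amplitude_def d_def s[unfolded d_def])
    have "1 \<le> d / sin d" using sin_x_le_x[of d] d sd by (simp add: field_simps)
    moreover have "d / sin d \<le> 1 / x"
      using cos_self_le_sin[of d] d sd assms unfolding x by (simp add: field_simps)
    ultimately show ?thesis using 1 unfolding A by auto
  next
    case 2
    then show ?thesis by (simp add: amplitude_def)
  next
    case 3
    define d where "d = arcosh x"
    have d: "0 < d" using 3 by (simp add: d_def)
    have x: "cosh d = x" using 3 by (simp add: d_def)
    have s: "sqrt (x\<^sup>2 - 1) = sinh d" using 3 by (simp add: d_def sinh_arcosh_real)
    have sd: "0 < sinh d" using d by simp
    have A: "amplitude x = d / sinh d" using 3 by (simp add: amplitude_def d_def s[unfolded d_def])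
    have "d / sinh d \<le> 1" using sinh_ge_self[of d] d sd by (simp add: field_simps)
    moreover have "1 / x \<le> d / sinh d"
      using sinh_le_self_cosh[of d] d sd assms unfolding x by (simp add: field_simps)
    ultimately show ?thesis using 3 unfolding A by auto
  qed
  then show "min 1 (1 / x) \<le> amplitude x" "amplitude x \<le> max 1 (1 / x)"
    "x < 1 \<Longrightarrow> 1 \<le> amplitude x" "1 < x \<Longrightarrow> amplitude x \<le> 1" by auto
qed

text \<open>At 1 the amplitude is squeezed between \<open>min 1 (1 / x)\<close> and \<open>max 1 (1 / x)\<close>.\<close>

lemma isCont_amplitude:
  assumes "0 < x"
  shows "isCont amplitude x"
proof (cases "x = 1")
  case True
  have lim: "((\<lambda>y. min 1 (1 / y)) \<longlongrightarrow> min 1 (1 / 1)) (at (1::real))" "((\<lambda>y. max 1 (1 / y)) \<longlongrightarrow> max 1 (1 / 1)) (at (1::real))"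
    by (intro tendsto_intros tendsto_min tendsto_max | simp)+
  have ev: "eventually (\<lambda>y::real. 0 < y) (at 1)"
    by (rule order_tendstoD(1)[OF tendsto_ident_at]) simp
  have "(amplitude \<longlongrightarrow> 1) (at 1)"
    by (rule tendsto_sandwich[OF eventually_mono[OF ev amplitude_bounds(1)] eventually_mono[OF ev amplitude_bounds(2)]])
       (use lim in simp_all)
  then show ?thesis unfolding True isCont_def by (simp add: amplitude_def)
next
  case False
  show ?thesis
  proof (cases "x < 1")
    case True
    have "isCont (\<lambda>x. arccos x / sqrt (1 - x\<^sup>2)) x"
      using True assms by (intro continuous_intros isCont_arccos) (auto simp: abs_square_eq_1 power2_eq_1_iff)
    moreover have ev: "eventually (\<lambda>y. arccos y / sqrt (1 - y\<^sup>2) = amplitude y) (nhds x)"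
      using eventually_nhds_in_open[of "{..<1}" x] True by (auto elim!: eventually_mono simp: amplitude_def)
    ultimately show ?thesis by (simp only: isCont_cong[OF ev])
  next
    case gt: False
    then have "1 < x" using False by simp
    have "isCont (\<lambda>x. arcosh x / sqrt (x\<^sup>2 - 1)) x"
      using \<open>1 < x\<close> by (intro continuous_intros DERIV_isCont[OF arcosh_real_has_field_derivative]) (auto simp: power2_eq_1_iff)
    moreover have ev: "eventually (\<lambda>y. arcosh y / sqrt (y\<^sup>2 - 1) = amplitude y) (nhds x)"
      using eventually_nhds_in_open[of "{1<..}" x] \<open>1 < x\<close> by (auto elim!: eventually_mono simp: amplitude_def)
    ultimately show ?thesis by (simp only: isCont_cong[OF ev])
  qed
qed

lemma DERIV_geodesic_sq:
  assumes "0 < x" "x \<noteq> 1"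
  shows "(geodesic_sq has_real_derivative - 2 * amplitude x) (at x)"
proof (cases "x < 1")
  case True
  have "((\<lambda>x. (arccos x)\<^sup>2) has_real_derivative - 2 * amplitude x) (at x)"
    using True assms by (auto intro!: derivative_eq_intros simp: amplitude_def field_simps)
  moreover have ev: "eventually (\<lambda>y. geodesic_sq y = (arccos y)\<^sup>2) (nhds x)"
    using eventually_nhds_in_open[of "{..<1}" x] True by (auto elim!: eventually_mono simp: geodesic_sq_def)
  ultimately show ?thesis by (simp only: DERIV_cong_ev[OF refl ev refl])
next
  case False
  then have x: "1 < x" using assms by simp
  have "((\<lambda>x. - (arcosh x)\<^sup>2) has_real_derivative - 2 * amplitude x) (at x)"
    using x by (auto intro!: derivative_eq_intros simp: amplitude_def field_simps)
  moreover have ev: "eventually (\<lambda>y. geodesic_sq y = - (arcosh y)\<^sup>2) (nhds x)"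
    using eventually_nhds_in_open[of "{1<..}" x] x by (auto elim!: eventually_mono simp: geodesic_sq_def)
  ultimately show ?thesis by (simp only: DERIV_cong_ev[OF refl ev refl])
qed

lemma continuous_on_geodesic_sq: "continuous_on {0..} geodesic_sq"
proof -
  have "continuous_on ({0..1} \<union> {1..}) (\<lambda>x. if x \<le> 1 then (arccos x)\<^sup>2 else - (arcosh x)\<^sup>2)"
    by (intro continuous_on_cases) (auto intro!: continuous_intros)
  moreover have "{0..1} \<union> {1..} = {0::real..}" by auto
  ultimately show ?thesis by (simp add: geodesic_sq_def[abs_def])
qed

lemma DERIV_amplitude_times:
  assumes "0 < x" "x \<noteq> 1"
  shows "((\<lambda>x. x * amplitude x) has_real_derivative (amplitude x - x) / (1 - x\<^sup>2)) (at x)"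
proof (cases "x < 1")
  case True
  define q where "q = sqrt (1 - x\<^sup>2)"
  have x2: "0 < 1 - x\<^sup>2" using True assms by (simp add: abs_square_less_1)
  have q: "0 < q" "q\<^sup>2 = 1 - x\<^sup>2" using x2 by (simp_all add: q_def)
  have A: "amplitude x = arccos x / q" using True by (simp add: amplitude_def q_def)
  have da: "(arccos has_real_derivative - inverse q) (at x)"
    using DERIV_arccos[of x] True assms by (simp add: q_def)
  have "((\<lambda>x. 1 - x\<^sup>2) has_real_derivative - (2 * x)) (at x)" by (auto intro!: derivative_eq_intros)
  from DERIV_chain2[OF DERIV_real_sqrt[OF x2] this]
  have dq: "((\<lambda>x. sqrt (1 - x\<^sup>2)) has_real_derivative - (2 * x) / (2 * q)) (at x)"
  proof (rule DERIV_cong)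
    show "inverse (sqrt (1 - x\<^sup>2)) / 2 * (- (2 * x)) = - (2 * x) / (2 * q)"
      unfolding q_def[symmetric] using q(1) by (simp add: field_simps)
  qed
  have "((\<lambda>x. x * (arccos x / sqrt (1 - x\<^sup>2))) has_real_derivative
     1 * (arccos x / q) + (- inverse q * q - arccos x * (- (2 * x) / (2 * q))) / (q * q) * x) (at x)"
    using DERIV_mult[OF DERIV_ident DERIV_divide[OF da dq]] q(1) unfolding q_def[symmetric] by simp
  moreover have "1 * (arccos x / q) + (- inverse q * q - arccos x * (- (2 * x) / (2 * q))) / (q * q) * x = (arccos x / q - x) / q\<^sup>2"
  proof -
    have "1 * (arccos x / q) + (- inverse q * q - arccos x * (- (2 * x) / (2 * q))) / (q * q) * x = ((q\<^sup>2 + x\<^sup>2) * (arccos x / q) - x) / q\<^sup>2"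
      using q(1) by (simp add: field_simps power2_eq_square)
    then show ?thesis using q(2) by simp
  qed
  ultimately have "((\<lambda>x. x * (arccos x / sqrt (1 - x\<^sup>2))) has_real_derivative (amplitude x - x) / (1 - x\<^sup>2)) (at x)"
    by (simp add: A q(2))
  moreover have ev: "eventually (\<lambda>y. y * amplitude y = y * (arccos y / sqrt (1 - y\<^sup>2))) (nhds x)"
    using eventually_nhds_in_open[of "{..<1}" x] True by (auto elim!: eventually_mono simp: amplitude_def)
  ultimately show ?thesis by (simp only: DERIV_cong_ev[OF refl ev refl])
next
  case False
  then have x: "1 < x" using assms by simp
  define q where "q = sqrt (x\<^sup>2 - 1)"
  have x2: "0 < x\<^sup>2 - 1" using x by (simp add: one_less_power)
  have q: "0 < q" "q\<^sup>2 = x\<^sup>2 - 1" using x2 by (simp_all add: q_def)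
  have A: "amplitude x = arcosh x / q" using x by (simp add: amplitude_def q_def)
  have da: "(arcosh has_real_derivative inverse q) (at x)"
    using arcosh_real_has_field_derivative[OF x] by (simp add: q_def inverse_eq_divide)
  have "((\<lambda>x. x\<^sup>2 - 1) has_real_derivative (2 * x)) (at x)" by (auto intro!: derivative_eq_intros)
  from DERIV_chain2[OF DERIV_real_sqrt[OF x2] this]
  have dq: "((\<lambda>x. sqrt (x\<^sup>2 - 1)) has_real_derivative (2 * x) / (2 * q)) (at x)"
  proof (rule DERIV_cong)
    show "inverse (sqrt (x\<^sup>2 - 1)) / 2 * (2 * x) = (2 * x) / (2 * q)"
      unfolding q_def[symmetric] using q(1) by (simp add: field_simps)
  qed
  have "((\<lambda>x. x * (arcosh x / sqrt (x\<^sup>2 - 1))) has_real_derivative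
     1 * (arcosh x / q) + (inverse q * q - arcosh x * ((2 * x) / (2 * q))) / (q * q) * x) (at x)"
    using DERIV_mult[OF DERIV_ident DERIV_divide[OF da dq]] q(1) unfolding q_def[symmetric] by simp
  moreover have "1 * (arcosh x / q) + (inverse q * q - arcosh x * ((2 * x) / (2 * q))) / (q * q) * x = (arcosh x / q - x) / (- q\<^sup>2)"
  proof -
    have "1 * (arcosh x / q) + (inverse q * q - arcosh x * ((2 * x) / (2 * q))) / (q * q) * x = ((x\<^sup>2 - q\<^sup>2) * (arcosh x / q) - x) / (- q\<^sup>2)"
      using q(1) by (simp add: field_simps power2_eq_square)
    then show ?thesis using q(2) by simp
  qed
  ultimately have "((\<lambda>x. x * (arcosh x / sqrt (x\<^sup>2 - 1))) has_real_derivative (amplitude x - x) / (1 - x\<^sup>2)) (at x)"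
    by (simp add: A q(2))
  moreover have ev: "eventually (\<lambda>y. y * amplitude y = y * (arcosh y / sqrt (y\<^sup>2 - 1))) (nhds x)"
    using eventually_nhds_in_open[of "{1<..}" x] x by (auto elim!: eventually_mono simp: amplitude_def)
  ultimately show ?thesis by (simp only: DERIV_cong_ev[OF refl ev refl])
qed

text \<open>The derivative of \<open>x amplitude x - ln (1 + x)\<close> is \<open>(amplitude x - 1) / (1 - x\<^sup>2)\<close>, which is not negative on either
side of 1.\<close>

lemma amplitude_times_increment:
  assumes "0 < x" "x \<le> y"
  shows "ln ((1 + y) / (1 + x)) \<le> y * amplitude y - x * amplitude x"
proof -
  have "x * amplitude x - ln (1 + x) \<le> y * amplitude y - ln (1 + y)"
  proof (rule mono_except_point[OF assms(2), where p = 1])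
    show "continuous_on {x..y} (\<lambda>x. x * amplitude x - ln (1 + x))"
      using assms by (intro continuous_at_imp_continuous_on ballI continuous_intros isCont_amplitude) auto
    fix u assume u: "x < u" "u < y" "u \<noteq> 1"
    then have u0: "0 < u" using assms by simp
    have "((\<lambda>x. x * amplitude x - ln (1 + x)) has_real_derivative (amplitude u - u) / (1 - u\<^sup>2) - 1 / (1 + u)) (at u)"
      using u0 u(3) by (intro DERIV_diff DERIV_amplitude_times) (auto intro!: derivative_eq_intros)
    moreover have "(amplitude u - u) / (1 - u\<^sup>2) - 1 / (1 + u) = (amplitude u - 1) / (1 - u\<^sup>2)"
    proof -
      have "1 / (1 + u) = (1 - u) / ((1 - u) * (1 + u))" using u(3) u0 by simp
      also have "(1 - u) * (1 + u) = 1 - u\<^sup>2" by (simp add: power2_eq_square algebra_simps)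
      finally show ?thesis by (simp add: diff_divide_distrib[symmetric])
    qed
    moreover have "0 \<le> (amplitude u - 1) / (1 - u\<^sup>2)"
    proof (cases "u < 1")
      case True
      then show ?thesis using amplitude_bounds(3)[OF u0] u0 by (simp add: abs_square_le_1)
    next
      case False
      then have "1 < u" using u(3) by simp
      then show ?thesis using amplitude_bounds(4)[OF u0] by (simp add: divide_nonpos_nonpos one_le_power)
    qed
    ultimately show "\<exists>z. ((\<lambda>x. x * amplitude x - ln (1 + x)) has_real_derivative z) (at u) \<and> 0 \<le> z" by auto
  qed
  moreover have "ln ((1 + y) / (1 + x)) = ln (1 + y) - ln (1 + x)" using assms by (simp add: ln_div)
  ultimately show ?thesis by simp
qed

lemma self_eq_amplitude_cosh: "0 < y \<Longrightarrow> amplitude (cosh y) * sinh y = y"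
proof -
  assume y: "0 < y"
  then have "1 < cosh y" using cosh_real_strict_mono[of 0 y] by simp
  moreover have "sqrt ((cosh y)\<^sup>2 - 1) = sinh y" using y by (simp add: cosh_square_eq)
  ultimately show ?thesis using y by (simp add: amplitude_def arcosh_cosh_real)
qed

text \<open>In this form the derivative compares the increasing function \<open>x amplitude x\<close> at \<open>cosh y\<close> and at the smaller point
\<open>k cosh y\<close>; the first summand comes from \<open>y = amplitude (cosh y) sinh y\<close>.\<close>

lemma DERIV_phase:
  assumes k: "0 < k" and y: "0 < y" and ne: "k * cosh y \<noteq> 1"
  shows "((\<lambda>y. y\<^sup>2 + geodesic_sq (k * cosh y)) has_real_derivative
     2 * tanh y * (cosh y * amplitude (cosh y) - k * cosh y * amplitude (k * cosh y))) (at y)"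
proof -
  have "((\<lambda>y. geodesic_sq (k * cosh y)) has_real_derivative (- 2 * amplitude (k * cosh y)) * (k * sinh y)) (at y)"
    by (rule DERIV_chain2[OF DERIV_geodesic_sq]) (use k ne in \<open>auto intro!: derivative_eq_intros\<close>)
  then have "((\<lambda>y. y\<^sup>2 + geodesic_sq (k * cosh y)) has_real_derivative 2 * y + (- 2 * amplitude (k * cosh y)) * (k * sinh y)) (at y)"
    by (intro DERIV_add) (auto intro!: derivative_eq_intros)
  moreover have "2 * y + (- 2 * amplitude (k * cosh y)) * (k * sinh y) =
      2 * tanh y * (cosh y * amplitude (cosh y) - k * cosh y * amplitude (k * cosh y))"
  proof -
    have "2 * y = 2 * (amplitude (cosh y) * sinh y)" using self_eq_amplitude_cosh[OF y] by simp
    then show ?thesis by (simp add: tanh_def field_simps)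
  qed
  ultimately show ?thesis by simp
qed

text \<open>By the increment estimate the derivative of the phase is at least \<open>2 c tanh y\<close> with
\<open>c = ln (2 / (1 + k))\<close>, because \<open>(1 + cosh y) / (1 + k cosh y)\<close> is smallest at \<open>y = 0\<close>.\<close>

lemma phase_lower_bound:
  assumes k: "0 < k" "k < 1"
  shows "geodesic_sq k + 2 * ln (2 / (1 + k)) * ln (cosh y) \<le> y\<^sup>2 + geodesic_sq (k * cosh y)"
proof -
  define c where "c = ln (2 / (1 + k))"
  have "geodesic_sq k + 2 * c * ln (cosh y) \<le> y\<^sup>2 + geodesic_sq (k * cosh y)" if y: "0 \<le> y" for y
  proof -
    define f where "f y = y\<^sup>2 + geodesic_sq (k * cosh y) - 2 * c * ln (cosh y)" for y
    have "f 0 \<le> f y"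
    proof (rule mono_except_point[OF y, where p = "arcosh (1 / k)"])
      show "continuous_on {0..y} f"
        unfolding f_def using k
        by (intro continuous_intros continuous_on_compose2[OF continuous_on_geodesic_sq]) (auto simp: cosh_real_pos)
      fix u assume u: "0 < u" "u < y" "u \<noteq> arcosh (1 / k)"
      have ne: "k * cosh u \<noteq> 1"
      proof
        assume "k * cosh u = 1"
        then have "cosh u = 1 / k" using k by (simp add: field_simps)
        then have "u = arcosh (1 / k)" using arcosh_cosh_real[of u] u(1) by simp
        then show False using u(3) by simp
      qed
      have C: "1 \<le> cosh u" by (rule cosh_real_ge_1)
      have D1: "((\<lambda>y. ln (cosh y)) has_real_derivative tanh u) (at u)"
        by (auto intro!: derivative_eq_intros simp: tanh_def cosh_real_pos divide_inverse)
      have "(f has_real_derivative 2 * tanh u * (cosh u * amplitude (cosh u) - k * cosh u * amplitude (k * cosh u)) - 2 * c * tanh u) (at u)"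
        unfolding f_def[abs_def] by (intro DERIV_diff DERIV_phase[OF k(1) u(1) ne] DERIV_cmult D1)
      moreover have "0 \<le> 2 * tanh u * (cosh u * amplitude (cosh u) - k * cosh u * amplitude (k * cosh u)) - 2 * c * tanh u"
      proof -
        have "c \<le> ln ((1 + cosh u) / (1 + k * cosh u))"
        proof -
          have "0 \<le> (cosh u - 1) * (1 - k)" using C k by simp
          then have "2 * (1 + k * cosh u) \<le> (1 + cosh u) * (1 + k)" by (simp add: algebra_simps)
          moreover have "0 < 1 + k" "0 < 1 + k * cosh u" using k C by (auto intro!: add_pos_pos mult_pos_pos)
          ultimately have "2 / (1 + k) \<le> (1 + cosh u) / (1 + k * cosh u)"
            by (simp add: pos_divide_le_eq pos_le_divide_eq)
          then show ?thesis unfolding c_def using k C by (subst ln_le_cancel_iff) (auto intro!: divide_pos_pos add_pos_pos mult_pos_pos)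
        qed
        also have "\<dots> \<le> cosh u * amplitude (cosh u) - k * cosh u * amplitude (k * cosh u)"
          by (rule amplitude_times_increment) (use k C in \<open>auto simp: mult_le_cancel_right1\<close>)
        finally have "0 \<le> 2 * tanh u * ((cosh u * amplitude (cosh u) - k * cosh u * amplitude (k * cosh u)) - c)"
          using u(1) by (intro mult_nonneg_nonneg) auto
        then show ?thesis by (simp add: algebra_simps)
      qed
      ultimately show "\<exists>z. (f has_real_derivative z) (at u) \<and> 0 \<le> z" by blast
    qed
    then show ?thesis by (simp add: f_def)
  qed
  from this[of "\<bar>y\<bar>"] show ?thesis by (simp add: c_def)
qed

text \<open>By l'Hospital's rule, since \<open>tanh y / y\<close> tends to 1. At \<open>k = cos r\<close> the limit is \<open>1 - r cot r\<close>.\<close>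

lemma phase_quadratic_limit:
  assumes k: "0 < k" "k < 1"
  shows "((\<lambda>y. (y\<^sup>2 + geodesic_sq (k * cosh y) - geodesic_sq k) / y\<^sup>2) \<longlongrightarrow> 1 - k * amplitude k) (at_right 0)"
proof (rule lhopital_right_0)
  define g where "g y = 2 * tanh y * (cosh y * amplitude (cosh y) - k * cosh y * amplitude (k * cosh y))" for y
  have kc: "isCont (\<lambda>y. k * cosh y) 0" by (intro continuous_intros)
  have ps: "isCont (\<lambda>y. geodesic_sq (k * cosh y)) 0"
    by (rule isCont_o2[OF kc]) (use k DERIV_isCont[OF DERIV_geodesic_sq] in simp)
  have "((\<lambda>y. y\<^sup>2 + geodesic_sq (k * cosh y) - geodesic_sq k) \<longlongrightarrow> 0\<^sup>2 + geodesic_sq (k * cosh 0) - geodesic_sq k) (at 0)"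
    by (intro tendsto_intros) (use ps in \<open>simp add: isCont_def\<close>)
  then show "((\<lambda>y. y\<^sup>2 + geodesic_sq (k * cosh y) - geodesic_sq k) \<longlongrightarrow> 0) (at_right 0)"
    by (simp add: filterlim_at_split)
  show "((\<lambda>y::real. y\<^sup>2) \<longlongrightarrow> 0) (at_right 0)" by real_asymp
  show "eventually (\<lambda>y::real. y\<^sup>2 \<noteq> 0) (at_right 0)" "eventually (\<lambda>y::real. 2 * y \<noteq> 0) (at_right 0)"
    by (auto simp: eventually_at_filter)
  show "eventually (\<lambda>y. ((\<lambda>y::real. y\<^sup>2) has_real_derivative 2 * y) (at y)) (at_right 0)"
    by (intro always_eventually allI) (auto intro!: derivative_eq_intros)
  have "((\<lambda>y. k * cosh y) \<longlongrightarrow> k) (at_right 0)" using kc by (simp add: isCont_def filterlim_at_split)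
  then have "eventually (\<lambda>y. k * cosh y < 1) (at_right 0)" using k(2) by (rule order_tendstoD)
  then show "eventually (\<lambda>y. ((\<lambda>y. y\<^sup>2 + geodesic_sq (k * cosh y) - geodesic_sq k) has_real_derivative g y) (at y)) (at_right 0)"
    using eventually_at_right_less[of 0]
  proof eventually_elim
    case (elim y)
    then show ?case
      using DERIV_diff[OF DERIV_phase[OF k(1), of y] DERIV_const[of "geodesic_sq k"]] by (simp add: g_def)
  qed
  have am: "isCont (\<lambda>y. amplitude (k * cosh y)) 0" "isCont (\<lambda>y. amplitude (cosh y)) 0"
    using k by (auto intro!: isCont_o2[OF _ isCont_amplitude] continuous_intros)
  have "((\<lambda>y. (tanh y / y) * (cosh y * amplitude (cosh y) - k * cosh y * amplitude (k * cosh y))) \<longlongrightarrow>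
     1 * (cosh 0 * amplitude (cosh 0) - k * cosh 0 * amplitude (k * cosh 0))) (at_right 0)"
  proof (intro tendsto_mult tendsto_diff tendsto_const)
    show "((\<lambda>y::real. tanh y / y) \<longlongrightarrow> 1) (at_right 0)" unfolding tanh_def by real_asymp
    show "((\<lambda>y. amplitude (cosh y)) \<longlongrightarrow> amplitude (cosh 0)) (at_right 0)"
      "((\<lambda>y. amplitude (k * cosh y)) \<longlongrightarrow> amplitude (k * cosh 0)) (at_right 0)"
      using am by (simp_all add: isCont_def filterlim_at_split)
  qed real_asymp+
  then show "((\<lambda>y. g y / (2 * y)) \<longlongrightarrow> 1 - k * amplitude k) (at_right 0)"
    by (simp add: g_def amplitude_def)
qed

lemma amplitude_times_less_1:
  assumes "0 < k" "k < 1"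
  shows "k * amplitude k < 1"
proof -
  have "0 < ln ((1 + 1) / (1 + k))" using assms by simp
  also have "\<dots> \<le> 1 * amplitude 1 - k * amplitude k"
    by (rule amplitude_times_increment) (use assms in auto)
  finally show ?thesis by (simp add: amplitude_def)
qed

section \<open>The Laplace method\<close>

text \<open>The case \<open>x = 1\<close> would need a limit in the division by \<open>sinh w\<close>; it occurs only on a null set of the integral
below.\<close>

lemma radial_kernel_small_time:
  assumes t: "0 < t" "t \<le> 1" and x: "0 < x" "x \<noteq> 1"
  obtains \<rho> where "\<bar>\<rho>\<bar> \<le> 32 * exp (- 2 / t)"
    "radial_kernel t x = sqrt pi * exp t / (4 * t powr (3 / 2)) * (exp (- geodesic_sq x / (4 * t)) * amplitude x * (1 + \<rho>))"
proof (cases "x < 1")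
  case True
  define d where "d = arccos x"
  define w where "w = \<i> * complex_of_real d"
  have cd: "cos d = x" using True x by (simp add: d_def)
  have d: "0 < d" "d < pi" using True x arccos_lt_bounded[of x] by (auto simp: d_def)
  have d2: "d \<le> pi / 2"
  proof (rule ccontr)
    assume "\<not> d \<le> pi / 2"
    then have "cos d < 0" using d cos_lt_zero_pi[of d] by auto
    then show False using cd x by simp
  qed
  have sd: "0 < sin d" using d by (rule sin_gt_zero)
  have sx: "sin d = sqrt (1 - x\<^sup>2)" using sin_arccos_abs[of x] True x by (simp add: d_def)
  have c: "cosh w = of_real x" by (simp add: w_def cosh_conv_cos cd[symmetric] cos_of_real)
  have s: "sinh w = \<i> * of_real (sin d)" by (simp add: w_def sinh_conv_sin sin_of_real)
  show ?thesis
  proof (rule radial_kernel_expansion[OF t, of w x "amplitude x" "- geodesic_sq x"])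
    show "\<bar>Im w\<bar> \<le> pi / 2" using d d2 by (simp add: w_def)
    show "w \<noteq> 0" "sinh w \<noteq> 0" using d sd by (simp_all add: s, simp add: w_def)
    show "cosh w = of_real x" by (rule c)
    show "w / sinh w = of_real (amplitude x)" using True sd unfolding s by (simp add: w_def amplitude_def d_def[symmetric] sx[symmetric])
    show "w\<^sup>2 = of_real (- geodesic_sq x)" using True by (simp add: w_def geodesic_sq_def d_def power_mult_distrib)
  qed (rule that)
next
  case False
  then have x1: "1 < x" using x by simp
  define d where "d = arcosh x"
  have d: "0 < d" "cosh d = x" "sinh d = sqrt (x\<^sup>2 - 1)" using x1 by (simp_all add: d_def sinh_arcosh_real)
  have sd: "0 < sinh d" using d(1) by simp
  have of_real: "sinh (complex_of_real d) = of_real (sinh d)" "cosh (complex_of_real d) = of_real (cosh d)"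
    by (simp_all add: sinh_field_def cosh_field_def exp_of_real flip: of_real_minus)
  show ?thesis
  proof (rule radial_kernel_expansion[OF t, of "of_real d" x "amplitude x" "- geodesic_sq x"])
    show "\<bar>Im (of_real d)\<bar> \<le> pi / 2" by simp
    show "complex_of_real d \<noteq> 0" "sinh (complex_of_real d) \<noteq> 0" using d(1) sd by (simp_all add: of_real)
    show "cosh (complex_of_real d) = of_real x" by (simp add: of_real d)
    show "of_real d / sinh (complex_of_real d) = of_real (amplitude x)"
      using x1 unfolding of_real d(3) by (simp add: amplitude_def d_def)
    show "(complex_of_real d)\<^sup>2 = of_real (- geodesic_sq x)" using x1 by (simp add: geodesic_sq_def d_def)
  qed (rule that)
qed

lemma cosh_ge_quadratic: "1 + y\<^sup>2 / 2 \<le> cosh (y::real)"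
proof -
  have "\<bar>y\<bar> / 2 \<le> sinh (\<bar>y\<bar> / 2)" by (rule sinh_ge_self) simp
  then have "(\<bar>y\<bar> / 2)\<^sup>2 \<le> (sinh (\<bar>y\<bar> / 2))\<^sup>2" by (rule power_mono) simp
  moreover have "cosh (2 * (\<bar>y\<bar> / 2)) = 1 + 2 * (sinh (\<bar>y\<bar> / 2))\<^sup>2"
    unfolding cosh_double cosh_square_eq by simp
  ultimately show ?thesis by (simp add: power_divide)
qed

text \<open>With \<open>a = c / (2 t) \<ge> 1\<close> the left side is \<open>cosh (\<surd>t u)\<^sup>-\<^sup>a\<close>. Bernoulli's inequality for an integer exponent between \<open>a / 2\<close> and \<open>a\<close>
gives a majorant that does not depend on \<open>t\<close> and is integrable in \<open>u\<close>.\<close>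

lemma cosh_power_bound:
  assumes t: "0 < t" "t \<le> c / 2"
  shows "exp (- (2 * c * ln (cosh (sqrt t * u))) / (4 * t)) \<le> inverse (1 + (sqrt (c / 8) * u)\<^sup>2)"
proof -
  define a where "a = c / (2 * t)"
  have c: "0 < c" using t by simp
  have a: "1 \<le> a" using t by (simp add: a_def field_simps)
  define n where "n = nat \<lfloor>a\<rfloor>"
  have "1 \<le> \<lfloor>a\<rfloor>" using a by simp
  then have "real n = of_int \<lfloor>a\<rfloor>" "1 \<le> real_of_int \<lfloor>a\<rfloor>" by (simp_all add: n_def)
  then have n: "real n \<le> a" "a / 2 \<le> real n" by linarith+
  define L where "L = ln (cosh (sqrt t * u))"
  have L: "0 \<le> L" "exp L = cosh (sqrt t * u)" using cosh_real_ge_1[of "sqrt t * u"] by (simp_all add: L_def cosh_real_pos)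
  have "1 + (sqrt (c / 8) * u)\<^sup>2 = 1 + (a / 2) * ((sqrt t * u)\<^sup>2 / 2)"
    using t c by (simp add: a_def power_mult_distrib)
  also have "\<dots> \<le> 1 + real n * ((sqrt t * u)\<^sup>2 / 2)"
    using n by (intro add_left_mono mult_right_mono) auto
  also have "\<dots> \<le> (1 + (sqrt t * u)\<^sup>2 / 2) ^ n"
    by (rule Bernoulli_inequality) (meson divide_nonneg_nonneg le_minus_one_simps(1) order_trans zero_le_numeral zero_le_power2)
  also have "\<dots> \<le> cosh (sqrt t * u) ^ n"
    by (intro power_mono cosh_ge_quadratic) auto
  also have "\<dots> = exp (real n * L)" by (simp add: L(2)[symmetric] exp_of_nat_mult)
  also have "\<dots> \<le> exp (a * L)" using n L by (simp add: mult_right_mono)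
  finally have le: "1 + (sqrt (c / 8) * u)\<^sup>2 \<le> exp (a * L)" .
  have "exp (- (2 * c * ln (cosh (sqrt t * u))) / (4 * t)) = inverse (exp (a * L))"
    unfolding exp_minus[symmetric] using t by (simp add: a_def L_def field_simps)
  also have "\<dots> \<le> inverse (1 + (sqrt (c / 8) * u)\<^sup>2)"
    by (rule le_imp_inverse_le[OF le]) (simp add: add_pos_nonneg)
  finally show ?thesis .
qed

lemma borel_measurable_radial_kernel:
  assumes "continuous_on UNIV f"
  shows "(\<lambda>u. radial_kernel t (f u)) \<in> borel_measurable borel"
proof -
  have "continuous_on UNIV (\<lambda>u. cheb_U m (f u))" for m
    by (induction m "0::real" rule: cheb_U.induct) (auto intro!: continuous_intros assms)
  then show ?thesis
    unfolding radial_kernel_def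
    by (intro borel_measurable_suminf borel_measurable_times borel_measurable_const borel_measurable_continuous_onI)
qed

text \<open>After \<open>y = \<surd>t u\<close> the integrand is \<open>E t u\<close> up to a relative error \<open>32 exp (- 2 / t)\<close>. \<open>E t u\<close> converges to a Gaussian in \<open>u\<close>
by the second-order expansion of the phase, and the lower bound for the phase dominates it.\<close>

theorem Gaussian_integral_Laplace:
  assumes k: "0 < k" "k < 1"
  shows "((\<lambda>t. 4 * t powr (3 / 2) * exp (geodesic_sq k / (4 * t)) / sqrt pi *
       (\<integral>y. exp (- y\<^sup>2 / (4 * t)) / sqrt (4 * pi * t) * radial_kernel t (k * cosh y) \<partial>lborel))
     \<longlongrightarrow> amplitude k / sqrt (1 - k * amplitude k)) (at_right 0)"
proof -
  define \<kappa> where "\<kappa> = 1 - k * amplitude k"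
  have \<kappa>: "0 < \<kappa>" using amplitude_times_less_1[OF k] by (simp add: \<kappa>_def)
  define c where "c = ln (2 / (1 + k))"
  have c: "0 < c" using k by (simp add: c_def)
  define A where "A t = 4 * t powr (3 / 2) * exp (geodesic_sq k / (4 * t)) / sqrt pi" for t
  define f where "f t y = exp (- y\<^sup>2 / (4 * t)) / sqrt (4 * pi * t) * radial_kernel t (k * cosh y)" for t y
  define g where "g t u = A t * sqrt t * f t (sqrt t * u)" for t u
  define h where "h y = y\<^sup>2 + geodesic_sq (k * cosh y) - geodesic_sq k" for y
  define E where "E t u = exp t / sqrt (4 * pi) * amplitude (k * cosh (sqrt t * u)) * exp (- h (sqrt t * u) / (4 * t))" for t u
  define G where "G u = amplitude k / sqrt (4 * pi) * exp (- (\<kappa> / 4) * u\<^sup>2)" for u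
  define C where "C = exp 1 / sqrt (4 * pi) * (1 / k) * 33"
  have C: "0 \<le> C" using k by (simp add: C_def)
  have scale: "A t * (\<integral>y. f t y \<partial>lborel) = (\<integral>u. g t u \<partial>lborel)" if t: "0 < t" for t
    using lborel_integral_real_affine[of "sqrt t" "f t" 0] t by (simp add: g_def)
  have g_E: "\<bar>g t u - E t u\<bar> \<le> 32 * exp (- 2 / t) * \<bar>E t u\<bar>" if t: "0 < t" "t \<le> 1" and ne: "k * cosh (sqrt t * u) \<noteq> 1" for t u
  proof -
    define y where "y = sqrt t * u"
    define x where "x = k * cosh y"
    have x: "0 < x" "x \<noteq> 1" using k ne by (auto simp: x_def y_def)
    obtain \<rho> where \<rho>: "\<bar>\<rho>\<bar> \<le> 32 * exp (- 2 / t)"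
      "radial_kernel t x = sqrt pi * exp t / (4 * t powr (3 / 2)) * (exp (- geodesic_sq x / (4 * t)) * amplitude x * (1 + \<rho>))"
      by (rule radial_kernel_small_time[OF t x])
    define T where "T = 4 * t powr (3 / 2)"
    have T: "T \<noteq> 0" using t by (simp add: T_def)
    have s: "sqrt t \<noteq> 0" using t by simp
    have "g t u = (T * exp (geodesic_sq k / (4 * t)) / sqrt pi) * sqrt t * (exp (- y\<^sup>2 / (4 * t)) / (sqrt (4 * pi) * sqrt t) *
        (sqrt pi * exp t / T * (exp (- geodesic_sq x / (4 * t)) * amplitude x * (1 + \<rho>))))"
      unfolding g_def A_def f_def y_def[symmetric] x_def[symmetric] \<rho>(2) T_def[symmetric] real_sqrt_mult[symmetric] ..
    also have "\<dots> = exp t / sqrt (4 * pi) * amplitude x * (exp (geodesic_sq k / (4 * t)) * exp (- y\<^sup>2 / (4 * t)) * exp (- geodesic_sq x / (4 * t))) * (1 + \<rho>)"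
      using T s by (simp add: divide_simps)
    also have "exp (geodesic_sq k / (4 * t)) * exp (- y\<^sup>2 / (4 * t)) * exp (- geodesic_sq x / (4 * t)) = exp (- h y / (4 * t))"
      unfolding exp_add[symmetric] h_def x_def by (simp add: diff_divide_distrib add_divide_distrib)
    finally have "g t u = E t u * (1 + \<rho>)" by (simp add: E_def y_def x_def)
    then have "\<bar>g t u - E t u\<bar> = \<bar>\<rho>\<bar> * \<bar>E t u\<bar>" by (simp add: distrib_left abs_mult)
    also have "\<dots> \<le> 32 * exp (- 2 / t) * \<bar>E t u\<bar>" by (intro mult_right_mono \<rho>) simp
    finally show ?thesis .
  qed
  have E_bound: "\<bar>E t u\<bar> \<le> exp 1 / sqrt (4 * pi) * (1 / k) * inverse (1 + (sqrt (c / 8) * u)\<^sup>2)"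
    if t: "0 < t" "t \<le> 1" "t \<le> c / 2" for t u
  proof -
    have x: "k \<le> k * cosh (sqrt t * u)" using k cosh_real_ge_1 by (simp add: mult_le_cancel_left1)
    then have x0: "0 < k * cosh (sqrt t * u)" using k by simp
    have "0 \<le> min 1 (1 / (k * cosh (sqrt t * u)))" using x0 by simp
    then have a0: "0 \<le> amplitude (k * cosh (sqrt t * u))" using amplitude_bounds(1)[OF x0] by linarith
    have "max 1 (1 / (k * cosh (sqrt t * u))) \<le> 1 / k" using x k x0 by (auto intro: divide_left_mono)
    then have a1: "amplitude (k * cosh (sqrt t * u)) \<le> 1 / k" using amplitude_bounds(2)[OF x0] by linarith
    have "2 * c * ln (cosh (sqrt t * u)) \<le> h (sqrt t * u)"
      using phase_lower_bound[OF k, of "sqrt t * u"] by (simp add: h_def c_def)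
    then have "exp (- h (sqrt t * u) / (4 * t)) \<le> exp (- (2 * c * ln (cosh (sqrt t * u))) / (4 * t))"
      unfolding exp_le_cancel_iff using t by (intro divide_right_mono) auto
    also have "\<dots> \<le> inverse (1 + (sqrt (c / 8) * u)\<^sup>2)" by (rule cosh_power_bound[OF t(1,3)])
    finally have e: "exp (- h (sqrt t * u) / (4 * t)) \<le> inverse (1 + (sqrt (c / 8) * u)\<^sup>2)" .
    have "\<bar>E t u\<bar> = exp t / sqrt (4 * pi) * amplitude (k * cosh (sqrt t * u)) * exp (- h (sqrt t * u) / (4 * t))"
      using a0 by (simp add: E_def abs_mult)
    also have "\<dots> \<le> exp 1 / sqrt (4 * pi) * (1 / k) * inverse (1 + (sqrt (c / 8) * u)\<^sup>2)"
      using t a0 a1 e k by (intro mult_mono divide_right_mono) auto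
    finally show ?thesis .
  qed
  \<comment> \<open>The exceptional points are those at which the distance changes from real to imaginary.\<close>
  have AE_ne: "AE u in lborel. k * cosh (sqrt t * u) \<noteq> 1" if t: "0 < t" for t
  proof -
    define u0 where "u0 = arcosh (1 / k) / sqrt t"
    have "AE u in lborel. u \<noteq> u0" "AE u in lborel. u \<noteq> - u0" by (rule AE_lborel_singleton)+
    then show ?thesis
    proof eventually_elim
      case (elim u)
      show ?case
      proof
        assume "k * cosh (sqrt t * u) = 1"
        then have "cosh \<bar>sqrt t * u\<bar> = 1 / k" using k by (simp add: field_simps)
        then have "\<bar>sqrt t * u\<bar> = arcosh (1 / k)" by (metis abs_ge_zero arcosh_cosh_real)
        then have "\<bar>u\<bar> = u0" using t by (simp add: u0_def abs_mult field_simps)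
        then show False using elim by auto
      qed
    qed
  qed
  have g_bound: "AE u in lborel. norm (g t u) \<le> C * inverse (1 + (sqrt (c / 8) * u)\<^sup>2)" if t: "0 < t" "t \<le> 1" "t \<le> c / 2" for t
    using AE_ne[OF t(1)]
  proof eventually_elim
    case (elim u)
    have "exp (- 2 / t) \<le> 1" using t by simp
    then have "32 * exp (- 2 / t) * \<bar>E t u\<bar> \<le> 32 * 1 * \<bar>E t u\<bar>" by (intro mult_right_mono mult_left_mono) auto
    then have "\<bar>g t u\<bar> \<le> 33 * \<bar>E t u\<bar>" using g_E[OF t(1,2) elim] by linarith
    also have "\<dots> \<le> 33 * (exp 1 / sqrt (4 * pi) * (1 / k) * inverse (1 + (sqrt (c / 8) * u)\<^sup>2))"
      by (intro mult_left_mono E_bound t) simp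
    finally show ?case by (simp add: C_def mult_ac)
  qed
  have g_lim: "((\<lambda>t. g t u) \<longlongrightarrow> G u) (at_right 0)" for u
  proof -
    have sq: "((\<lambda>t. sqrt t * u) \<longlongrightarrow> 0) (at_right 0)"
    proof -
      have "((\<lambda>t. sqrt t * u) \<longlongrightarrow> sqrt 0 * u) (at_right 0)" by (intro tendsto_intros)
      then show ?thesis by simp
    qed
    have kc: "((\<lambda>t. k * cosh (sqrt t * u)) \<longlongrightarrow> k * cosh 0) (at_right 0)" by (intro tendsto_intros sq)
    have ex: "((\<lambda>t. h (sqrt t * u) / (4 * t)) \<longlongrightarrow> \<kappa> / 4 * u\<^sup>2) (at_right 0)"
    proof (cases "u = 0")
      case True
      then show ?thesis by (simp add: h_def)
    next
      case False
      have fl: "filterlim (\<lambda>t. sqrt t * \<bar>u\<bar>) (at_right 0) (at_right 0)"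
      proof (rule tendsto_imp_filterlim_at_right)
        have "((\<lambda>t. sqrt t * \<bar>u\<bar>) \<longlongrightarrow> sqrt 0 * \<bar>u\<bar>) (at_right 0)" by (intro tendsto_intros)
        then show "((\<lambda>t. sqrt t * \<bar>u\<bar>) \<longlongrightarrow> 0) (at_right 0)" by simp
        show "eventually (\<lambda>t. 0 < sqrt t * \<bar>u\<bar>) (at_right 0)"
          using eventually_at_right_less[of 0] by eventually_elim (use False in simp)
      qed
      have "((\<lambda>t. h (sqrt t * \<bar>u\<bar>) / (sqrt t * \<bar>u\<bar>)\<^sup>2 * (u\<^sup>2 / 4)) \<longlongrightarrow> \<kappa> * (u\<^sup>2 / 4)) (at_right 0)"
        unfolding h_def \<kappa>_def by (intro tendsto_mult tendsto_const filterlim_compose[OF phase_quadratic_limit[OF k] fl])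
      then have "((\<lambda>t. h (sqrt t * \<bar>u\<bar>) / (sqrt t * \<bar>u\<bar>)\<^sup>2 * (u\<^sup>2 / 4)) \<longlongrightarrow> \<kappa> / 4 * u\<^sup>2) (at_right 0)" by simp
      then show ?thesis
      proof (rule Lim_transform_eventually)
        show "eventually (\<lambda>t. h (sqrt t * \<bar>u\<bar>) / (sqrt t * \<bar>u\<bar>)\<^sup>2 * (u\<^sup>2 / 4) = h (sqrt t * u) / (4 * t)) (at_right 0)"
          using eventually_at_right_less[of 0]
        proof eventually_elim
          case (elim t)
          have "h (sqrt t * \<bar>u\<bar>) = h (sqrt t * u)" by (simp add: h_def abs_if)
          moreover have "(sqrt t * \<bar>u\<bar>)\<^sup>2 = t * u\<^sup>2" using elim by (simp add: power_mult_distrib)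
          ultimately show ?case using elim False by (simp add: field_simps)
        qed
      qed
    qed
    have am: "((\<lambda>t. amplitude (k * cosh (sqrt t * u))) \<longlongrightarrow> amplitude k) (at_right 0)"
      using isCont_tendsto_compose[OF isCont_amplitude[OF k(1)]] kc by simp
    have "((\<lambda>t. exp t / sqrt (4 * pi) * amplitude (k * cosh (sqrt t * u)) * exp (- (h (sqrt t * u) / (4 * t)))) \<longlongrightarrow>
        exp 0 / sqrt (4 * pi) * amplitude k * exp (- (\<kappa> / 4 * u\<^sup>2))) (at_right 0)"
      by (intro tendsto_mult tendsto_exp tendsto_minus tendsto_divide tendsto_const am ex tendsto_ident_at) simp
    then have E_lim: "((\<lambda>t. E t u) \<longlongrightarrow> G u) (at_right 0)" by (simp add: E_def[abs_def] G_def)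
    have "((\<lambda>t. g t u - E t u) \<longlongrightarrow> 0) (at_right 0)"
    proof (rule Lim_null_comparison)
      have "eventually (\<lambda>t. k * cosh (sqrt t * u) < 1) (at_right 0)"
        using kc k by (intro order_tendstoD(2)[OF kc]) simp
      then show "eventually (\<lambda>t. norm (g t u - E t u) \<le> 32 * exp (- 2 / t) * \<bar>E t u\<bar>) (at_right 0)"
        using eventually_at_right_real[of 0 1, OF zero_less_one]
      proof eventually_elim
        case (elim t)
        then show ?case using g_E[of t u] by simp
      qed
      have "((\<lambda>t. 32 * exp (- 2 / t)) \<longlongrightarrow> 0) (at_right (0::real))" by real_asymp
      from tendsto_mult[OF this tendsto_rabs[OF E_lim]]
      show "((\<lambda>t. 32 * exp (- 2 / t) * \<bar>E t u\<bar>) \<longlongrightarrow> 0) (at_right 0)" by simp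
    qed
    from tendsto_add[OF this E_lim] show ?thesis by simp
  qed
  have f_meas: "(\<lambda>u. f t (sqrt t * u)) \<in> borel_measurable borel" for t
  proof -
    have [measurable]: "(\<lambda>u. radial_kernel t (k * cosh (sqrt t * u))) \<in> borel_measurable borel"
      by (intro borel_measurable_radial_kernel continuous_intros)
    show ?thesis unfolding f_def by measurable
  qed
  have g_meas: "g t \<in> borel_measurable lborel" for t
    unfolding g_def[abs_def] using f_meas by (intro borel_measurable_times) auto
  have dom: "integrable lborel (\<lambda>u. C * inverse (1 + (sqrt (c / 8) * u)\<^sup>2))"
  proof -
    have "integrable lborel (\<lambda>x::real. inverse (1 + x\<^sup>2))"
      using integrable_inverse_1_plus_square by (simp add: set_integrable_def)
    from lborel_integrable_real_affine[OF this, of "sqrt (c / 8)" 0] c show ?thesis by simp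
  qed
  have "((\<lambda>s. \<integral>u. g (inverse s) u \<partial>lborel) \<longlongrightarrow> (\<integral>u. G u \<partial>lborel)) at_top"
  proof (rule integral_dominated_convergence_at_top[where w = "\<lambda>u. C * inverse (1 + (sqrt (c / 8) * u)\<^sup>2)"])
    show "G \<in> borel_measurable lborel"
      unfolding G_def[abs_def] by measurable
    show "g (inverse t) \<in> borel_measurable lborel" for t by (rule g_meas)
    show "AE u in lborel. ((\<lambda>s. g (inverse s) u) \<longlongrightarrow> G u) at_top"
      using g_lim unfolding filterlim_at_right_to_top by simp
    show "\<forall>\<^sub>F s in at_top. AE u in lborel. norm (g (inverse s) u) \<le> C * inverse (1 + (sqrt (c / 8) * u)\<^sup>2)"
      using eventually_ge_at_top[of "max 1 (2 / c)"]
    proof eventually_elim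
      case (elim s)
      then have "1 \<le> s" "2 / c \<le> s" by auto
      then have "0 < inverse s" "inverse s \<le> 1" "inverse s \<le> c / 2" using c by (auto simp: field_simps)
      then show ?case by (rule g_bound)
    qed
  qed (rule dom)
  then have "((\<lambda>t. \<integral>u. g t u \<partial>lborel) \<longlongrightarrow> (\<integral>u. G u \<partial>lborel)) (at_right 0)"
    unfolding filterlim_at_right_to_top .
  moreover have "(\<integral>u. G u \<partial>lborel) = amplitude k / sqrt \<kappa>"
  proof -
    have "has_bochner_integral lborel (\<lambda>u. exp (- u\<^sup>2 / (4 * (1 / \<kappa>)) + 0 * u)) (sqrt (4 * pi * (1 / \<kappa>)) * exp (0\<^sup>2 * (1 / \<kappa>)))"
      by (rule real_Gaussian_moment) (use \<kappa> in simp)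
    then have "(\<integral>u. exp (- (\<kappa> / 4) * u\<^sup>2) \<partial>lborel) = sqrt (4 * pi) / sqrt \<kappa>"
      by (simp add: has_bochner_integral_iff real_sqrt_divide mult.commute)
    then show ?thesis by (simp add: G_def[abs_def])
  qed
  ultimately have "((\<lambda>t. \<integral>u. g t u \<partial>lborel) \<longlongrightarrow> amplitude k / sqrt \<kappa>) (at_right 0)" by simp
  then have "((\<lambda>t. A t * (\<integral>y. f t y \<partial>lborel)) \<longlongrightarrow> amplitude k / sqrt \<kappa>) (at_right 0)"
  proof (rule Lim_transform_eventually)
    show "eventually (\<lambda>t. (\<integral>u. g t u \<partial>lborel) = A t * (\<integral>y. f t y \<partial>lborel)) (at_right 0)"
      using eventually_at_right_less[of 0] by eventually_elim (simp add: scale)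
  qed
  then show ?thesis by (simp add: A_def f_def \<kappa>_def)
qed

theorem proposition3p10:
  fixes P :: "real \<Rightarrow> ((SU2 \<Rightarrow>\<^sub>C real) \<Rightarrow>\<^sub>L (SU2 \<Rightarrow>\<^sub>C real))"
    and p :: "real \<Rightarrow> SU2 \<Rightarrow> real"
    and r \<theta> :: real
  assumes "heat_semigroup P"
    and "heat_kernel P p"
    and "r \<in> {0<..<pi / 2}"
    and "\<theta> \<in> {0..2 * pi}"
  shows "(\<lambda>t. p t (cylindric r \<theta> 0)) \<sim>[at_right 0]
         (\<lambda>t. r / sin r * sqrt (1 / (1 - r * cot r)) *
              (sqrt pi * exp (- r\<^sup>2 / (4 * t)) / (4 * t powr (3 / 2))))"
proof -
  define k where "k = cos r"
  have r: "0 < r" "r < pi / 2" using assms(3) by auto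
  have sr: "0 < sin r" using r by (intro sin_gt_zero) auto
  have k: "0 < k" using r by (simp add: k_def cos_gt_zero)
  have k1: "k < 1" using cos_monotone_0_pi[of 0 r] r by (simp add: k_def)
  have ac: "arccos k = r" using r by (simp add: k_def arccos_cos)
  have sk: "sqrt (1 - k\<^sup>2) = sin r" using sr by (simp add: k_def sin_squared_eq[symmetric])
  have amp: "amplitude k = r / sin r" using k1 by (simp add: amplitude_def ac sk)
  have ph: "geodesic_sq k = r\<^sup>2" using k1 by (simp add: geodesic_sq_def ac)
  have \<kappa>: "1 - k * amplitude k = 1 - r * cot r" unfolding amp by (simp add: k_def cot_def)
  have \<kappa>0: "0 < 1 - r * cot r" using amplitude_times_less_1[OF k k1] unfolding \<kappa>[symmetric] by simp
  define I where "I t = (\<integral>y. exp (- y\<^sup>2 / (4 * t)) / sqrt (4 * pi * t) * radial_kernel t (k * cosh y) \<partial>lborel)" for t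
  have p: "p t (cylindric r \<theta> 0) = I t" if "0 < t" for t
  proof -
    have "complex_of_real (p t (cylindric r \<theta> 0)) = disc_kernel t (of_real k)"
      using heat_kernel_eq_disc_kernel[OF assms(1,2) that assms(3,4), of 0] by (simp add: k_def)
    also have "\<dots> = of_real (I t)" unfolding I_def by (rule disc_kernel_eq_Gaussian_integral[OF that k k1])
    finally show ?thesis by simp
  qed
  define b where "b = r / sin r * sqrt (1 / (1 - r * cot r))"
  have b: "0 < b" using r sr \<kappa>0 by (simp add: b_def)
  have "((\<lambda>t. 4 * t powr (3 / 2) * exp (r\<^sup>2 / (4 * t)) / sqrt pi * I t) \<longlongrightarrow> b) (at_right 0)"
    using Gaussian_integral_Laplace[OF k k1] unfolding ph \<kappa> unfolding amp I_def[symmetric]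
    by (simp add: b_def real_sqrt_divide)
  from tendsto_divide[OF this tendsto_const[of b]] b
  have lim: "((\<lambda>t. 4 * t powr (3 / 2) * exp (r\<^sup>2 / (4 * t)) / sqrt pi * I t / b) \<longlongrightarrow> 1) (at_right 0)" by simp
  show ?thesis
    unfolding b_def[symmetric]
  proof (rule asymp_equivI')
    show "((\<lambda>t. p t (cylindric r \<theta> 0) / (b * (sqrt pi * exp (- r\<^sup>2 / (4 * t)) / (4 * t powr (3 / 2))))) \<longlongrightarrow> 1) (at_right 0)"
    proof (rule Lim_transform_eventually[OF lim])
      show "eventually (\<lambda>t. 4 * t powr (3 / 2) * exp (r\<^sup>2 / (4 * t)) / sqrt pi * I t / b =
          p t (cylindric r \<theta> 0) / (b * (sqrt pi * exp (- r\<^sup>2 / (4 * t)) / (4 * t powr (3 / 2))))) (at_right 0)"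
        using eventually_at_right_less[of 0]
      proof eventually_elim
        case (elim t)
        then have "t powr (3 / 2) \<noteq> 0" by simp
        then show ?case using elim b by (simp add: p exp_minus field_simps)
      qed
    qed
  qed
qed

end
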